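(* Suppose that $m,n$ are integers with $n\ge 1$ and $m\in[0,n-1]$, let $\Lambda\subset\mathbf{R}^n$ be an $m$-dimensional hyperplane, $w\in\Lambda$, $p\in(n-m,\infty]$, and let $\beta=\frac{p-n+m}{p-1}$, with $\beta=1$ if $p=\infty$. Assume that $\Omega\subset\mathbf{R}^n$ is an unbounded domain satisfying $\Lambda\subseteq\complement\Omega\subseteq\Lambda_s$ for some $s>0$. Let $v_r$ be the $p$-harmonic measure of $\partial B(w,5r)\setminus\complement\Omega$ with respect to $B(w,5r)\cap\Omega$. Then there exists a constant $c=c(n,p)\ge 1$, depending only on $n$ and $p$, and independent of $p$ if $p$ is large, such that $$c^{-1}s^\beta\le v_r(A_{2s}(w))\,r^\beta\le c\,s^\beta$$ whenever $2s/\delta_c<r$, where $\delta_c\in(0,1)$ is the constant described in the context.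
   Context: Notation: a domain is an open connected set; $\complement\Omega=\mathbf{R}^n\setminus\Omega$; an $m$-dimensional hyperplane is an $m$-dimensional affine subspace of $\mathbf{R}^n$ (a point if $m=0$); $d(x,E)$ is Euclidean distance; $B(w,r)$ is the open ball with center $w$ and radius $r$; $\Lambda_s=\{x\in\mathbf{R}^n:d(x,\Lambda)\le s\}$, with interior $\Lambda_s^o$; $A_r(w)$ denotes a point with $d(A_r(w),\Lambda)=r$ and $A_r(w)\in\partial B(w,r)$. For $p\in(1,\infty)$, $u$ is a weak subsolution (supersolution) of the $p$-Laplace equation in an open set $G$ if $u\in W^{1,p}_{loc}(G)$ and $\int_G|\nabla u|^{p-2}\langle\nabla u,\nabla\theta\rangle\,dx\le(\ge)\,0$ for all non-negative $\theta\in C_0^\infty(G)$. A lower semicontinuous supersolution is called $p$-superharmonic. $p$-harmonic measure: let $G\subseteq\mathbf{R}^n$ be a domain, $E\subseteq\partial G$, $p\in(1,\infty)$ and $x\in G$. The $p$-harmonic measure of $E$ at $x$ with respect to $G$ is $\inf_u u(x)$, where the infimum is over all $p$-superharmonic functions $u\ge 0$ in $G$ such that $\liminf_{z\to y}u(z)\ge 1$ for all $y\in E$. The $\infty$-harmonic measure is defined in a similar manner, with "$p$-superharmonic" replaced by "absolutely minimizing" (a continuous function $u$ on $G$ is absolutely minimizing if for every bounded open $V$ with $\overline V\subset G$ the Lipschitz constant of $u$ on $V$ equals that of $u$ on $\partial V$). The function $v_r$ is $x\mapsto$ ($p$-harmonic measure at $x$). The constant $\delta_c$ is the one provided by the following lemma.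 Write $x=(x',x'')$ with $x'\in\mathbf{R}^{n-m}$, $x''\in\mathbf{R}^m$, and take $\Lambda=\{x:|x'|=0\}$. Let $m\in[1,n-2]$, $p\in(n-m,\infty)$, $\beta=(p-n+m)/(p-1)$ and $0<\gamma<\beta$. Then there exists $\delta_c\in(0,1)$, depending only on $n,\gamma$ and $p$, such that in $\{x:|x''|<1\}\cap\Lambda^o_{\delta_c}\setminus\Lambda$ the function $\hat u=|x'|^\beta+|x''|^2|x'|^\gamma-\frac12|x'|^2$ is a supersolution and $\check u=(1-|x''|^2)|x'|^\beta+|x'|$ is a subsolution of the $p$-Laplace equation. Moreover, if $\gamma>1/2$ then $\delta_c$ can be chosen independent of $p$ if $p$ is large.
   Formalization: A p-superharmonic function is taken to be the canonical lower semicontinuous representative (its value is the essential lower limit at each point); otherwise lowering it at one point would make every p-harmonic measure with finite p zero and the lower bound false. *)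

theory Defs
  imports "HOL-Analysis.Analysis"
begin

definition partial_deriv :: "'n::finite \<Rightarrow> (real^'n \<Rightarrow> real) \<Rightarrow> real^'n \<Rightarrow> real" where
  "partial_deriv i f x = frechet_derivative f (at x) (axis i 1)"

definition gradient :: "(real^'n::finite \<Rightarrow> real) \<Rightarrow> real^'n \<Rightarrow> real^'n" where
  "gradient f x = (\<chi> i. partial_deriv i f x)"

primrec C_class :: "nat \<Rightarrow> (real^'n::finite \<Rightarrow> real) \<Rightarrow> bool" where
  "C_class 0 f \<longleftrightarrow> continuous_on UNIV f"
| "C_class (Suc k) f \<longleftrightarrow> (\<forall>x. f differentiable at x) \<and> (\<forall>i. C_class k (partial_deriv i f))"

text \<open>The class \<open>C\<^sub>0\<^sup>\<infinity>(G)\<close>, its members being extended by zero to the whole space.\<close>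

definition test_function :: "(real^'n::finite) set \<Rightarrow> (real^'n \<Rightarrow> real) \<Rightarrow> bool" where
  "test_function G \<theta> \<longleftrightarrow>
     (\<forall>k. C_class k \<theta>) \<and> compact (closure {x. \<theta> x \<noteq> 0}) \<and> closure {x. \<theta> x \<noteq> 0} \<subseteq> G"

definition locally_Lp ::
  "real \<Rightarrow> (real^'n::finite) set \<Rightarrow> (real^'n \<Rightarrow> 'b::{banach,second_countable_topology}) \<Rightarrow> bool" where
  "locally_Lp p G f \<longleftrightarrow>
     set_borel_measurable lebesgue G f \<and>
     (\<forall>K. compact K \<and> K \<subseteq> G \<longrightarrow> set_integrable lebesgue K (\<lambda>x. norm (f x) powr p))"

text \<open>\<open>u\<close> belongs to \<open>W\<^sup>1\<^sup>,\<^sup>p\<^sub>l\<^sub>o\<^sub>c(G)\<close> and \<open>g\<close> is its distributional gradient.\<close>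

definition sobolev_loc_gradient ::
  "real \<Rightarrow> (real^'n::finite) set \<Rightarrow> (real^'n \<Rightarrow> real) \<Rightarrow> (real^'n \<Rightarrow> real^'n) \<Rightarrow> bool" where
  "sobolev_loc_gradient p G u g \<longleftrightarrow>
     locally_Lp p G u \<and> locally_Lp p G g \<and>
     (\<forall>\<theta> i. test_function G \<theta> \<longrightarrow>
        (LINT x:G|lebesgue. u x * partial_deriv i \<theta> x) = - (LINT x:G|lebesgue. g x $ i * \<theta> x))"

definition p_subsolution :: "real \<Rightarrow> (real^'n::finite) set \<Rightarrow> (real^'n \<Rightarrow> real) \<Rightarrow> bool" where
  "p_subsolution p G u \<longleftrightarrow>
     (\<exists>g. sobolev_loc_gradient p G u g \<and>
        (\<forall>\<theta>. test_function G \<theta> \<and> (\<forall>x. 0 \<le> \<theta> x) \<longrightarrow>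
           (LINT x:G|lebesgue. norm (g x) powr (p - 2) * (g x \<bullet> gradient \<theta> x)) \<le> 0))"

definition p_supersolution :: "real \<Rightarrow> (real^'n::finite) set \<Rightarrow> (real^'n \<Rightarrow> real) \<Rightarrow> bool" where
  "p_supersolution p G u \<longleftrightarrow>
     (\<exists>g. sobolev_loc_gradient p G u g \<and>
        (\<forall>\<theta>. test_function G \<theta> \<and> (\<forall>x. 0 \<le> \<theta> x) \<longrightarrow>
           (LINT x:G|lebesgue. norm (g x) powr (p - 2) * (g x \<bullet> gradient \<theta> x)) \<ge> 0))"

definition lower_semicontinuous_on :: "(real^'n::finite) set \<Rightarrow> (real^'n \<Rightarrow> real) \<Rightarrow> bool" where
  "lower_semicontinuous_on G u \<longleftrightarrow>
     (\<forall>x\<in>G. \<forall>a<u x. eventually (\<lambda>y. a < u y) (at x within G))"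

text \<open>
  A supersolution is an element of a Sobolev space, hence a class of functions modulo null sets;
  the third condition says that \<open>u\<close> is its canonical lower semicontinuous representative:
  together with lower semicontinuity it means that \<open>u(x)\<close> is the essential lower limit of \<open>u\<close>
  at every \<open>x \<in> G\<close>.  Lower semicontinuity alone would leave one free to decrease \<open>u\<close> at any single
  point, and every pointwise infimum of nonnegative such functions would then vanish.
\<close>

definition p_superharmonic :: "real \<Rightarrow> (real^'n::finite) set \<Rightarrow> (real^'n \<Rightarrow> real) \<Rightarrow> bool" where
  "p_superharmonic p G u \<longleftrightarrow>
     p_supersolution p G u \<and> lower_semicontinuous_on G u \<and>
     (\<forall>x\<in>G. \<forall>\<rho>>0. \<forall>a. (AE y in lebesgue. y \<in> ball x \<rho> \<inter> G \<longrightarrow> a \<le> u y) \<longrightarrow> a \<le> u x)"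

definition lipschitz_constant :: "(real^'n::finite) set \<Rightarrow> (real^'n \<Rightarrow> real) \<Rightarrow> ennreal" where
  "lipschitz_constant V u = (INF L \<in> {L. L-lipschitz_on V u}. ennreal L)"

definition absolutely_minimizing :: "(real^'n::finite) set \<Rightarrow> (real^'n \<Rightarrow> real) \<Rightarrow> bool" where
  "absolutely_minimizing G u \<longleftrightarrow>
     continuous_on G u \<and>
     (\<forall>V. open V \<and> bounded V \<and> closure V \<subseteq> G \<longrightarrow>
        lipschitz_constant V u = lipschitz_constant (frontier V) u)"

definition p_harmonic_measure ::
  "ereal \<Rightarrow> (real^'n::finite) set \<Rightarrow> (real^'n) set \<Rightarrow> real^'n \<Rightarrow> real" where
  "p_harmonic_measure p G E x =
     (INF u \<in> {u. (if p = \<infinity> then absolutely_minimizing G u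
                    else p_superharmonic (real_of_ereal p) G u) \<and>
                  (\<forall>z\<in>G. 0 \<le> u z) \<and>
                  (\<forall>y\<in>E. Liminf (at y within G) (\<lambda>z. ereal (u z)) \<ge> 1)}. u x)"

definition beta_exponent :: "nat \<Rightarrow> nat \<Rightarrow> ereal \<Rightarrow> real" where
  "beta_exponent n m p =
     (if p = \<infinity> then 1 else (real_of_ereal p - real n + real m) / (real_of_ereal p - 1))"

definition hyperplane_of_dim :: "nat \<Rightarrow> (real^'n::finite) set \<Rightarrow> bool" where
  "hyperplane_of_dim m \<Lambda> \<longleftrightarrow> affine \<Lambda> \<and> aff_dim \<Lambda> = int m"

definition tube :: "(real^'n::finite) set \<Rightarrow> real \<Rightarrow> (real^'n) set" where
  "tube \<Lambda> s = {x. infdist x \<Lambda> \<le> s}"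

text \<open>
  \<open>critical_delta TYPE('n) \<delta>\<close>: the function \<open>\<delta>\<close> of \<open>\<gamma>\<close> and \<open>p\<close> is an admissible choice of the constant
  \<open>\<delta>\<^sub>c\<close> in dimension \<open>n = CARD('n)\<close>.  The set \<open>K\<close> consists of the \<open>m\<close> indices of the coordinates
  making up \<open>x''\<close>, and \<open>- K\<close> of those making up \<open>x'\<close>.  The value at \<open>p = \<infinity>\<close> is, for \<open>\<gamma> > 1/2\<close>, the
  common value for all large \<open>p\<close>.
\<close>

definition critical_delta :: "'n::finite itself \<Rightarrow> (real \<Rightarrow> ereal \<Rightarrow> real) \<Rightarrow> bool" where
  "critical_delta (_ :: 'n itself) \<delta> \<longleftrightarrow>
     (\<forall>\<gamma> p. 0 < \<delta> \<gamma> p \<and> \<delta> \<gamma> p < 1) \<and>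
     (\<forall>(K :: 'n set) m (p :: real) \<gamma> \<beta>.
        card K = m \<and> 1 \<le> m \<and> m + 2 \<le> CARD('n) \<and>
        real CARD('n) - real m < p \<and> \<beta> = beta_exponent CARD('n) m (ereal p) \<and> 0 < \<gamma> \<and> \<gamma> < \<beta> \<longrightarrow>
        (let x' = (\<lambda>x :: real^'n. L2_set (\<lambda>i. x $ i) (- K));
             x'' = (\<lambda>x :: real^'n. L2_set (\<lambda>i. x $ i) K);
             \<Lambda> = {x. x' x = 0};
             D = {x. x'' x < 1} \<inter> interior (tube \<Lambda> (\<delta> \<gamma> (ereal p))) - \<Lambda>
         in p_supersolution p D
              (\<lambda>x. x' x powr \<beta> + (x'' x)\<^sup>2 * x' x powr \<gamma> - (1/2) * (x' x)\<^sup>2) \<and>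
            p_subsolution p D (\<lambda>x. (1 - (x'' x)\<^sup>2) * x' x powr \<beta> + x' x))) \<and>
     (\<forall>\<gamma>. 1/2 < \<gamma> \<and> \<gamma> < 1 \<longrightarrow> (\<exists>P :: real. \<forall>p \<ge> ereal P. \<delta> \<gamma> p = \<delta> \<gamma> \<infinity>))"

end

theory Submission
  imports Defs
begin

text \<open>
Let \<open>n = CARD('n)\<close>, \<open>d = n - m\<close>, \<open>R = 5r\<close>, \<open>G = B(w,R) \<inter> \<Omega>\<close>, and split \<open>x - w\<close> into its part
\<open>x'\<close> normal to \<open>\<Lambda>\<close> and its part \<open>x''\<close> along \<open>\<Lambda>\<close>, so that \<open>d(x,\<Lambda>) = |x'|\<close>.  The exponent \<open>\<beta>\<close> is
the one for which \<open>|x'|\<^sup>\<beta>\<close> is \<open>p\<close>-harmonic off \<open>\<Lambda>\<close>, and the estimate is obtained by comparing with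
perturbations of this function.

Lower bound, \<open>p < \<infinity>\<close>.  For \<open>b > \<beta>\<close> the \<open>p\<close>-Laplacian of \<open>|x'|\<^sup>b\<close> is strictly positive off \<open>\<Lambda>\<close>.  The function
\<open>(|x'|\<^sup>b - s\<^sup>b) / R\<^sup>b\<close> vanishes on the boundary of the tube and is at most \<open>1\<close> in the ball, so it lies
below every competitor \<open>u\<close> for the harmonic measure.  At the given point, where \<open>|x'| = 2s\<close>, letting
\<open>b \<rightarrow> \<beta>\<close> leaves \<open>(2\<^sup>\<beta> - 1) (s / R)\<^sup>\<beta>\<close> (\<open>p_superharmonic_lower_bound\<close>).
The comparison of a strict smooth subsolution \<open>\<phi>\<close> with a \<open>p\<close>-superharmonic \<open>u\<close>
(\<open>strict_subsolution_le_p_superharmonic\<close>) takes \<open>flat (\<phi> - e - u\<^sub>\<epsilon>)\<close> as test function, where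
\<open>flat\<close> is smooth, zero on the negative axis and increasing after it, and \<open>u\<^sub>\<epsilon>\<close> is a mollification of \<open>u\<close>.
The mollified weak gradients converge locally in \<open>L\<^sup>p\<close> and the flux \<open>\<xi> \<mapsto> |\<xi>|\<^sup>p\<^sup>-\<^sup>2 \<xi>\<close> is monotone, so in the
limit the integral of \<open>\<Delta>\<^sub>p\<phi> flat (\<phi> - e - u)\<close> is at most zero.  As \<open>\<Delta>\<^sub>p\<phi> > 0\<close>, this forces
\<open>\<phi> - e \<le> u\<close> almost everywhere.

Upper bound, \<open>p < \<infinity>\<close>.  One competitor suffices, but it must be at least \<open>1\<close> on the sphere even next to
\<open>\<Lambda>\<close>, where \<open>|x'|\<^sup>\<beta>\<close> is small.  With lengths measured in units of \<open>R\<close> take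
\<open>a |x'|\<^sup>\<beta> - |x'|\<^sup>2\<^sup>-\<^sup>\<beta> - k |x'|\<^sup>2 + |x''|\<^sup>2\<close>.
The last term lifts the function to \<open>1\<close> on the sphere.  Up to a common factor it adds to the \<open>p\<close>-Laplacian positive
terms, one as singular as \<open>|x'|\<^sup>\<beta>\<^sup>-\<^sup>2\<close> at \<open>\<Lambda>\<close> and one growing linearly in \<open>p\<close>; the second term absorbs the
former and the third term the latter once \<open>a\<close> is large (\<open>powr_combination_inequality\<close>).  The given point
has \<open>x'' = 0\<close>, so there the barrier is at most \<open>a (2s / R)\<^sup>\<beta>\<close>.  The number \<open>a\<close> depends only on \<open>n\<close> and on
lower bounds for \<open>\<beta>\<close> and \<open>p - 1\<close>, which makes the constant uniform for large \<open>p\<close>.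

For \<open>p = \<infinity>\<close> cones replace these functions.  The cone \<open>|x - w| / R\<close> is a competitor.  Conversely, every
competitor lies above the cone with value \<open>1\<close> at the point where the ray from \<open>w\<close> through the given
point leaves the ball and value \<open>0\<close> at distance \<open>R - s\<close> from there, because the ball of that radius
misses the tube.
\<close>

section \<open>Derivatives and smooth functions on open sets\<close>

lemma partial_deriv_eq: "(f has_derivative f') (at x) \<Longrightarrow> partial_deriv i f x = f' (axis i 1)"
  unfolding partial_deriv_def using frechet_derivative_at by metis

lemma gradient_component: "gradient f x $ i = partial_deriv i f x"
  by (simp add: gradient_def)

lemma has_derivative_gradient:
  fixes f :: "real^'n::finite \<Rightarrow> real"
  assumes "f differentiable at x"
  shows "(f has_derivative (\<lambda>h. gradient f x \<bullet> h)) (at x)"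
proof -
  obtain f' where f': "(f has_derivative f') (at x)"
    using assms differentiable_def by blast
  then interpret linear f' by (rule has_derivative_linear)
  have "f' h = gradient f x \<bullet> h" for h
  proof -
    have "f' h = f' (\<Sum>i\<in>UNIV. (h $ i) *\<^sub>R axis i 1)"
      by (metis basis_expansion scalar_mult_eq_scaleR)
    also have "\<dots> = (\<Sum>i\<in>UNIV. h $ i * f' (axis i 1))"
      by (simp add: sum scale)
    also have "\<dots> = gradient f x \<bullet> h"
      by (simp add: inner_vec_def gradient_component partial_deriv_eq[OF f'] mult.commute)
    finally show ?thesis .
  qed
  then have "f' = (\<lambda>h. gradient f x \<bullet> h)" by auto
  with f' show ?thesis by simp
qed

lemma gradient_unique:
  fixes f :: "real^'n::finite \<Rightarrow> real"
  assumes "(f has_derivative (\<lambda>h. v \<bullet> h)) (at x)"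
  shows "gradient f x = v"
  by (simp add: vec_eq_iff gradient_component partial_deriv_eq[OF assms] inner_axis)

lemma partial_deriv_cong_open:
  assumes "open U" "x \<in> U" "\<And>y. y \<in> U \<Longrightarrow> f y = g y"
  shows "partial_deriv i f x = partial_deriv i g x"
proof -
  have "(f has_derivative F) (at x) = (g has_derivative F) (at x)" for F
    using assms has_derivative_transform_within_open[of _ F x UNIV U] by metis
  then show ?thesis by (simp add: partial_deriv_def frechet_derivative_def)
qed

lemma differentiable_cong_open:
  assumes "open U" "x \<in> U" "\<And>y. y \<in> U \<Longrightarrow> f y = g y" "f differentiable at x"
  shows "g differentiable at x"
  using assms has_derivative_transform_within_open[of f _ x UNIV U g]
  unfolding differentiable_def by metis

text \<open>
The localization of \<open>C_class\<close> to a set.  Test functions arise from pieces that are smooth on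
overlapping open sets, one of them the complement of the support.
\<close>

primrec Ck_on :: "nat \<Rightarrow> (real^'n::finite) set \<Rightarrow> (real^'n \<Rightarrow> real) \<Rightarrow> bool" where
  "Ck_on 0 U f \<longleftrightarrow> continuous_on U f"
| "Ck_on (Suc k) U f \<longleftrightarrow> (\<forall>x\<in>U. f differentiable at x) \<and> (\<forall>i. Ck_on k U (partial_deriv i f))"

definition smooth_on :: "(real^'n::finite) set \<Rightarrow> (real^'n \<Rightarrow> real) \<Rightarrow> bool" where
  "smooth_on U f \<longleftrightarrow> (\<forall>k. Ck_on k U f)"

lemma C_class_iff: "C_class k f \<longleftrightarrow> Ck_on k UNIV f"
  by (induction k arbitrary: f) auto

lemma Ck_on_cong:
  assumes "open U" "\<And>y. y \<in> U \<Longrightarrow> f y = g y"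
  shows "Ck_on k U f = Ck_on k U g"
  using assms(2)
proof (induction k arbitrary: f g)
  case 0
  then show ?case by (simp cong: continuous_on_cong)
next
  case (Suc k)
  have "Ck_on k U (partial_deriv i f) = Ck_on k U (partial_deriv i g)" for i
    by (rule Suc.IH) (rule partial_deriv_cong_open[OF assms(1)], auto simp: Suc.prems)
  moreover have "(\<forall>x\<in>U. f differentiable at x) = (\<forall>x\<in>U. g differentiable at x)"
    using differentiable_cong_open[OF assms(1), of _ f g] differentiable_cong_open[OF assms(1), of _ g f] Suc.prems
    by auto
  ultimately show ?case by simp
qed

lemma Ck_on_continuous: "Ck_on k U f \<Longrightarrow> continuous_on U f"
  by (cases k) (auto intro!: continuous_at_imp_continuous_on differentiable_imp_continuous_within)

lemma Ck_on_Suc_imp: "Ck_on (Suc k) U f \<Longrightarrow> Ck_on k U f"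
proof (induction k arbitrary: f)
  case 0
  then show ?case using Ck_on_continuous[of "Suc 0" U f] by simp
next
  case (Suc k)
  have "(\<forall>x\<in>U. f differentiable at x) \<and> (\<forall>i. Ck_on (Suc k) U (partial_deriv i f))"
    using Suc.prems by (rule Ck_on.simps(2)[of "Suc k", THEN iffD1])
  then show ?case using Suc.IH Ck_on.simps(2)[of k] by blast
qed

lemma Ck_on_mono: "Ck_on k U f \<Longrightarrow> V \<subseteq> U \<Longrightarrow> Ck_on k V f"
  by (induction k arbitrary: f) (auto intro: continuous_on_subset)

lemma Ck_on_Un: "open U \<Longrightarrow> open V \<Longrightarrow> Ck_on k U f \<Longrightarrow> Ck_on k V f \<Longrightarrow> Ck_on k (U \<union> V) f"
  by (induction k arbitrary: f) (auto intro: continuous_on_open_Un)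

lemma Ck_on_const: "Ck_on k U (\<lambda>x. c)"
proof (induction k arbitrary: c)
  case (Suc k)
  have "partial_deriv i (\<lambda>x. c) = (\<lambda>x. 0)" for i :: 'a
    by (rule ext) (simp add: partial_deriv_eq[OF has_derivative_const])
  then show ?case using Suc by simp
qed simp

lemma Ck_on_add:
  assumes "open U" "Ck_on k U f" "Ck_on k U g"
  shows "Ck_on k U (\<lambda>x. f x + g x)"
  using assms(2,3)
proof (induction k arbitrary: f g)
  case (Suc k)
  have "partial_deriv i (\<lambda>x. f x + g x) x = partial_deriv i f x + partial_deriv i g x" if "x \<in> U" for x i
  proof -
    have "f differentiable at x" "g differentiable at x" using Suc.prems that by auto
    from partial_deriv_eq[OF has_derivative_add[OF this[THEN has_derivative_gradient]]]
    show ?thesis by (simp add: inner_axis gradient_component)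
  qed
  moreover have "Ck_on k U (\<lambda>x. partial_deriv i f x + partial_deriv i g x)" for i
    using Suc by simp
  ultimately have "Ck_on k U (partial_deriv i (\<lambda>x. f x + g x))" for i
    by (subst Ck_on_cong[OF assms(1)]) auto
  with Suc.prems show ?case by simp
qed (auto intro: continuous_intros)

lemma Ck_on_mult:
  assumes "open U" "Ck_on k U f" "Ck_on k U g"
  shows "Ck_on k U (\<lambda>x. f x * g x)"
  using assms(2,3)
proof (induction k arbitrary: f g)
  case (Suc k)
  have "partial_deriv i (\<lambda>x. f x * g x) x = f x * partial_deriv i g x + partial_deriv i f x * g x"
    if "x \<in> U" for x i
  proof -
    have "f differentiable at x" "g differentiable at x" using Suc.prems that by auto
    from partial_deriv_eq[OF has_derivative_mult[OF this[THEN has_derivative_gradient]]]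
    show ?thesis by (simp add: inner_axis gradient_component)
  qed
  moreover have "Ck_on k U (\<lambda>x. f x * partial_deriv i g x + partial_deriv i f x * g x)" for i
    using Suc Ck_on_Suc_imp[of k U f] Ck_on_Suc_imp[of k U g] by (intro Ck_on_add assms(1)) auto
  ultimately have "Ck_on k U (partial_deriv i (\<lambda>x. f x * g x))" for i
    by (subst Ck_on_cong[OF assms(1)]) auto
  with Suc.prems show ?case by simp
qed (auto intro: continuous_intros)

text \<open>
The tower \<open>h\<close> of successive derivatives lets the induction on the order run through all of
\<open>h j \<circ> f\<close> at once.
\<close>

lemma Ck_on_compose_real:
  fixes h :: "nat \<Rightarrow> real \<Rightarrow> real"
  assumes "open U" and h: "\<And>j t. t \<in> T \<Longrightarrow> (h j has_real_derivative h (Suc j) t) (at t)"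
    and "f ` U \<subseteq> T" and "Ck_on k U f"
  shows "Ck_on k U (\<lambda>x. h j (f x))"
  using assms(4)
proof (induction k arbitrary: j)
  case 0
  have "continuous_on T (h j)"
    using h by (meson DERIV_isCont continuous_at_imp_continuous_on)
  then show ?case using 0 assms(3) continuous_on_compose2 by fastforce
next
  case (Suc k)
  have D: "((\<lambda>x. h j (f x)) has_derivative (\<lambda>v. (gradient f x \<bullet> v) * h (Suc j) (f x))) (at x)" if "x \<in> U" for x
  proof -
    have "f differentiable at x" using Suc.prems that by auto
    moreover have "(h j has_real_derivative h (Suc j) (f x)) (at (f x))" using h assms(3) that by auto
    ultimately show ?thesis
      using DERIV_compose_FDERIV has_derivative_gradient by blast
  qed
  then have "partial_deriv i (\<lambda>x. h j (f x)) x = partial_deriv i f x * h (Suc j) (f x)" if "x \<in> U" for x i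
    using partial_deriv_eq[OF D[OF that], of i] that by (simp add: inner_axis gradient_component)
  moreover have "Ck_on k U (\<lambda>x. partial_deriv i f x * h (Suc j) (f x))" for i
    using Suc.IH[OF Ck_on_Suc_imp[OF Suc.prems], of "Suc j"] Suc.prems by (intro Ck_on_mult assms(1)) auto
  ultimately have "Ck_on k U (partial_deriv i (\<lambda>x. h j (f x)))" for i
    by (subst Ck_on_cong[OF assms(1)]) auto
  moreover have "\<forall>x\<in>U. (\<lambda>x. h j (f x)) differentiable at x"
    using D differentiable_def by blast
  ultimately show ?case by simp
qed

lemma Ck_on_affine:
  assumes "open U" shows "Ck_on k U (\<lambda>x. v \<bullet> (x - w))"
proof (cases k)
  case 0
  then show ?thesis by (auto intro!: continuous_intros)
next
  case (Suc l)
  have D: "((\<lambda>x. v \<bullet> (x - w)) has_derivative (\<lambda>h. v \<bullet> h)) (at x)" for x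
    by (auto intro!: derivative_eq_intros)
  then have "partial_deriv i (\<lambda>x. v \<bullet> (x - w)) = (\<lambda>x. v $ i)" for i
    by (auto simp: partial_deriv_eq[OF D] inner_axis)
  then show ?thesis using Suc D Ck_on_const by (auto simp: differentiable_def)
qed

lemma Ck_on_sum:
  assumes "open U" "finite B" "\<And>b. b \<in> B \<Longrightarrow> Ck_on k U (f b)"
  shows "Ck_on k U (\<lambda>x. \<Sum>b\<in>B. f b x)"
  using assms(2,3) by (induction B rule: finite_induct) (simp_all add: Ck_on_const Ck_on_add assms(1))

lemma smooth_on_subset: "smooth_on U f \<Longrightarrow> V \<subseteq> U \<Longrightarrow> smooth_on V f"
  unfolding smooth_on_def using Ck_on_mono by blast

lemma smooth_on_cong: "open U \<Longrightarrow> (\<And>y. y \<in> U \<Longrightarrow> f y = g y) \<Longrightarrow> smooth_on U f = smooth_on U g"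
  unfolding smooth_on_def using Ck_on_cong by blast

lemma smooth_on_add: "open U \<Longrightarrow> smooth_on U f \<Longrightarrow> smooth_on U g \<Longrightarrow> smooth_on U (\<lambda>x. f x + g x)"
  unfolding smooth_on_def using Ck_on_add by blast

lemma smooth_on_mult: "open U \<Longrightarrow> smooth_on U f \<Longrightarrow> smooth_on U g \<Longrightarrow> smooth_on U (\<lambda>x. f x * g x)"
  unfolding smooth_on_def using Ck_on_mult by blast

lemma smooth_on_const: "smooth_on U (\<lambda>x. c)"
  unfolding smooth_on_def using Ck_on_const by blast

lemma smooth_on_diff:
  assumes "open U" "smooth_on U f" "smooth_on U g" shows "smooth_on U (\<lambda>x. f x - g x)"
proof -
  have "smooth_on U (\<lambda>x. f x + (- 1) * g x)"
    by (intro smooth_on_add smooth_on_mult smooth_on_const assms)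
  then show ?thesis by simp
qed

lemma smooth_on_partial_deriv: "smooth_on U f \<Longrightarrow> smooth_on U (partial_deriv i f)"
  unfolding smooth_on_def using Ck_on.simps(2) by blast

lemma smooth_on_differentiable: "smooth_on U f \<Longrightarrow> x \<in> U \<Longrightarrow> f differentiable at x"
  unfolding smooth_on_def using Ck_on.simps(2)[of 0 U f] by blast

lemma smooth_on_continuous: "smooth_on U f \<Longrightarrow> continuous_on U f"
  unfolding smooth_on_def using Ck_on_continuous by blast

lemma smooth_on_continuous_gradient: "smooth_on U f \<Longrightarrow> continuous_on U (gradient f)"
  unfolding gradient_def
  by (intro continuous_on_vec_lambda smooth_on_continuous smooth_on_partial_deriv)

lemma smooth_on_compose_real:
  fixes h :: "nat \<Rightarrow> real \<Rightarrow> real"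
  assumes "open U" "\<And>j t. t \<in> T \<Longrightarrow> (h j has_real_derivative h (Suc j) t) (at t)"
    and "f ` U \<subseteq> T" and "smooth_on U f"
  shows "smooth_on U (\<lambda>x. h j (f x))"
  unfolding smooth_on_def
proof
  fix k show "Ck_on k U (\<lambda>x. h j (f x))"
    by (rule Ck_on_compose_real[where T=T and h=h]) (use assms in \<open>auto simp: smooth_on_def\<close>)
qed

lemma smooth_on_sum_squares:
  fixes B :: "(real^'n::finite) set"
  assumes "open U" "finite B" shows "smooth_on U (\<lambda>x. \<Sum>b\<in>B. (b \<bullet> (x - w))\<^sup>2)"
  unfolding smooth_on_def power2_eq_square
  by (intro allI Ck_on_sum Ck_on_mult Ck_on_affine assms)

lemma smooth_on_powr:
  assumes "open U" "smooth_on U f" "\<And>x. x \<in> U \<Longrightarrow> f x > 0"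
  shows "smooth_on U (\<lambda>x. f x powr a)"
proof -
  define h where "h j t = (\<Prod>i<j. a - real i) * t powr (a - real j)" for j and t :: real
  have "(h j has_real_derivative h (Suc j) t) (at t)" if "t \<in> {0<..}" for j t
    unfolding h_def using that
    by (auto intro!: derivative_eq_intros simp: algebra_simps)
  then have "smooth_on U (\<lambda>x. h 0 (f x))"
    by (rule smooth_on_compose_real[where T="{0<..}" and h=h, OF assms(1) _ _ assms(2)]) (use assms(3) in auto)
  then show ?thesis by (simp add: h_def)
qed

section \<open>A flat smooth function\<close>

definition flat :: "real \<Rightarrow> real" where
  "flat t = (if t \<le> 0 then 0 else exp (- (1 / t)))"

text \<open>
Differentiating \<open>P(1/t) exp(-1/t)\<close> replaces the polynomial \<open>P\<close> by \<open>X\<^sup>2 (P - P')\<close>.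
\<close>

definition flat_poly :: "nat \<Rightarrow> real poly" where
  "flat_poly j = ((\<lambda>P. [:0, 0, 1:] * (P - pderiv P)) ^^ j) 1"

definition flat_deriv :: "nat \<Rightarrow> real \<Rightarrow> real" where
  "flat_deriv j t = (if t \<le> 0 then 0 else poly (flat_poly j) (1 / t) * exp (- (1 / t)))"

lemma tendsto_poly_exp_0: "((\<lambda>x::real. poly P x * exp (- x)) \<longlongrightarrow> 0) at_top"
proof -
  have "((\<lambda>x. \<Sum>i\<le>degree P. coeff P i * (x ^ i / exp x)) \<longlongrightarrow> (\<Sum>i\<le>degree P. coeff P i * 0)) at_top"
    by (intro tendsto_intros tendsto_power_div_exp_0)
  then show ?thesis
    by (simp add: poly_altdef sum_distrib_right exp_minus divide_inverse mult.assoc)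
qed

text \<open>
At \<open>t = 0\<close> the right difference quotient is again a polynomial in \<open>1/t\<close> times \<open>exp(-1/t)\<close>, which
tends to \<open>0\<close>.
\<close>

lemma flat_deriv_has_derivative:
  "(flat_deriv j has_real_derivative flat_deriv (Suc j) t) (at t)"
proof -
  consider "t < 0" | "t = 0" | "t > 0" by linarith
  then show ?thesis
  proof cases
    case 1
    have "((\<lambda>x. 0) has_real_derivative 0) (at t)" by simp
    then have "(flat_deriv j has_real_derivative 0) (at t)"
      by (rule has_field_derivative_transform_within_open[of _ _ _ "{..<0}"])
        (use 1 in \<open>auto simp: flat_deriv_def\<close>)
    then show ?thesis using 1 by (simp add: flat_deriv_def)
  next
    case 3
    have "((\<lambda>t. poly (flat_poly j) (1 / t) * exp (- (1 / t))) has_real_derivative flat_deriv (Suc j) t) (at t)"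
      using 3 by (auto intro!: derivative_eq_intros DERIV_chain2[OF poly_DERIV] simp: flat_deriv_def flat_poly_def field_simps power2_eq_square)
    then show ?thesis
      by (rule has_field_derivative_transform_within_open[of _ _ _ "{0<..}"])
        (use 3 in \<open>auto simp: flat_deriv_def\<close>)
  next
    case 2
    have "((\<lambda>x. poly ([:0,1:] * flat_poly j) x * exp (- x)) \<longlongrightarrow> 0) at_top"
      by (rule tendsto_poly_exp_0)
    moreover have "filterlim (\<lambda>y::real. inverse y) at_top (at_right 0)"
      by (rule filterlim_inverse_at_top_right)
    ultimately have "((\<lambda>y. poly ([:0,1:] * flat_poly j) (inverse y) * exp (- inverse y)) \<longlongrightarrow> 0) (at_right 0)"
      by (rule filterlim_compose)
    moreover have "eventually (\<lambda>y. poly ([:0,1:] * flat_poly j) (inverse y) * exp (- inverse y) = (flat_deriv j y - flat_deriv j 0) / (y - 0)) (at_right 0)"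
      by (auto simp: eventually_at_right_less flat_deriv_def field_simps eventually_at intro!: exI[of _ 1])
    ultimately have R: "((\<lambda>y. (flat_deriv j y - flat_deriv j 0) / (y - 0)) \<longlongrightarrow> 0) (at_right 0)"
      by (rule Lim_transform_eventually)
    have "eventually (\<lambda>y. 0 = (flat_deriv j y - flat_deriv j 0) / (y - 0)) (at_left 0)"
      by (auto simp: flat_deriv_def eventually_at intro!: exI[of _ 1])
    then have "((\<lambda>y. (flat_deriv j y - flat_deriv j 0) / (y - 0)) \<longlongrightarrow> 0) (at_left 0)"
      by (rule Lim_transform_eventually[OF tendsto_const])
    with R have "(flat_deriv j has_real_derivative 0) (at 0)"
      unfolding has_field_derivative_iff by (simp add: filterlim_split_at_real)
    then show ?thesis using 2 by (simp add: flat_deriv_def)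
  qed
qed

lemma flat_eq: "flat = flat_deriv 0"
  by (auto simp: flat_def flat_deriv_def flat_poly_def)

lemma smooth_on_flat:
  assumes "open U" "smooth_on U f" shows "smooth_on U (\<lambda>x. flat (f x))"
  unfolding flat_eq
  by (rule smooth_on_compose_real[where T=UNIV and h=flat_deriv, OF assms(1) flat_deriv_has_derivative _ assms(2)]) auto

lemma flat_nonneg: "flat t \<ge> 0" and flat_pos_iff: "flat t > 0 \<longleftrightarrow> t > 0"
  and flat_zero: "t \<le> 0 \<Longrightarrow> flat t = 0" and flat_deriv1_nonneg: "flat_deriv 1 t \<ge> 0"
  by (auto simp: flat_def flat_deriv_def flat_poly_def)

lemma flat_has_derivative: "(flat has_real_derivative flat_deriv 1 t) (at t)"
  using flat_deriv_has_derivative[of 0 t] by (simp add: flat_eq)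

lemma continuous_on_flat_deriv: "continuous_on S (flat_deriv j)"
  using flat_deriv_has_derivative by (meson DERIV_isCont continuous_at_imp_continuous_on)

text \<open>
With \<open>z = 1/t\<close> the derivative is \<open>z\<^sup>2 exp(-z)\<close>, and \<open>exp z \<ge> z\<^sup>2/2\<close>.  The bound is global, so
composition with \<open>flat\<close> preserves convergence in \<open>L\<^sup>1\<close>.
\<close>

lemma flat_deriv1_le_2: "flat_deriv 1 t \<le> 2"
proof (cases "t \<le> 0")
  case False
  define z where "z = 1 / t"
  have z: "z > 0" using False by (simp add: z_def)
  have "1 + z + z\<^sup>2 / 2 \<le> exp z" using z by (intro exp_lower_Taylor_quadratic) simp
  then have "z * z \<le> 2 * exp z" using z by (simp add: power2_eq_square)
  then have "z * z * exp (- z) \<le> 2" by (simp add: exp_minus field_simps)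
  then show ?thesis using False by (simp add: flat_deriv_def flat_poly_def z_def)
qed (simp add: flat_deriv_def)

lemma flat_lipschitz: "\<bar>flat s - flat t\<bar> \<le> 2 * \<bar>s - t\<bar>"
proof -
  have "norm (flat s - flat t) \<le> 2 * norm (s - t)"
    by (rule field_differentiable_bound[of UNIV flat "flat_deriv 1"])
      (auto simp: flat_has_derivative flat_deriv1_le_2 flat_deriv1_nonneg simp del: One_nat_def)
  then show ?thesis by simp
qed

lemma flat_le_1: "flat t \<le> 1" by (simp add: flat_def)

section \<open>Integration by parts and classical supersolutions\<close>

lemma set_integrable_compact:
  fixes f :: "real^'n::finite \<Rightarrow> 'b::{banach, second_countable_topology}"
  assumes "compact K" "continuous_on K f"
  shows "set_integrable lebesgue K f"
proof -
  have i: "integrable lborel (\<lambda>x. indicator K x *\<^sub>R f x)"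
    using assms by (rule borel_integrable_compact)
  then show ?thesis
    unfolding set_integrable_def using borel_measurable_integrable[OF i]
    by (subst integrable_completion) auto
qed

text \<open>
Difference quotients of a compactly supported function integrate to zero by translation invariance;
they converge boundedly to the partial derivative.
\<close>

lemma integral_partial_deriv_eq_0:
  fixes \<psi> :: "real^'n::finite \<Rightarrow> real"
  assumes diff: "\<And>x. \<psi> differentiable at x" and cont: "continuous_on UNIV (partial_deriv i \<psi>)"
    and K: "compact K" and supp: "\<And>x. x \<notin> K \<Longrightarrow> \<psi> x = 0"
  shows "(LINT x|lebesgue. partial_deriv i \<psi> x) = 0"
proof -
  define e :: "real^'n" where "e = axis i 1"
  have e1: "norm e = 1" by (simp add: e_def)
  have line: "((\<lambda>t. \<psi> (x + t *\<^sub>R e)) has_real_derivative partial_deriv i \<psi> (x + t *\<^sub>R e)) (at t)" for x t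
  proof -
    have "((\<lambda>t. \<psi> (x + t *\<^sub>R e)) has_derivative (\<lambda>s. gradient \<psi> (x + t *\<^sub>R e) \<bullet> (s *\<^sub>R e))) (at t)"
      by (rule has_derivative_compose[OF _ has_derivative_gradient[OF diff], where f="\<lambda>t. x + t *\<^sub>R e"])
        (auto intro!: derivative_eq_intros)
    then show ?thesis
      by (simp add: has_field_derivative_def e_def inner_axis gradient_component mult.commute[of _ "partial_deriv i _ _"])
  qed
  obtain M0 where "\<forall>x\<in>K. norm x \<le> M0"
    using compact_imp_bounded[OF K] bounded_iff by blast
  then obtain M where M: "K \<subseteq> cball 0 M" "M \<ge> 0"
    by (intro that[of "\<bar>M0\<bar>"]) force+
  have "compact (partial_deriv i \<psi> ` cball 0 (M + 2))"
    by (intro compact_continuous_image continuous_on_subset[OF cont]) auto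
  then obtain L0 where L0: "\<And>x. x \<in> cball 0 (M + 2) \<Longrightarrow> \<bar>partial_deriv i \<psi> x\<bar> \<le> L0"
    by (metis bounded_iff compact_imp_bounded imageI real_norm_def)
  define h where "h n = 1 / real (Suc n)" for n
  have h: "0 < h n" "h n \<le> 1" for n by (auto simp: h_def)
  define Q where "Q n x = (\<psi> (x + h n *\<^sub>R e) - \<psi> x) / h n" for n x
  have mvt: "\<exists>t. 0 < t \<and> t < h n \<and> Q n x = partial_deriv i \<psi> (x + t *\<^sub>R e)" for n x
  proof -
    have "\<exists>t. 0 < t \<and> t < h n \<and> \<psi> (x + h n *\<^sub>R e) - \<psi> (x + 0 *\<^sub>R e) = (h n - 0) * partial_deriv i \<psi> (x + t *\<^sub>R e)"
      by (rule MVT2[OF h(1), where f="\<lambda>t. \<psi> (x + t *\<^sub>R e)"]) (rule line)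
    then show ?thesis unfolding Q_def using h(1)[of n] by (auto simp: field_simps)
  qed
  have Q_bound: "\<bar>Q n x\<bar> \<le> indicator (cball 0 (M + 1)) x *\<^sub>R \<bar>L0\<bar>" for n x
  proof (cases "norm x \<le> M + 1")
    case True
    obtain t where t: "0 < t" "t < h n" "Q n x = partial_deriv i \<psi> (x + t *\<^sub>R e)" using mvt by blast
    have "norm (x + t *\<^sub>R e) \<le> norm x + norm (t *\<^sub>R e)" by (rule norm_triangle_ineq)
    also have "\<dots> \<le> M + 2" using t h(2)[of n] True e1 by simp
    finally have "\<bar>Q n x\<bar> \<le> L0" using L0[of "x + t *\<^sub>R e"] t(3) by simp
    then show ?thesis using True by simp
  next
    case False
    have "norm x \<le> norm (x + h n *\<^sub>R e) + norm (h n *\<^sub>R e)"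
      by (metis add_diff_cancel norm_triangle_ineq4)
    then have "norm (x + h n *\<^sub>R e) > M" using False h[of n] e1 by auto
    then have "x + h n *\<^sub>R e \<notin> K" "x \<notin> K" using M False by auto
    then have "Q n x = 0" by (simp add: Q_def supp)
    then show ?thesis by simp
  qed
  have psi_cont: "continuous_on UNIV \<psi>"
    using diff by (meson continuous_at_imp_continuous_on differentiable_imp_continuous_within)
  have [measurable]: "\<psi> \<in> borel_measurable borel" "partial_deriv i \<psi> \<in> borel_measurable borel"
    using psi_cont cont by (auto intro: borel_measurable_continuous_onI)
  have Q_lim: "(\<lambda>n. Q n x) \<longlonglongrightarrow> partial_deriv i \<psi> x" for x
  proof -
    have "((\<lambda>s. (\<psi> (x + s *\<^sub>R e) - \<psi> (x + 0 *\<^sub>R e)) / (s - 0)) \<longlongrightarrow> partial_deriv i \<psi> (x + 0 *\<^sub>R e)) (at 0)"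
      using line[of x 0] unfolding has_field_derivative_iff .
    moreover have "filterlim h (at 0) sequentially"
      unfolding filterlim_at using h LIMSEQ_Suc[OF lim_inverse_n']
      by (auto simp: h_def[abs_def])
    ultimately have "(\<lambda>n. (\<psi> (x + h n *\<^sub>R e) - \<psi> (x + 0 *\<^sub>R e)) / (h n - 0)) \<longlonglongrightarrow> partial_deriv i \<psi> (x + 0 *\<^sub>R e)"
      by (rule filterlim_compose)
    then show ?thesis by (simp add: Q_def)
  qed
  have bint: "integrable lborel (\<lambda>x::real^'n. indicator (cball 0 (M + 1)) x *\<^sub>R \<bar>L0\<bar>)"
    by (intro borel_integrable_compact) auto
  have "(\<lambda>n. LINT x|lborel. Q n x) \<longlonglongrightarrow> (LINT x|lborel. partial_deriv i \<psi> x)"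
    by (rule integral_dominated_convergence[OF _ _ bint])
      (use Q_bound Q_lim in \<open>auto simp: Q_def\<close>)
  moreover have "(LINT x|lborel. Q n x) = 0" for n
  proof -
    have "integrable lborel (\<lambda>x. indicator K x *\<^sub>R \<psi> x)"
      by (intro borel_integrable_compact K continuous_on_subset[OF psi_cont]) auto
    moreover have "(\<lambda>x. indicator K x *\<^sub>R \<psi> x) = \<psi>"
    proof
      show "indicator K x *\<^sub>R \<psi> x = \<psi> x" for x using supp[of x] by (cases "x \<in> K") auto
    qed
    ultimately have i1: "integrable lborel \<psi>" by simp
    have eq: "(LINT x|distr lborel borel ((+) (h n *\<^sub>R e)). \<psi> x) = (LINT x|lborel. \<psi> (h n *\<^sub>R e + x))"
      by (rule integral_distr) auto
    have "integrable (distr lborel borel ((+) (h n *\<^sub>R e))) \<psi>"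
      using i1 by (simp add: lborel_distr_plus)
    then have i2: "integrable lborel (\<lambda>x. \<psi> (h n *\<^sub>R e + x))"
      by (subst (asm) integrable_distr_eq) auto
    show ?thesis
      unfolding Q_def using i1 i2 eq by (simp add: lborel_distr_plus add.commute)
  qed
  ultimately have "(LINT x|lborel. partial_deriv i \<psi> x) = 0"
    using LIMSEQ_unique[OF _ tendsto_const] by fastforce
  then show ?thesis by (simp add: integral_completion)
qed

lemma test_function_smooth: "test_function G \<theta> \<Longrightarrow> smooth_on UNIV \<theta>"
  by (auto simp: test_function_def smooth_on_def C_class_iff)

lemma test_function_support:
  assumes "test_function G \<theta>"
  obtains K where "compact K" "K \<subseteq> G" "\<And>x. x \<notin> K \<Longrightarrow> \<theta> x = 0" "\<And>x i. x \<notin> K \<Longrightarrow> partial_deriv i \<theta> x = 0"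
proof -
  define K where "K = closure {x. \<theta> x \<noteq> 0}"
  have K: "compact K" "K \<subseteq> G"
    unfolding K_def using assms[unfolded test_function_def] by simp_all
  have z: "\<theta> x = 0" if "x \<notin> K" for x
    using subsetD[OF closure_subset[of "{x. \<theta> x \<noteq> 0}"], of x] that[unfolded K_def] by auto
  have "partial_deriv j \<theta> x = 0" if "x \<notin> K" for x j
  proof -
    have "partial_deriv j \<theta> x = partial_deriv j (\<lambda>x. 0) x"
      by (rule partial_deriv_cong_open[of "- K"]) (use that z compact_imp_closed[OF K(1)] in auto)
    then show ?thesis by (simp add: partial_deriv_eq[OF has_derivative_const])
  qed
  with K z that show ?thesis by blast
qed

lemma set_integrable_compact_support:
  fixes f :: "real^'n::finite \<Rightarrow> 'b::{banach, second_countable_topology}"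
  assumes "compact K" "K \<subseteq> G" "continuous_on G f" "\<And>x. x \<notin> K \<Longrightarrow> f x = 0"
  shows "set_integrable lebesgue G f"
proof -
  have "set_integrable lebesgue K f"
    using assms by (intro set_integrable_compact) (auto intro: continuous_on_subset)
  moreover have "indicator K x *\<^sub>R f x = indicator G x *\<^sub>R f x" for x
    using assms(2) assms(4)[of x] by (cases "x \<in> K") (auto simp: indicator_def)
  ultimately show ?thesis by (simp add: set_integrable_def)
qed

text \<open>
The product \<open>X \<theta>\<close>, extended by zero, is continuously differentiable on the whole space.
\<close>

lemma integration_by_parts:
  fixes X :: "real^'n::finite \<Rightarrow> real"
  assumes G: "open G" and diff: "\<And>x. x \<in> G \<Longrightarrow> X differentiable at x"
    and cont: "continuous_on G (partial_deriv i X)" and test: "test_function G \<theta>"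
  shows "(LINT x:G|lebesgue. X x * partial_deriv i \<theta> x) = - (LINT x:G|lebesgue. partial_deriv i X x * \<theta> x)"
proof -
  obtain K where K: "compact K" "K \<subseteq> G" and K0: "\<And>x. x \<notin> K \<Longrightarrow> \<theta> x = 0"
      "\<And>x i. x \<notin> K \<Longrightarrow> partial_deriv i \<theta> x = 0"
    by (rule test_function_support[OF test]) blast
  note smooth = test_function_smooth[OF test]
  define \<psi> where "\<psi> x = (if x \<in> G then X x * \<theta> x else 0)" for x
  have der: "(\<psi> has_derivative (\<lambda>h. (X x *\<^sub>R gradient \<theta> x + \<theta> x *\<^sub>R gradient X x) \<bullet> h)) (at x)" if "x \<in> G" for x
  proof (rule has_derivative_transform_within_open[OF _ G that])
    have "\<theta> differentiable at x" using smooth_on_differentiable[OF smooth] by simp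
    from has_derivative_mult[OF diff[OF that, THEN has_derivative_gradient] this[THEN has_derivative_gradient]]
    show "((\<lambda>x. X x * \<theta> x) has_derivative (\<lambda>h. (X x *\<^sub>R gradient \<theta> x + \<theta> x *\<^sub>R gradient X x) \<bullet> h)) (at x)"
      by (rule has_derivative_eq_rhs) (auto simp: fun_eq_iff inner_vec_def gradient_component algebra_simps sum.distrib sum_distrib_left)
  qed (auto simp: \<psi>_def)
  have der0: "(\<psi> has_derivative (\<lambda>h. 0)) (at x)" if "x \<notin> K" for x
  proof (rule has_derivative_transform_within_open)
    show "((\<lambda>x. 0) has_derivative (\<lambda>h. 0)) (at x)" by simp
    show "open (- K)" "x \<in> - K" using that compact_imp_closed[OF K(1)] by auto
    show "0 = \<psi> y" if "y \<in> - K" for y using that K0 unfolding \<psi>_def by simp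
  qed
  have pd: "partial_deriv i \<psi> x = X x * partial_deriv i \<theta> x + partial_deriv i X x * \<theta> x" if "x \<in> G" for x
    using partial_deriv_eq[OF der[OF that], of i] by (simp add: inner_axis gradient_component)
  have pd0: "partial_deriv i \<psi> x = 0" if "x \<notin> K" for x
    using partial_deriv_eq[OF der0[OF that]] .
  have X_cont: "continuous_on G X"
    using diff by (meson continuous_at_imp_continuous_on differentiable_imp_continuous_within)
  have t_cont: "continuous_on G \<theta>" "continuous_on G (partial_deriv i \<theta>)"
    using smooth_on_subset[OF smooth, of G] smooth_on_continuous smooth_on_partial_deriv by blast+
  have "continuous_on G (partial_deriv i \<psi>)"
    by (subst continuous_on_cong[OF refl pd]) (auto intro!: continuous_intros X_cont t_cont cont)
  moreover have "continuous_on (- K) (partial_deriv i \<psi>)"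
    by (subst continuous_on_cong[OF refl pd0]) auto
  ultimately have "continuous_on (G \<union> - K) (partial_deriv i \<psi>)"
    using G compact_imp_closed[OF K(1)] by (intro continuous_on_open_Un) auto
  moreover have "G \<union> - K = UNIV" using K(2) by auto
  ultimately have c: "continuous_on UNIV (partial_deriv i \<psi>)" by simp
  have d: "\<psi> differentiable at x" for x
    using der[of x] der0[of x] K(2) unfolding differentiable_def by blast
  have "(LINT x|lebesgue. partial_deriv i \<psi> x) = 0"
    by (rule integral_partial_deriv_eq_0[OF d c K(1)]) (use K0 in \<open>auto simp: \<psi>_def\<close>)
  moreover have "partial_deriv i \<psi> x = indicator G x *\<^sub>R (X x * partial_deriv i \<theta> x + partial_deriv i X x * \<theta> x)" for x
    using pd[of x] pd0[of x] K(2) by (auto simp: indicator_def)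
  ultimately have "(LINT x:G|lebesgue. X x * partial_deriv i \<theta> x + partial_deriv i X x * \<theta> x) = 0"
    by (simp add: set_lebesgue_integral_def)
  moreover have "set_integrable lebesgue G (\<lambda>x. X x * partial_deriv i \<theta> x)"
    by (rule set_integrable_compact_support[OF K]) (auto intro!: continuous_intros X_cont t_cont simp: K0)
  moreover have "set_integrable lebesgue G (\<lambda>x. partial_deriv i X x * \<theta> x)"
    by (rule set_integrable_compact_support[OF K]) (auto intro!: continuous_intros cont t_cont simp: K0)
  ultimately show ?thesis by (simp add: set_integral_add)
qed

definition divergence :: "(real^'n::finite \<Rightarrow> real^'n) \<Rightarrow> real^'n \<Rightarrow> real" where
  "divergence X x = (\<Sum>i\<in>UNIV. partial_deriv i (\<lambda>y. X y $ i) x)"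

definition C1_field_on :: "(real^'n::finite) set \<Rightarrow> (real^'n \<Rightarrow> real^'n) \<Rightarrow> bool" where
  "C1_field_on G X \<longleftrightarrow> (\<forall>i. Ck_on 1 G (\<lambda>y. X y $ i))"

lemma C1_field_onD:
  assumes "C1_field_on G X"
  shows "x \<in> G \<Longrightarrow> (\<lambda>y. X y $ i) differentiable at x"
    "continuous_on G (partial_deriv j (\<lambda>y. X y $ i))" "continuous_on G X" "continuous_on G (divergence X)"
proof -
  have C: "(\<forall>x\<in>G. (\<lambda>y. X y $ i) differentiable at x) \<and> (\<forall>j. continuous_on G (partial_deriv j (\<lambda>y. X y $ i)))" for i
    using assms[unfolded C1_field_on_def One_nat_def Ck_on.simps] by (rule spec)
  have *: "\<forall>x\<in>G. (\<lambda>y. X y $ i) differentiable at x" for i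
    using C by (rule conjunct1)
  have **: "continuous_on G (partial_deriv j (\<lambda>y. X y $ i))" for i j
    using C[THEN conjunct2] by (rule spec)
  show "x \<in> G \<Longrightarrow> (\<lambda>y. X y $ i) differentiable at x" by (rule *[rule_format])
  show "continuous_on G (partial_deriv j (\<lambda>y. X y $ i))" by (rule **)
  have "continuous_on G (\<lambda>x. \<chi> i. X x $ i)"
    by (intro continuous_on_vec_lambda continuous_at_imp_continuous_on ballI
        differentiable_imp_continuous_within *[rule_format])
  then show "continuous_on G X" by simp
  show "continuous_on G (divergence X)"
    unfolding divergence_def[abs_def] by (intro continuous_intros **)
qed

lemma set_integral_sum:
  fixes f :: "'i \<Rightarrow> 'a \<Rightarrow> 'b::{banach, second_countable_topology}"
  assumes "\<And>i. i \<in> I \<Longrightarrow> set_integrable M A (f i)"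
  shows "(LINT x:A|M. (\<Sum>i\<in>I. f i x)) = (\<Sum>i\<in>I. LINT x:A|M. f i x)"
  using assms unfolding set_lebesgue_integral_def set_integrable_def
  by (simp add: scaleR_sum_right Bochner_Integration.integral_sum)

lemma divergence_theorem_test_function:
  fixes X :: "real^'n::finite \<Rightarrow> real^'n"
  assumes G: "open G" and X: "C1_field_on G X" and test: "test_function G \<theta>"
  shows "(LINT x:G|lebesgue. X x \<bullet> gradient \<theta> x) = - (LINT x:G|lebesgue. divergence X x * \<theta> x)"
proof -
  obtain K where K: "compact K" "K \<subseteq> G" and K0: "\<And>x. x \<notin> K \<Longrightarrow> \<theta> x = 0"
      "\<And>x i. x \<notin> K \<Longrightarrow> partial_deriv i \<theta> x = 0"
    by (rule test_function_support[OF test]) blast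
  note smooth = test_function_smooth[OF test]
  have t_cont: "continuous_on G \<theta>" "continuous_on G (partial_deriv i \<theta>)" for i
    using smooth_on_subset[OF smooth, of G] smooth_on_continuous smooth_on_partial_deriv by blast+
  have Xc: "continuous_on G (\<lambda>x. X x $ i)" for i
    using C1_field_onD(3)[OF X] by (rule continuous_on_component)
  have "(LINT x:G|lebesgue. X x \<bullet> gradient \<theta> x) = (LINT x:G|lebesgue. (\<Sum>i\<in>UNIV. X x $ i * partial_deriv i \<theta> x))"
    by (simp add: inner_vec_def gradient_component)
  also have "\<dots> = (\<Sum>i\<in>UNIV. LINT x:G|lebesgue. X x $ i * partial_deriv i \<theta> x)"
    by (rule set_integral_sum) (auto intro!: set_integrable_compact_support[OF K] continuous_intros t_cont Xc simp: K0)
  also have "\<dots> = (\<Sum>i\<in>UNIV. - (LINT x:G|lebesgue. partial_deriv i (\<lambda>y. X y $ i) x * \<theta> x))"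
    by (intro sum.cong refl integration_by_parts[OF G] test C1_field_onD[OF X])
  also have "\<dots> = - (LINT x:G|lebesgue. (\<Sum>i\<in>UNIV. partial_deriv i (\<lambda>y. X y $ i) x * \<theta> x))"
    by (subst set_integral_sum) (auto intro!: set_integrable_compact_support[OF K] continuous_intros t_cont C1_field_onD[OF X] simp: K0 sum_negf)
  finally show ?thesis by (simp add: divergence_def sum_distrib_right)
qed

lemma locally_Lp_continuous:
  fixes f :: "real^'n::finite \<Rightarrow> 'b::{banach,second_countable_topology}"
  assumes "open G" "continuous_on G f" "p > 0" shows "locally_Lp p G f"
  unfolding locally_Lp_def
proof (intro conjI allI impI)
  have "(\<lambda>x. indicator G x *\<^sub>R f x) \<in> borel_measurable borel"
    using assms by (intro borel_measurable_continuous_on_indicator) auto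
  then show "set_borel_measurable lebesgue G f"
    unfolding set_borel_measurable_def by (simp add: measurable_completion)
next
  fix K assume "compact K \<and> K \<subseteq> G"
  then show "set_integrable lebesgue K (\<lambda>x. norm (f x) powr p)"
    using assms by (intro set_integrable_compact continuous_on_powr' continuous_intros) (auto intro: continuous_on_subset)
qed

lemma sobolev_loc_gradient_classical:
  fixes u :: "real^'n::finite \<Rightarrow> real"
  assumes "open G" "p > 0" and diff: "\<And>x. x \<in> G \<Longrightarrow> u differentiable at x" and cont: "continuous_on G (gradient u)"
  shows "sobolev_loc_gradient p G u (gradient u)"
  unfolding sobolev_loc_gradient_def
proof (intro conjI allI impI)
  show "locally_Lp p G u"
    using assms by (intro locally_Lp_continuous) (auto intro: continuous_at_imp_continuous_on differentiable_imp_continuous_within)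
  show "locally_Lp p G (gradient u)" using assms by (intro locally_Lp_continuous)
  fix \<theta> i assume t: "test_function G \<theta>"
  have "continuous_on G (partial_deriv i u)"
    using continuous_on_component[OF cont, of i] by (simp add: gradient_component)
  then show "(LINT x:G|lebesgue. u x * partial_deriv i \<theta> x) = - (LINT x:G|lebesgue. gradient u x $ i * \<theta> x)"
    unfolding gradient_component using assms t by (intro integration_by_parts) auto
qed

definition p_flux :: "real \<Rightarrow> (real^'n::finite \<Rightarrow> real) \<Rightarrow> real^'n \<Rightarrow> real^'n" where
  "p_flux p u x = norm (gradient u x) powr (p - 2) *\<^sub>R gradient u x"

text \<open>
Where the gradient of \<open>u\<close> is continuous it is the weak gradient, and the weak inequality follows from
the pointwise one by the divergence theorem.  The canonical representative of a continuous function is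
the function itself, as nonempty open sets are not null.
\<close>

lemma p_superharmonic_classical:
  fixes u :: "real^'n::finite \<Rightarrow> real"
  assumes G: "open G" and p: "p > 0" and diff: "\<And>x. x \<in> G \<Longrightarrow> u differentiable at x"
    and cont: "continuous_on G (gradient u)"
    and X: "C1_field_on G (p_flux p u)" and div: "\<And>x. x \<in> G \<Longrightarrow> divergence (p_flux p u) x \<le> 0"
  shows "p_superharmonic p G u"
proof -
  have "p_supersolution p G u"
    unfolding p_supersolution_def
  proof (intro exI conjI allI impI)
    show "sobolev_loc_gradient p G u (gradient u)"
      by (rule sobolev_loc_gradient_classical[OF G p diff cont])
    fix \<theta> assume t: "test_function G \<theta> \<and> (\<forall>x. 0 \<le> \<theta> x)"
    have "0 \<le> (LINT x:G|lebesgue. - divergence (p_flux p u) x * \<theta> x)"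
      unfolding set_lebesgue_integral_def
      by (intro Bochner_Integration.integral_nonneg) (use div t in \<open>auto simp: indicator_def mult_nonpos_nonneg\<close>)
    also have "\<dots> = (LINT x:G|lebesgue. p_flux p u x \<bullet> gradient \<theta> x)"
      using divergence_theorem_test_function[OF G X] t by (simp add: set_lebesgue_integral_def)
    also have "\<dots> = (LINT x:G|lebesgue. norm (gradient u x) powr (p - 2) * (gradient u x \<bullet> gradient \<theta> x))"
      unfolding set_lebesgue_integral_def
      by (intro Bochner_Integration.integral_cong) (auto simp: indicator_def p_flux_def)
    finally show "(LINT x:G|lebesgue. norm (gradient u x) powr (p - 2) * (gradient u x \<bullet> gradient \<theta> x)) \<ge> 0" .
  qed
  moreover have c: "isCont u x" if "x \<in> G" for x
    using diff[OF that] differentiable_imp_continuous_within by blast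
  have "lower_semicontinuous_on G u"
    unfolding lower_semicontinuous_on_def
  proof (intro ballI allI impI)
    fix x a assume "x \<in> G" "a < u x"
    have "(u \<longlongrightarrow> u x) (at x within G)"
      using c[OF \<open>x \<in> G\<close>] continuous_at_imp_continuous_at_within continuous_within by blast
    then show "\<forall>\<^sub>F y in at x within G. a < u y"
      using \<open>a < u x\<close> by (rule order_tendstoD(1))
  qed
  moreover have "a \<le> u x" if "x \<in> G" "\<rho> > 0" and AE: "AE y in lebesgue. y \<in> ball x \<rho> \<inter> G \<longrightarrow> a \<le> u y" for x \<rho> a
  proof (rule ccontr)
    assume "\<not> a \<le> u x"
    then have ux: "u x < a" by simp
    have "continuous_on G u" using c by (simp add: continuous_at_imp_continuous_on)
    then have o: "open (G \<inter> u -` {..<a})" by (intro continuous_open_preimage G) auto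
    let ?V = "(G \<inter> u -` {..<a}) \<inter> ball x \<rho>"
    have "open ?V" using o by auto
    moreover have "x \<in> ?V" using that ux by auto
    ultimately have "\<not> negligible ?V" using open_not_negligible by blast
    moreover have "AE y in lebesgue. y \<notin> ?V" using AE by eventually_elim auto
    then have "?V \<in> null_sets lebesgue"
      using \<open>open ?V\<close> by (subst AE_iff_null_sets) auto
    ultimately show False by (simp add: negligible_iff_null_sets)
  qed
  ultimately show ?thesis unfolding p_superharmonic_def by blast
qed

section \<open>Convolution with a mollifier\<close>

definition convolve :: "(real^'n::finite \<Rightarrow> real) \<Rightarrow> (real^'n \<Rightarrow> real) \<Rightarrow> real^'n \<Rightarrow> real" where
  "convolve k f x = (LINT y|lebesgue. k (x - y) * f y)"

lemma continuous_lebesgue_measurable: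
  fixes f :: "real^'n::finite \<Rightarrow> 'b::{second_countable_topology, topological_space}"
  shows "continuous_on UNIV f \<Longrightarrow> f \<in> borel_measurable lebesgue"
  by (simp add: borel_measurable_continuous_onI measurable_completion)

lemma bounded_of_compact_support:
  fixes f :: "real^'n::finite \<Rightarrow> 'b::real_normed_vector"
  assumes "continuous_on UNIV f" "compact K" "\<And>x. x \<notin> K \<Longrightarrow> f x = 0"
  obtains B where "\<And>x. norm (f x) \<le> B" "B \<ge> 0"
proof -
  have "compact (f ` K)" using assms by (intro compact_continuous_image continuous_on_subset[OF assms(1)]) auto
  then obtain B where B: "\<forall>x\<in>K. norm (f x) \<le> B" using compact_imp_bounded bounded_iff by (metis imageI)
  have "norm (f x) \<le> \<bar>B\<bar>" for x using B assms(3)[of x] by (cases "x \<in> K") force+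
  then show ?thesis using that[of "\<bar>B\<bar>"] by simp
qed

lemma integrable_convolution_integrand:
  fixes k :: "real^'n::finite \<Rightarrow> real"
  assumes "continuous_on UNIV k" "\<And>x. \<bar>k x\<bar> \<le> B" "integrable lebesgue f"
  shows "integrable lebesgue (\<lambda>y. k (x - y) * f y)"
proof (rule Bochner_Integration.integrable_bound)
  show "integrable lebesgue (\<lambda>y. B * f y)" using assms by simp
  have "continuous_on UNIV (\<lambda>y. k (x - y))"
    by (rule continuous_on_compose2[OF assms(1)]) (auto intro!: continuous_intros)
  then show "(\<lambda>y. k (x - y) * f y) \<in> borel_measurable lebesgue"
    using borel_measurable_integrable[OF assms(3)] by (intro borel_measurable_times) (auto intro: continuous_lebesgue_measurable)
  have "0 \<le> B" using assms(2)[of 0] by linarith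
  show "AE y in lebesgue. norm (k (x - y) * f y) \<le> norm (B * f y)"
    using assms(2) \<open>0 \<le> B\<close> by (auto simp: abs_mult intro!: mult_right_mono)
qed

lemma continuous_on_convolve:
  fixes k :: "real^'n::finite \<Rightarrow> real"
  assumes "continuous_on UNIV k" "\<And>x. \<bar>k x\<bar> \<le> B" "integrable lebesgue f"
  shows "continuous_on UNIV (convolve k f)"
  unfolding continuous_on_sequentially
proof (intro allI impI ballI, elim conjE)
  fix X and a :: "real^'n" assume X: "X \<longlonglongrightarrow> a"
  have "0 \<le> B" using assms(2)[of 0] by linarith
  have "(\<lambda>n. LINT y|lebesgue. k (X n - y) * f y) \<longlonglongrightarrow> (LINT y|lebesgue. k (a - y) * f y)"
  proof (rule integral_dominated_convergence)
    show "integrable lebesgue (\<lambda>y. B * \<bar>f y\<bar>)" using assms by simp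
    show "AE y in lebesgue. (\<lambda>n. k (X n - y) * f y) \<longlonglongrightarrow> k (a - y) * f y"
      using X assms(1) by (intro AE_I2 tendsto_intros continuous_on_tendsto_compose[OF assms(1)]) auto
    show "AE y in lebesgue. norm (k (X n - y) * f y) \<le> B * \<bar>f y\<bar>" for n
      using assms(2) by (intro AE_I2) (auto simp: abs_mult intro!: mult_right_mono)
  qed (use integrable_convolution_integrand[OF assms] in auto)
  then show "(convolve k f \<circ> X) \<longlonglongrightarrow> convolve k f a"
    by (simp add: convolve_def[abs_def] comp_def)
qed

lemma lipschitz_of_compact_support:
  fixes k :: "real^'n::finite \<Rightarrow> real"
  assumes "\<And>x. k differentiable at x" "\<And>x. norm (gradient k x) \<le> L"
  shows "\<bar>k a - k b\<bar> \<le> L * norm (a - b)"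
proof -
  have "norm (k a - k b) \<le> L * norm (a - b)"
  proof (rule differentiable_bound[of UNIV k "\<lambda>x h. gradient k x \<bullet> h"])
    show "onorm ((\<bullet>) (gradient k x)) \<le> L" for x
      using order_trans[OF Cauchy_Schwarz_ineq2 mult_right_mono[OF assms(2)[of x] norm_ge_zero]]
      by (intro onorm_le) simp
  qed (auto intro: has_derivative_gradient assms)
  then show ?thesis by simp
qed

text \<open>
Differentiation under the integral: the remainder quotients of \<open>k\<close> are bounded by twice its Lipschitz
constant, so dominated convergence applies along every sequence.
\<close>

lemma has_derivative_convolve:
  fixes k :: "real^'n::finite \<Rightarrow> real"
  assumes k: "smooth_on UNIV k" and K: "compact K" "\<And>x. x \<notin> K \<Longrightarrow> k x = 0" "\<And>x i. x \<notin> K \<Longrightarrow> partial_deriv i k x = 0"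
    and f: "integrable lebesgue f"
  shows "(convolve k f has_derivative (\<lambda>h. (\<chi> i. convolve (partial_deriv i k) f x) \<bullet> h)) (at x)"
proof -
  have kd: "k differentiable at x" for x using smooth_on_differentiable[OF k] by simp
  have kc: "continuous_on UNIV k" using smooth_on_continuous[OF k] .
  have pc: "continuous_on UNIV (partial_deriv i k)" for i using smooth_on_continuous[OF smooth_on_partial_deriv[OF k]] .
  have gc: "continuous_on UNIV (gradient k)" using smooth_on_continuous_gradient[OF k] .
  have g0: "gradient k x = 0" if "x \<notin> K" for x using K(3)[OF that] by (simp add: vec_eq_iff gradient_component)
  obtain L where L: "\<And>x. norm (gradient k x) \<le> L" "L \<ge> 0" using bounded_of_compact_support[OF gc K(1) g0] by blast
  obtain B where B: "\<And>x. norm (k x) \<le> B" "B \<ge> 0" using bounded_of_compact_support[OF kc K(1,2)] by blast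
  note lip = lipschitz_of_compact_support[OF kd L(1)]
  have i0: "integrable lebesgue (\<lambda>y. k (z - y) * f y)" for z
    using integrable_convolution_integrand[OF kc _ f, of B] B by simp
  have pL: "\<bar>partial_deriv i k x\<bar> \<le> L" for i x
    using component_le_norm_cart[of "gradient k x" i] L(1)[of x] by (simp add: gradient_component)
  have i1: "integrable lebesgue (\<lambda>y. partial_deriv i k (z - y) * f y)" for z i
    using integrable_convolution_integrand[OF pc pL f] .
  define q where "q z y = (k (z - y) - k (x - y) - gradient k (x - y) \<bullet> (z - x)) / norm (z - x) * f y" for z y
  have grad: "(gradient k (x - y) \<bullet> h) * f y = (\<Sum>i\<in>UNIV. h $ i * (partial_deriv i k (x - y) * f y))" for h y
    by (simp add: inner_vec_def gradient_component sum_distrib_left sum_distrib_right mult_ac)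
  have ig: "integrable lebesgue (\<lambda>y. (gradient k (x - y) \<bullet> h) * f y)" for h
    unfolding grad using i1 by simp
  have cg: "(LINT y|lebesgue. (gradient k (x - y) \<bullet> h) * f y) = (\<chi> i. convolve (partial_deriv i k) f x) \<bullet> h" for h
    unfolding grad using i1 by (simp add: convolve_def inner_vec_def mult.commute)
  have q_eq: "q z y = (k (z - y) * f y - k (x - y) * f y - (gradient k (x - y) \<bullet> (z - x)) * f y) / norm (z - x)" for z y
    unfolding q_def by (simp add: diff_divide_distrib left_diff_distrib)
  have iq: "integrable lebesgue (q z)" for z unfolding q_eq[abs_def]
    by (intro integrable_divide_zero Bochner_Integration.integrable_diff i0 ig)
  have LINT_q: "(LINT y|lebesgue. q z y) = (convolve k f z - convolve k f x - (\<chi> i. convolve (partial_deriv i k) f x) \<bullet> (z - x)) / norm (z - x)" for z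
    unfolding q_eq using i0 ig by (simp add: cg convolve_def)
  show ?thesis
    unfolding has_derivative_iff_norm
  proof
    show "bounded_linear ((\<bullet>) (\<chi> i. convolve (partial_deriv i k) f x))" by (rule bounded_linear_inner_right)
    show "((\<lambda>y. norm (convolve k f y - convolve k f x - (\<chi> i. convolve (partial_deriv i k) f x) \<bullet> (y - x)) / norm (y - x)) \<longlongrightarrow> 0) (at x)"
      unfolding tendsto_at_iff_sequentially
    proof (intro allI impI)
      fix X assume X0: "\<forall>i. X i \<in> UNIV - {x}" and X: "X \<longlonglongrightarrow> x"
      have "(\<lambda>n. LINT y|lebesgue. q (X n) y) \<longlonglongrightarrow> (LINT y|(lebesgue :: (real^'n) measure). 0)"
      proof (rule integral_dominated_convergence)
        show "integrable lebesgue (\<lambda>y. 2 * L * \<bar>f y\<bar>)" using f by simp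
        show "AE y in lebesgue. (\<lambda>n. q (X n) y) \<longlonglongrightarrow> 0"
        proof (rule AE_I2)
          fix y
          have "((\<lambda>z. k (z - y)) has_derivative (\<lambda>h. gradient k (x - y) \<bullet> h)) (at x)"
            by (rule has_derivative_compose[OF _ has_derivative_gradient[OF kd], where f="\<lambda>z. z - y"]) (auto intro!: derivative_eq_intros)
          then have "((\<lambda>z. norm (k (z - y) - k (x - y) - gradient k (x - y) \<bullet> (z - x)) / norm (z - x)) \<longlongrightarrow> 0) (at x)"
            unfolding has_derivative_iff_norm by blast
          then have "(\<lambda>n. norm (k (X n - y) - k (x - y) - gradient k (x - y) \<bullet> (X n - x)) / norm (X n - x)) \<longlonglongrightarrow> 0"
            unfolding tendsto_at_iff_sequentially comp_def using X0 X by blast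
          then have "(\<lambda>n. norm (k (X n - y) - k (x - y) - gradient k (x - y) \<bullet> (X n - x)) / norm (X n - x) * \<bar>f y\<bar>) \<longlonglongrightarrow> 0 * \<bar>f y\<bar>"
            by (intro tendsto_mult tendsto_const)
          then have "(\<lambda>n. norm (q (X n) y)) \<longlonglongrightarrow> 0"
            by (simp add: q_def abs_mult)
          then show "(\<lambda>n. q (X n) y) \<longlonglongrightarrow> 0" by (rule tendsto_norm_zero_cancel)
        qed
        show "AE y in lebesgue. norm (q (X n) y) \<le> 2 * L * \<bar>f y\<bar>" for n
        proof (rule AE_I2)
          fix y
          have "\<bar>k (X n - y) - k (x - y)\<bar> \<le> L * norm (X n - x)" using lip[of "X n - y" "x - y"] by simp
          moreover have "\<bar>gradient k (x - y) \<bullet> (X n - x)\<bar> \<le> L * norm (X n - x)"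
            by (meson Cauchy_Schwarz_ineq2 L(1) mult_right_mono norm_ge_zero order_trans)
          ultimately have "\<bar>k (X n - y) - k (x - y) - gradient k (x - y) \<bullet> (X n - x)\<bar> \<le> 2 * L * norm (X n - x)" by linarith
          moreover have "norm (X n - x) > 0" using X0 by simp
          ultimately have "\<bar>k (X n - y) - k (x - y) - gradient k (x - y) \<bullet> (X n - x)\<bar> / norm (X n - x) \<le> 2 * L"
            by (simp add: divide_le_eq)
          from mult_right_mono[OF this, of "\<bar>f y\<bar>"] show "norm (q (X n) y) \<le> 2 * L * \<bar>f y\<bar>"
            unfolding q_def by (simp add: abs_mult)
        qed
      qed (use borel_measurable_integrable[OF iq] in auto)
      then have "(\<lambda>n. LINT y|lebesgue. q (X n) y) \<longlonglongrightarrow> 0" by simp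
      from tendsto_norm_zero[OF this] have "(\<lambda>n. norm (LINT y|lebesgue. q (X n) y)) \<longlonglongrightarrow> 0" .
      then show "((\<lambda>y. norm (convolve k f y - convolve k f x - (\<chi> i. convolve (partial_deriv i k) f x) \<bullet> (y - x)) / norm (y - x)) \<circ> X) \<longlonglongrightarrow> 0"
        by (simp add: LINT_q comp_def)
    qed
  qed
qed

lemma partial_deriv_outside_support:
  assumes "closed K" "\<And>x. x \<notin> K \<Longrightarrow> k x = 0" "x \<notin> K"
  shows "partial_deriv i k x = 0"
proof -
  have "partial_deriv i k x = partial_deriv i (\<lambda>x. 0) x"
    by (rule partial_deriv_cong_open[of "- K"]) (use assms in auto)
  then show ?thesis by (simp add: partial_deriv_eq[OF has_derivative_const])
qed

lemma partial_deriv_convolve: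
  assumes k: "smooth_on UNIV k" and K: "compact K" "\<And>x. x \<notin> K \<Longrightarrow> k x = 0" and f: "integrable lebesgue f"
  shows "partial_deriv i (convolve k f) x = convolve (partial_deriv i k) f x"
  using partial_deriv_eq[OF has_derivative_convolve[OF k K partial_deriv_outside_support[OF compact_imp_closed[OF K(1)] K(2)] f], of i x]
  by (simp add: inner_axis)

lemma smooth_on_convolve:
  assumes k: "smooth_on UNIV k" and K: "compact K" "\<And>x. x \<notin> K \<Longrightarrow> k x = 0" and f: "integrable lebesgue f"
  shows "smooth_on UNIV (convolve k f)"
proof -
  have "Ck_on n UNIV (convolve k f)" for n
    using k K(2)
  proof (induction n arbitrary: k)
    case 0
    obtain B where "\<And>x. norm (k x) \<le> B" "B \<ge> 0"
      using bounded_of_compact_support[OF smooth_on_continuous[OF 0(1)] K(1) 0(2)] by blast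
    then show ?case using continuous_on_convolve[OF smooth_on_continuous[OF 0(1)] _ f, of B] by simp
  next
    case (Suc n)
    note P0 = partial_deriv_outside_support[OF compact_imp_closed[OF K(1)] Suc.prems(2)]
    have "convolve k f differentiable at x" for x
      using has_derivative_convolve[OF Suc.prems(1) K(1) Suc.prems(2) P0 f] unfolding differentiable_def by blast
    moreover have "partial_deriv i (convolve k f) = convolve (partial_deriv i k) f" for i
      by (rule ext) (rule partial_deriv_convolve[OF Suc.prems(1) K(1) Suc.prems(2) f])
    moreover have "Ck_on n UNIV (convolve (partial_deriv i k) f)" for i
      by (rule Suc.IH[OF smooth_on_partial_deriv[OF Suc.prems(1)] P0])
    ultimately show ?case by simp
  qed
  then show ?thesis unfolding smooth_on_def by blast
qed

text \<open>
Normalized by its integral rather than by a power of \<open>\<epsilon>\<close>, so that mass one is immediate for every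
radius.
\<close>

definition mollifier :: "real \<Rightarrow> real^'n::finite \<Rightarrow> real" where
  "mollifier \<epsilon> x = flat (\<epsilon>\<^sup>2 - x \<bullet> x) / (LINT y|(lebesgue :: (real^'n) measure). flat (\<epsilon>\<^sup>2 - y \<bullet> y))"

lemma smooth_on_inner_self: "open U \<Longrightarrow> smooth_on U (\<lambda>x::real^'n::finite. x \<bullet> x)"
proof -
  assume U: "open U"
  have "smooth_on U (\<lambda>x. \<Sum>b\<in>Basis. (b \<bullet> (x - 0))\<^sup>2)" by (rule smooth_on_sum_squares[OF U]) simp
  moreover have "(\<Sum>b\<in>Basis. (b \<bullet> (x - 0))\<^sup>2) = x \<bullet> x" for x :: "real^'n"
    by (subst euclidean_inner) (simp add: power2_eq_square inner_commute)
  ultimately show ?thesis by simp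
qed

lemma mollifier_kernel:
  fixes \<epsilon> :: real
  assumes "\<epsilon> > 0"
  defines "\<phi> \<equiv> \<lambda>x::real^'n::finite. flat (\<epsilon>\<^sup>2 - x \<bullet> x)"
  shows "smooth_on UNIV \<phi>" "\<And>x. norm x \<ge> \<epsilon> \<Longrightarrow> \<phi> x = 0" "integrable lborel \<phi>" "(LINT x|lebesgue. \<phi> x) > 0"
proof -
  show s: "smooth_on UNIV \<phi>"
    unfolding \<phi>_def by (intro smooth_on_flat smooth_on_diff smooth_on_const smooth_on_inner_self) auto
  show z: "\<phi> x = 0" if "norm x \<ge> \<epsilon>" for x
    unfolding \<phi>_def by (rule flat_zero) (use that assms(1) in \<open>simp add: dot_square_norm power_mono\<close>)
  have "integrable lborel (\<lambda>x. indicator (cball 0 \<epsilon>) x *\<^sub>R \<phi> x)"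
    by (intro borel_integrable_compact continuous_on_subset[OF smooth_on_continuous[OF s]]) auto
  moreover have "(\<lambda>x. indicator (cball 0 \<epsilon>) x *\<^sub>R \<phi> x) = \<phi>"
    by (rule ext) (use z in \<open>auto simp: indicator_def\<close>)
  ultimately show i: "integrable lborel \<phi>" by simp
  have il: "integrable lebesgue \<phi>" using i by (subst integrable_completion) auto
  have nn: "\<phi> x \<ge> 0" for x by (simp add: \<phi>_def flat_nonneg)
  have "(LINT x|lebesgue. \<phi> x) \<noteq> 0"
  proof
    assume "(LINT x|lebesgue. \<phi> x) = 0"
    then have AE: "AE x in lebesgue. \<phi> x = 0" using integral_nonneg_eq_0_iff_AE[OF il] nn by auto
    have pos: "\<phi> x > 0" if "x \<in> ball 0 \<epsilon>" for x
      unfolding \<phi>_def flat_pos_iff using that assms(1) by (simp add: dot_square_norm power_strict_mono)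
    have "AE x in lebesgue. x \<notin> ball (0::real^'n) \<epsilon>"
      by (rule eventually_mono[OF AE]) (use pos in force)
    then have "ball (0::real^'n) \<epsilon> \<in> null_sets lebesgue" by (subst AE_iff_null_sets) auto
    then show False
      using open_not_negligible[of "ball (0::real^'n) \<epsilon>"] assms(1) by (simp add: negligible_iff_null_sets)
  qed
  moreover have "(LINT x|lebesgue. \<phi> x) \<ge> 0" using nn by simp
  ultimately show "(LINT x|lebesgue. \<phi> x) > 0" by simp
qed

lemma mollifier_smooth_kernel:
  fixes \<epsilon> :: real
  assumes "\<epsilon> > 0"
  shows "smooth_on UNIV (mollifier \<epsilon> :: real^'n::finite \<Rightarrow> real)" "\<And>x::real^'n. mollifier \<epsilon> x \<ge> 0"
    "\<And>x::real^'n. norm x \<ge> \<epsilon> \<Longrightarrow> mollifier \<epsilon> x = 0" "\<And>x::real^'n. mollifier \<epsilon> (- x) = mollifier \<epsilon> x"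
    "integrable lborel (mollifier \<epsilon> :: real^'n \<Rightarrow> real)"
    "(LINT x|lborel. mollifier \<epsilon> (x::real^'n)) = 1"
proof -
  let ?\<phi> = "\<lambda>x::real^'n. flat (\<epsilon>\<^sup>2 - x \<bullet> x)"
  note M = mollifier_kernel[OF assms, where 'n='n]
  have eq: "mollifier \<epsilon> = (\<lambda>x. (1 / (LINT y|lebesgue. ?\<phi> y)) * ?\<phi> x)" by (auto simp: mollifier_def)
  show "smooth_on UNIV (mollifier \<epsilon> :: real^'n::finite \<Rightarrow> real)"
    unfolding eq by (intro smooth_on_mult smooth_on_const M) auto
  show "mollifier \<epsilon> x \<ge> 0" for x :: "real^'n" using M(4) flat_nonneg by (simp add: mollifier_def)
  show "norm x \<ge> \<epsilon> \<Longrightarrow> mollifier \<epsilon> x = 0" for x :: "real^'n" using M(2) by (simp add: mollifier_def)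
  show "mollifier \<epsilon> (- x) = mollifier \<epsilon> x" for x :: "real^'n" by (simp add: mollifier_def)
  show "integrable lborel (mollifier \<epsilon> :: real^'n \<Rightarrow> real)" unfolding eq using M(3) by simp
  have "(LINT x|lebesgue. ?\<phi> x) = (LINT x|lborel. ?\<phi> x)"
    using borel_measurable_integrable[OF M(3)] by (intro integral_completion) simp
  then show "(LINT x|lborel. mollifier \<epsilon> (x::real^'n)) = 1"
    unfolding eq using M(4) by simp
qed

lemma mollifier_translate:
  assumes "\<epsilon> > 0"
  shows "integrable lborel (\<lambda>y::real^'n::finite. mollifier \<epsilon> (x - y))" "(LINT y|lborel. mollifier \<epsilon> (x - y::real^'n)) = 1"
    "(\<integral>\<^sup>+y. ennreal (mollifier \<epsilon> (y - x::real^'n)) \<partial>lborel) = 1"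
proof -
  note M = mollifier_smooth_kernel[OF assms, where 'n='n]
  have sym: "mollifier \<epsilon> (x - y) = mollifier \<epsilon> (- x + y)" for y
    using M(4)[of "x - y"] by simp
  have [measurable]: "(mollifier \<epsilon> :: real^'n \<Rightarrow> real) \<in> borel_measurable borel"
    using borel_measurable_integrable[OF M(5)] by simp
  have "integrable (distr lborel borel ((+) (- x))) (mollifier \<epsilon> :: real^'n \<Rightarrow> real)"
    using M(5) by (simp add: lborel_distr_plus)
  then show i: "integrable lborel (\<lambda>y::real^'n. mollifier \<epsilon> (x - y))"
    unfolding sym by (subst (asm) integrable_distr_eq) auto
  have "(LINT y|distr lborel borel ((+) (- x)). mollifier \<epsilon> y) = (LINT y|lborel. mollifier \<epsilon> (- x + y))"
    by (rule integral_distr) auto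
  then show e: "(LINT y|lborel. mollifier \<epsilon> (x - y::real^'n)) = 1"
    unfolding sym using M(6) by (simp add: lborel_distr_plus)
  have "(\<integral>\<^sup>+y. ennreal (mollifier \<epsilon> (y - x::real^'n)) \<partial>lborel) = (\<integral>\<^sup>+y. ennreal (mollifier \<epsilon> (x - y::real^'n)) \<partial>lborel)"
    using sym by (simp add: algebra_simps)
  also have "\<dots> = ennreal (LINT y|lborel. mollifier \<epsilon> (x - y::real^'n))"
    using i M(2) by (intro nn_integral_eq_integral) auto
  finally show "(\<integral>\<^sup>+y. ennreal (mollifier \<epsilon> (y - x::real^'n)) \<partial>lborel) = 1" using e by simp
qed

section \<open>Convergence of mollifications in \<open>L\<^sup>p\<close>\<close>

text \<open>
Jensen's inequality for the weight \<open>w\<close>.  With \<open>A\<close> the mean of \<open>|h|\<close>, integrate Young's inequality for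
\<open>|h| A\<^sup>p\<^sup>-\<^sup>1\<close> against \<open>w\<close>.
\<close>

lemma weighted_power_mean:
  fixes w h :: "'a \<Rightarrow> real"
  assumes p: "p > 1" and w: "\<And>x. w x \<ge> 0" "integrable M w" "(LINT x|M. w x) = 1"
    and wh: "integrable M (\<lambda>x. w x * h x)" and whp: "integrable M (\<lambda>x. w x * \<bar>h x\<bar> powr p)"
  shows "\<bar>LINT x|M. w x * h x\<bar> powr p \<le> (LINT x|M. w x * \<bar>h x\<bar> powr p)"
proof -
  define A where "A = (LINT x|M. w x * \<bar>h x\<bar>)"
  have i: "integrable M (\<lambda>x. w x * \<bar>h x\<bar>)"
    using integrable_abs[OF wh] w(1) by (simp add: abs_mult)
  have A0: "A \<ge> 0" unfolding A_def using w(1) by simp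
  have "\<bar>LINT x|M. w x * h x\<bar> \<le> (LINT x|M. \<bar>w x * h x\<bar>)" by (rule integral_abs_bound)
  also have "\<dots> = A" unfolding A_def using w(1) by (simp add: abs_mult)
  finally have le: "\<bar>LINT x|M. w x * h x\<bar> powr p \<le> A powr p" using p by (intro powr_mono2) auto
  define q where "q = p / (p - 1)"
  have q: "q > 1" "1 / p + 1 / q = 1" "(p - 1) * q = p" using p by (auto simp: q_def field_simps)
  have young: "\<bar>h x\<bar> * A powr (p - 1) \<le> \<bar>h x\<bar> powr p / p + A powr p / q" for x
    using Youngs_inequality[OF p q(1,2), of "\<bar>h x\<bar>" "A powr (p - 1)"] by (simp add: powr_powr q(3))
  have "A * A powr (p - 1) = (LINT x|M. (w x * \<bar>h x\<bar>) * A powr (p - 1))" by (simp add: A_def)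
  also have "\<dots> \<le> (LINT x|M. (w x * \<bar>h x\<bar> powr p) / p + w x * (A powr p / q))"
  proof (rule integral_mono)
    show "w x * \<bar>h x\<bar> * A powr (p - 1) \<le> w x * \<bar>h x\<bar> powr p / p + w x * (A powr p / q)" for x
      using mult_left_mono[OF young[of x] w(1)[of x]] by (simp add: algebra_simps)
  qed (use i w(2) whp in auto)
  also have "\<dots> = (LINT x|M. w x * \<bar>h x\<bar> powr p) / p + A powr p / q"
    using w whp by simp
  finally have "A * A powr (p - 1) \<le> (LINT x|M. w x * \<bar>h x\<bar> powr p) / p + A powr p / q" .
  moreover have "A * A powr (p - 1) = A powr p"
    using A0 by (cases "A = 0") (auto simp: powr_mult_base)
  moreover have "A powr p / q = A powr p - A powr p / p"
    using q(2) p by (simp add: q_def field_simps)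
  ultimately have "A powr p \<le> (LINT x|M. w x * \<bar>h x\<bar> powr p)"
    using p by (simp add: divide_le_cancel)
  with le show ?thesis by simp
qed

lemma abs_le_one_plus_powr:
  fixes t :: real assumes "p \<ge> 1" shows "\<bar>t\<bar> \<le> 1 + \<bar>t\<bar> powr p"
proof (cases "\<bar>t\<bar> \<le> 1")
  case True then show ?thesis by (metis add_increasing2 powr_ge_zero)
next
  case False
  then have "\<bar>t\<bar> powr 1 \<le> \<bar>t\<bar> powr p" using assms by (intro powr_mono) auto
  then show ?thesis using False by simp
qed

lemma powr_add_le:
  fixes a b :: real assumes "p \<ge> 0"
  shows "\<bar>a + b\<bar> powr p \<le> 2 powr p * (\<bar>a\<bar> powr p + \<bar>b\<bar> powr p)"
proof -
  let ?m = "max \<bar>a\<bar> \<bar>b\<bar>"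
  have "\<bar>a + b\<bar> powr p \<le> (2 * ?m) powr p" using assms by (intro powr_mono2) auto
  also have "\<dots> = 2 powr p * ?m powr p" by (simp add: powr_mult)
  also have "\<dots> \<le> 2 powr p * (\<bar>a\<bar> powr p + \<bar>b\<bar> powr p)" by (intro mult_left_mono) (auto simp: max_def)
  finally show ?thesis .
qed

lemma convolve_cong_AE:
  assumes "AE y in lebesgue. f y = g y" "f \<in> borel_measurable lebesgue" "g \<in> borel_measurable lebesgue" "continuous_on UNIV k"
  shows "convolve k f x = convolve k g x"
proof -
  have "continuous_on UNIV (\<lambda>y. k (x - y))"
    by (rule continuous_on_compose2[OF assms(4)]) (auto intro!: continuous_intros)
  then have "(\<lambda>y. k (x - y)) \<in> borel_measurable lebesgue" by (rule continuous_lebesgue_measurable)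
  then show ?thesis unfolding convolve_def using assms
    by (intro integral_cong_AE) auto
qed

text \<open>
By Jensen's inequality \<open>|k * f|\<^sup>p \<le> k * |f|\<^sup>p\<close>, and the integral of the right side is that of \<open>|f|\<^sup>p\<close> by
Fubini.  Fubini's theorem is applied to a Borel function equal to \<open>f\<close> almost everywhere, so that the
integrand is measurable for the product of Borel measures.
\<close>

lemma convolve_mollifier_Lp_bound:
  fixes f :: "real^'n::finite \<Rightarrow> real"
  assumes p: "p > 1" and e: "\<epsilon> > 0" and f: "integrable lebesgue f" and fp: "integrable lebesgue (\<lambda>x. \<bar>f x\<bar> powr p)"
  shows "integrable lebesgue (\<lambda>x. \<bar>convolve (mollifier \<epsilon>) f x\<bar> powr p)"
    "(LINT x|lebesgue. \<bar>convolve (mollifier \<epsilon>) f x\<bar> powr p) \<le> (LINT x|lebesgue. \<bar>f x\<bar> powr p)"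
proof -
  let ?k = "mollifier \<epsilon> :: real^'n \<Rightarrow> real"
  note M = mollifier_smooth_kernel[OF e, where 'n='n]
  have kc: "continuous_on UNIV ?k" using smooth_on_continuous[OF M(1)] .
  obtain B where B: "\<And>x. norm (?k x) \<le> B" "B \<ge> 0"
    by (rule bounded_of_compact_support[OF kc, of "cball 0 \<epsilon>"]) (use M(3) in auto)
  obtain g where g[measurable]: "g \<in> borel_measurable lborel" and fg: "AE x in lborel. f x = g x"
    using completion_ex_borel_measurable_real[OF borel_measurable_integrable[OF f]] by blast
  have [measurable]: "?k \<in> borel_measurable borel" using kc by (rule borel_measurable_continuous_onI)
  have fg': "AE x in lebesgue. f x = g x" using fg by (rule AE_completion)
  have g'[measurable]: "g \<in> borel_measurable lebesgue" using g by (rule measurable_completion)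
  have f'[measurable]: "f \<in> borel_measurable lebesgue" using f by simp
  have gi: "integrable lebesgue g" using f fg' by (subst integrable_cong_AE[symmetric, of f]) auto
  have gpi: "integrable lebesgue (\<lambda>x. \<bar>g x\<bar> powr p)"
    by (rule iffD1[OF integrable_cong_AE fp]) (use fg' in auto)
  have gi': "integrable lborel g" using gi by (subst (asm) integrable_completion) auto
  have gpi': "integrable lborel (\<lambda>x. \<bar>g x\<bar> powr p)" using gpi by (subst (asm) integrable_completion) auto
  have conv: "convolve ?k f x = convolve ?k g x" for x
    by (rule convolve_cong_AE[OF fg' f' g' kc])
  have conv': "convolve ?k g x = (LINT y|lborel. ?k (x - y) * g y)" for x
    unfolding convolve_def by (rule integral_completion) measurable
  have ik: "integrable lborel (\<lambda>y. ?k (x - y) * h y)" if "integrable lborel h" for x and h :: "real^'n \<Rightarrow> real"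
  proof (rule Bochner_Integration.integrable_bound)
    show "integrable lborel (\<lambda>y. B * h y)" using that by simp
    have [measurable]: "h \<in> borel_measurable lborel" using that by simp
    show "(\<lambda>y. ?k (x - y) * h y) \<in> borel_measurable lborel" by measurable
    show "AE y in lborel. norm (?k (x - y) * h y) \<le> norm (B * h y)"
      using B by (auto simp: abs_mult intro!: mult_right_mono)
  qed
  have jensen: "\<bar>convolve ?k g x\<bar> powr p \<le> (LINT y|lborel. ?k (x - y) * \<bar>g y\<bar> powr p)" for x
    unfolding conv'
    by (rule weighted_power_mean[OF p]) (use M(2) mollifier_translate[OF e] ik[OF gi'] ik[OF gpi'] in auto)
  have cc: "continuous_on UNIV (convolve ?k g)"
    using continuous_on_convolve[OF kc _ gi, of B] B by simp
  then have [measurable]: "convolve ?k g \<in> borel_measurable borel" by (rule borel_measurable_continuous_onI)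
  have "(\<integral>\<^sup>+x. ennreal (\<bar>convolve ?k g x\<bar> powr p) \<partial>lborel) \<le> (\<integral>\<^sup>+x. (\<integral>\<^sup>+y. ennreal (?k (x - y) * \<bar>g y\<bar> powr p) \<partial>lborel) \<partial>lborel)"
  proof (rule nn_integral_mono)
    fix x
    have "ennreal (\<bar>convolve ?k g x\<bar> powr p) \<le> ennreal (LINT y|lborel. ?k (x - y) * \<bar>g y\<bar> powr p)"
      using jensen by (rule ennreal_leI)
    also have "\<dots> = (\<integral>\<^sup>+y. ennreal (?k (x - y) * \<bar>g y\<bar> powr p) \<partial>lborel)"
      using ik[OF gpi'] M(2) by (intro nn_integral_eq_integral[symmetric]) auto
    finally show "ennreal (\<bar>convolve ?k g x\<bar> powr p) \<le> \<dots>" .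
  qed
  also have "\<dots> = (\<integral>\<^sup>+y. (\<integral>\<^sup>+x. ennreal (?k (x - y) * \<bar>g y\<bar> powr p) \<partial>lborel) \<partial>lborel)"
    by (rule lborel_pair.Fubini') measurable
  also have "\<dots> = (\<integral>\<^sup>+y. (\<integral>\<^sup>+x. ennreal (?k (x - y)) \<partial>lborel) * ennreal (\<bar>g y\<bar> powr p) \<partial>lborel)"
    using M(2) by (intro nn_integral_cong) (simp add: ennreal_mult nn_integral_multc)
  also have "\<dots> = (\<integral>\<^sup>+y. ennreal (\<bar>g y\<bar> powr p) \<partial>lborel)"
    by (simp add: mollifier_translate(3)[OF e])
  also have "\<dots> = ennreal (LINT y|lborel. \<bar>g y\<bar> powr p)"
    using gpi' by (intro nn_integral_eq_integral) auto
  finally have le: "(\<integral>\<^sup>+x. ennreal (\<bar>convolve ?k g x\<bar> powr p) \<partial>lborel) \<le> ennreal (LINT y|lborel. \<bar>g y\<bar> powr p)" .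
  have ic: "integrable lborel (\<lambda>x. \<bar>convolve ?k g x\<bar> powr p)"
  proof (rule integrableI_bounded)
    show "(\<integral>\<^sup>+x. ennreal (norm (\<bar>convolve ?k g x\<bar> powr p)) \<partial>lborel) < \<infinity>"
      using le by (simp add: order_le_less_trans[OF le])
  qed measurable
  then show "integrable lebesgue (\<lambda>x. \<bar>convolve ?k f x\<bar> powr p)"
    unfolding conv by (subst integrable_completion) auto
  have "ennreal (LINT x|lborel. \<bar>convolve ?k g x\<bar> powr p) \<le> ennreal (LINT y|lborel. \<bar>g y\<bar> powr p)"
    using le nn_integral_eq_integral[OF ic] by simp
  then have "(LINT x|lborel. \<bar>convolve ?k g x\<bar> powr p) \<le> (LINT y|lborel. \<bar>g y\<bar> powr p)"
    by (simp add: ennreal_le_iff)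
  moreover have "(LINT x|lebesgue. \<bar>convolve ?k f x\<bar> powr p) = (LINT x|lborel. \<bar>convolve ?k g x\<bar> powr p)"
    unfolding conv by (rule integral_completion) measurable
  moreover have "(LINT x|lebesgue. \<bar>f x\<bar> powr p) = (LINT x|lebesgue. \<bar>g x\<bar> powr p)"
    by (rule integral_cong_AE) (use fg' in auto)
  moreover have "(LINT x|lebesgue. \<bar>g x\<bar> powr p) = (LINT x|lborel. \<bar>g x\<bar> powr p)"
    by (rule integral_completion) measurable
  ultimately show "(LINT x|lebesgue. \<bar>convolve ?k f x\<bar> powr p) \<le> (LINT x|lebesgue. \<bar>f x\<bar> powr p)"
    by simp
qed

text \<open>
Truncating \<open>f\<close> to a bounded range changes it little in \<open>L\<^sup>p\<close>.  A measurable function is an almost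
everywhere limit of continuous functions; truncating these as well and cutting them off outside a ball
makes the convergence dominated.
\<close>

lemma continuous_dense_Lp:
  fixes f :: "real^'n::finite \<Rightarrow> real"
  assumes p: "p \<ge> 1" and f[measurable]: "f \<in> borel_measurable lebesgue" and fp: "integrable lebesgue (\<lambda>x. \<bar>f x\<bar> powr p)"
    and supp: "\<And>x. norm x > m \<Longrightarrow> f x = 0" and eta: "\<eta> > 0"
  obtains \<phi> where "continuous_on UNIV \<phi>" "\<And>x. norm x > m + 1 \<Longrightarrow> \<phi> x = 0"
    "integrable lebesgue (\<lambda>x. \<bar>f x - \<phi> x\<bar> powr p)" "(LINT x|lebesgue. \<bar>f x - \<phi> x\<bar> powr p) < \<eta>"
proof -
  define T :: "nat \<Rightarrow> real \<Rightarrow> real" where "T n t = max (- real n) (min (real n) t)" for n t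
  have T: "\<bar>T n t\<bar> \<le> n" "T n 0 = 0" "\<bar>t - T n t\<bar> \<le> \<bar>t\<bar>" for n t by (auto simp: T_def)
  have T_eq: "T n t = t" if "\<bar>t\<bar> \<le> n" for n t using that by (auto simp: T_def)
  have [measurable]: "T n \<in> borel_measurable borel" for n unfolding T_def by measurable
  have Tc: "continuous_on S (T n)" for n S unfolding T_def by (intro continuous_intros)
  have 1: "(\<lambda>n. LINT x|lebesgue. \<bar>f x - T n (f x)\<bar> powr p) \<longlonglongrightarrow> (LINT x|(lebesgue :: (real^'n) measure). 0)"
  proof (rule integral_dominated_convergence[OF _ _ fp])
    show "AE x in lebesgue. (\<lambda>n. \<bar>f x - T n (f x)\<bar> powr p) \<longlonglongrightarrow> 0"
    proof (rule AE_I2)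
      fix x
      obtain N where N: "\<bar>f x\<bar> \<le> real N" using real_arch_simple by blast
      show "(\<lambda>n. \<bar>f x - T n (f x)\<bar> powr p) \<longlonglongrightarrow> 0"
      proof (rule tendsto_eventually, rule eventually_sequentiallyI[of N])
        fix n assume "n \<ge> N"
        then have "\<bar>f x\<bar> \<le> n" using N by linarith
        then show "\<bar>f x - T n (f x)\<bar> powr p = 0" using T_eq by simp
      qed
    qed
    show "AE x in lebesgue. norm (\<bar>f x - T n (f x)\<bar> powr p) \<le> \<bar>f x\<bar> powr p" for n
      using T(3) p by (auto intro!: powr_mono2)
  qed measurable
  define \<eta>' where "\<eta>' = \<eta> / (2 powr p * 2)"
  have e': "\<eta>' > 0" using eta by (simp add: \<eta>'_def)
  from order_tendstoD(2)[OF 1, of \<eta>'] e' obtain c where c: "(LINT x|lebesgue. \<bar>f x - T c (f x)\<bar> powr p) < \<eta>'"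
    using eventually_happens' sequentially_bot by fastforce
  have i1: "integrable lebesgue (\<lambda>x. \<bar>f x - T c (f x)\<bar> powr p)"
    by (rule Bochner_Integration.integrable_bound[OF fp]) (use T(3) p in \<open>auto intro!: powr_mono2\<close>)
  have "f measurable_on UNIV" by (rule lebesgue_measurable_imp_measurable_on[OF f]) simp
  then obtain N g where N: "negligible N" and g: "\<And>n. continuous_on UNIV (g n)"
    and lim: "\<And>x. x \<notin> N \<Longrightarrow> (\<lambda>n. g n x) \<longlonglongrightarrow> f x"
    unfolding measurable_on_def by auto
  define \<kappa> where "\<kappa> x = max 0 (min 1 (m + 1 - norm x))" for x :: "real^'n"
  have chi: "0 \<le> \<kappa> x" "\<kappa> x \<le> 1" "norm x > m + 1 \<Longrightarrow> \<kappa> x = 0" "norm x \<le> m \<Longrightarrow> \<kappa> x = 1" for x by (auto simp: \<kappa>_def)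
  define \<phi> where "\<phi> n x = \<kappa> x * T c (g n x)" for n x
  have \<phi>c: "continuous_on UNIV (\<phi> n)" for n
    unfolding \<phi>_def \<kappa>_def by (intro continuous_intros continuous_on_compose2[OF Tc g]) auto
  have [measurable]: "\<phi> n \<in> borel_measurable lebesgue" for n using \<phi>c by (rule continuous_lebesgue_measurable)
  have AEN: "AE x in lebesgue. x \<notin> N"
    using N by (simp add: negligible_iff_null_sets AE_not_in)
  have bound: "norm (\<bar>T c (f x) - \<phi> n x\<bar> powr p) \<le> indicator (cball 0 (m + 1)) x * (2 * real c) powr p" for x n
  proof (cases "norm x \<le> m + 1")
    case True
    have "\<bar>\<phi> n x\<bar> \<le> 1 * real c" unfolding \<phi>_def abs_mult using chi[of x] T(1) by (intro mult_mono) auto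
    then have "\<bar>T c (f x) - \<phi> n x\<bar> \<le> 2 * real c" using T(1)[of c "f x"] by linarith
    then show ?thesis using True p by (auto intro!: powr_mono2)
  next
    case False
    then have "f x = 0" "\<phi> n x = 0" using supp[of x] chi(3)[of x] by (auto simp: \<phi>_def)
    then show ?thesis by (simp add: T(2))
  qed
  have ib: "integrable lebesgue (\<lambda>x::real^'n. indicator (cball 0 (m + 1)) x * (2 * real c) powr p)"
  proof -
    have "set_integrable lebesgue (cball (0::real^'n) (m + 1)) (\<lambda>x. (2 * real c) powr p)"
      by (intro set_integrable_compact) auto
    then show ?thesis by (simp add: set_integrable_def)
  qed
  have 2: "(\<lambda>n. LINT x|lebesgue. \<bar>T c (f x) - \<phi> n x\<bar> powr p) \<longlonglongrightarrow> (LINT x|(lebesgue :: (real^'n) measure). 0)"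
  proof (rule integral_dominated_convergence[OF _ _ ib])
    show "AE x in lebesgue. (\<lambda>n. \<bar>T c (f x) - \<phi> n x\<bar> powr p) \<longlonglongrightarrow> 0"
      using AEN
    proof eventually_elim
      fix x assume "x \<notin> N"
      have Teq: "T c (f x) = \<kappa> x * T c (f x)" using supp[of x] chi(4)[of x] by (cases "norm x \<le> m") (auto simp: T(2))
      have "isCont (T c) (f x)" using Tc[of UNIV c] continuous_on_eq_continuous_at by blast
      then have "(\<lambda>n. T c (g n x)) \<longlonglongrightarrow> T c (f x)"
        using lim[OF \<open>x \<notin> N\<close>] by (rule isCont_tendsto_compose)
      then have "(\<lambda>n. \<bar>\<kappa> x * T c (f x) - \<kappa> x * T c (g n x)\<bar>) \<longlonglongrightarrow> \<bar>\<kappa> x * T c (f x) - \<kappa> x * T c (f x)\<bar>"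
        by (intro tendsto_intros)
      then have "(\<lambda>n. \<bar>T c (f x) - \<phi> n x\<bar>) \<longlonglongrightarrow> 0" using Teq by (simp add: \<phi>_def)
      then show "(\<lambda>n. \<bar>T c (f x) - \<phi> n x\<bar> powr p) \<longlonglongrightarrow> 0"
        using p by (intro tendsto_zero_powrI[where b=p]) auto
    qed
  qed (use bound in auto)
  from order_tendstoD(2)[OF 2, of \<eta>'] e' obtain n where n: "(LINT x|lebesgue. \<bar>T c (f x) - \<phi> n x\<bar> powr p) < \<eta>'"
    using eventually_happens' sequentially_bot by fastforce
  have i2: "integrable lebesgue (\<lambda>x. \<bar>T c (f x) - \<phi> n x\<bar> powr p)"
    by (rule Bochner_Integration.integrable_bound[OF ib]) (use bound in auto)
  have le: "\<bar>f x - \<phi> n x\<bar> powr p \<le> 2 powr p * (\<bar>f x - T c (f x)\<bar> powr p + \<bar>T c (f x) - \<phi> n x\<bar> powr p)" for x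
    using powr_add_le[of p "f x - T c (f x)" "T c (f x) - \<phi> n x"] p by simp
  have i3: "integrable lebesgue (\<lambda>x. 2 powr p * (\<bar>f x - T c (f x)\<bar> powr p + \<bar>T c (f x) - \<phi> n x\<bar> powr p))"
    using i1 i2 by simp
  have i4: "integrable lebesgue (\<lambda>x. \<bar>f x - \<phi> n x\<bar> powr p)"
    by (rule Bochner_Integration.integrable_bound[OF i3]) (use le in \<open>auto intro: order_trans[OF _ abs_ge_self]\<close>)
  have "(LINT x|lebesgue. \<bar>f x - \<phi> n x\<bar> powr p) \<le> (LINT x|lebesgue. 2 powr p * (\<bar>f x - T c (f x)\<bar> powr p + \<bar>T c (f x) - \<phi> n x\<bar> powr p))"
    by (rule integral_mono[OF i4 i3 le])
  also have "\<dots> = 2 powr p * ((LINT x|lebesgue. \<bar>f x - T c (f x)\<bar> powr p) + (LINT x|lebesgue. \<bar>T c (f x) - \<phi> n x\<bar> powr p))"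
    using i1 i2 by simp
  also have "\<dots> < 2 powr p * (\<eta>' + \<eta>')" using c n by (intro mult_strict_left_mono add_strict_mono) auto
  also have "\<dots> = \<eta>" by (simp add: \<eta>'_def)
  finally show ?thesis
    using that[OF \<phi>c _ i4] chi(3) by (auto simp: \<phi>_def)
qed

lemma convolve_diff:
  fixes k :: "real^'n::finite \<Rightarrow> real"
  assumes "continuous_on UNIV k" "\<And>x. \<bar>k x\<bar> \<le> B" "integrable lebesgue f" "integrable lebesgue g"
  shows "convolve k (\<lambda>y. f y - g y) x = convolve k f x - convolve k g x"
  using integrable_convolution_integrand[OF assms(1,2,3), of x] integrable_convolution_integrand[OF assms(1,2,4), of x]
  by (simp add: convolve_def right_diff_distrib)

lemma mollifier_bounded:
  assumes "\<epsilon> > 0"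
  obtains B where "\<And>x::real^'n::finite. \<bar>mollifier \<epsilon> x\<bar> \<le> B"
  using bounded_of_compact_support[OF smooth_on_continuous[OF mollifier_smooth_kernel(1)[OF assms]], of "cball 0 \<epsilon>"] mollifier_smooth_kernel(3)[OF assms]
  by (metis compact_cball linorder_le_cases mem_cball_0 real_norm_def)

text \<open>
The convolution is an average of \<open>f\<close> over the ball of radius \<open>\<epsilon>\<close> about \<open>x\<close>.
\<close>

lemma convolve_mollifier_ge:
  fixes f :: "real^'n::finite \<Rightarrow> real"
  assumes e: "\<epsilon> > 0" and f: "integrable lebesgue f" and a: "\<And>y. norm (y - x) < \<epsilon> \<Longrightarrow> a \<le> f y"
  shows "a \<le> convolve (mollifier \<epsilon>) f x"
proof -
  note M = mollifier_smooth_kernel[OF e, where 'n='n]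
  obtain B where B: "\<And>x::real^'n. \<bar>mollifier \<epsilon> x\<bar> \<le> B" using mollifier_bounded[OF e] by blast
  have i1: "integrable lebesgue (\<lambda>y. mollifier \<epsilon> (x - y) * f y)"
    by (rule integrable_convolution_integrand[OF smooth_on_continuous[OF M(1)] B f])
  have m: "(\<lambda>y. mollifier \<epsilon> (x - y)) \<in> borel_measurable lborel"
    using mollifier_translate(1)[OF e, of x] by simp
  have i2: "integrable lebesgue (\<lambda>y. mollifier \<epsilon> (x - y))"
    using mollifier_translate(1)[OF e, of x] m by (subst integrable_completion) auto
  have e2: "(LINT y|lebesgue. mollifier \<epsilon> (x - y)) = 1"
    using mollifier_translate(2)[OF e, of x] m by (subst integral_completion) auto
  have "0 \<le> mollifier \<epsilon> (x - y) * (f y - a)" for y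
  proof (cases "norm (y - x) < \<epsilon>")
    case True then show ?thesis using a[of y] M(2)[of "x - y"] by simp
  next
    case False then show ?thesis using M(3)[of "x - y"] by (simp add: norm_minus_commute)
  qed
  then have "0 \<le> (LINT y|lebesgue. mollifier \<epsilon> (x - y) * (f y - a))"
    by (intro Bochner_Integration.integral_nonneg)
  also have "\<dots> = convolve (mollifier \<epsilon>) f x - a"
    using i1 i2 e2 by (simp add: right_diff_distrib convolve_def)
  finally show ?thesis by simp
qed

lemma convolve_mollifier_le:
  fixes f :: "real^'n::finite \<Rightarrow> real"
  assumes "\<epsilon> > 0" "integrable lebesgue f" "\<And>y. norm (y - x) < \<epsilon> \<Longrightarrow> f y \<le> a"
  shows "convolve (mollifier \<epsilon>) f x \<le> a"
  using convolve_mollifier_ge[of \<epsilon> "\<lambda>y. - f y" x "- a"] assms by (simp add: convolve_def)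

text \<open>
For a continuous \<open>\<phi>\<close> of compact support the mollifications converge uniformly.  A general \<open>f\<close> is
approximated by such a \<open>\<phi>\<close>, the error being controlled by the \<open>L\<^sup>p\<close> bound for the mollification of
\<open>f - \<phi>\<close>.
\<close>

lemma convolve_mollifier_tendsto_Lp:
  fixes f :: "real^'n::finite \<Rightarrow> real"
  assumes p: "p > 1" and f[measurable]: "f \<in> borel_measurable lebesgue" and fp: "integrable lebesgue (\<lambda>x. \<bar>f x\<bar> powr p)"
    and supp: "\<And>x. norm x > m \<Longrightarrow> f x = 0" and eta: "\<eta> > 0"
  obtains \<epsilon>\<^sub>0 where "\<epsilon>\<^sub>0 > 0" "\<And>\<epsilon>. 0 < \<epsilon> \<Longrightarrow> \<epsilon> < \<epsilon>\<^sub>0 \<Longrightarrow>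
     integrable lebesgue (\<lambda>x. \<bar>convolve (mollifier \<epsilon>) f x - f x\<bar> powr p) \<and>
     (LINT x|lebesgue. \<bar>convolve (mollifier \<epsilon>) f x - f x\<bar> powr p) < \<eta>"
proof -
  have ball_i: "integrable lebesgue (\<lambda>x::real^'n. indicator (cball 0 M) x * (c::real))" for M c
  proof -
    have "set_integrable lebesgue (cball (0::real^'n) M) (\<lambda>x. c)" by (intro set_integrable_compact) auto
    then show ?thesis by (simp add: set_integrable_def)
  qed
  have fi: "integrable lebesgue f"
  proof (rule Bochner_Integration.integrable_bound)
    show "integrable lebesgue (\<lambda>x. indicator (cball 0 m) x * 1 + \<bar>f x\<bar> powr p)"
      by (intro Bochner_Integration.integrable_add ball_i fp)
    show "AE x in lebesgue. norm (f x) \<le> norm (indicator (cball 0 m) x * 1 + \<bar>f x\<bar> powr p)"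
    proof (rule AE_I2)
      fix x
      have "\<bar>f x\<bar> \<le> indicator (cball 0 m) x * 1 + \<bar>f x\<bar> powr p"
      proof (cases "norm x > m")
        case False
        have "\<bar>f x\<bar> \<le> 1 + \<bar>f x\<bar> powr p" using p by (intro abs_le_one_plus_powr) simp
        then show ?thesis using False by simp
      qed (simp add: supp)
      then show "norm (f x) \<le> norm (indicator (cball 0 m) x * 1 + \<bar>f x\<bar> powr p)" by simp
    qed
  qed measurable
  define C where "C = 2 powr p"
  have C: "C > 0" by (simp add: C_def)
  define \<eta>1 where "\<eta>1 = \<eta> / (4 * (C + C * C))"
  have e1: "\<eta>1 > 0" using eta C by (simp add: \<eta>1_def add_pos_pos)
  have p1: "p \<ge> 1" using p by simp
  obtain \<phi> where \<phi>: "continuous_on UNIV \<phi>" "\<And>x. norm x > m + 1 \<Longrightarrow> \<phi> x = 0"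
    and i1: "integrable lebesgue (\<lambda>x. \<bar>f x - \<phi> x\<bar> powr p)" and l1: "(LINT x|lebesgue. \<bar>f x - \<phi> x\<bar> powr p) < \<eta>1"
    using continuous_dense_Lp[OF p1 f fp supp e1] by blast
  have \<phi>0: "\<And>x. x \<notin> cball 0 (m + 1) \<Longrightarrow> \<phi> x = 0" using \<phi>(2) by simp
  have \<phi>_ind: "indicator (cball 0 (m + 1)) x *\<^sub>R \<phi> x = \<phi> x" for x using \<phi>0[of x] by (cases "x \<in> cball 0 (m + 1)") auto
  have "set_integrable lebesgue (cball 0 (m + 1)) \<phi>"
    by (intro set_integrable_compact continuous_on_subset[OF \<phi>(1)]) auto
  then have \<phi>i: "integrable lebesgue \<phi>" unfolding set_integrable_def \<phi>_ind .
  have fm: "integrable lebesgue (\<lambda>x. f x - \<phi> x)" using fi \<phi>i by simp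
  define V where "V = (LINT x|lebesgue. indicator (cball (0::real^'n) (m + 2)) x * (1::real))"
  have V: "V \<ge> 0" unfolding V_def by simp
  define d where "d = (\<eta>1 / (V + 1)) powr (1 / p)"
  have d: "d > 0" "d powr p * V \<le> \<eta>1"
  proof -
    show "d > 0" using e1 V by (simp add: d_def)
    have "d powr p = \<eta>1 / (V + 1)" using e1 V p by (simp add: d_def powr_powr)
    then have "d powr p * (V + 1) = \<eta>1" using V by simp
    moreover have "d powr p * V \<le> d powr p * (V + 1)" by (intro mult_left_mono) auto
    ultimately show "d powr p * V \<le> \<eta>1" by simp
  qed
  have "uniformly_continuous_on (cball 0 (m + 3)) \<phi>"
    by (intro compact_uniformly_continuous continuous_on_subset[OF \<phi>(1)]) auto
  then obtain \<epsilon>1 where \<epsilon>1: "\<epsilon>1 > 0"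
    "\<And>x y. x \<in> cball 0 (m + 3) \<Longrightarrow> y \<in> cball 0 (m + 3) \<Longrightarrow> dist y x < \<epsilon>1 \<Longrightarrow> dist (\<phi> y) (\<phi> x) < d"
    unfolding uniformly_continuous_on_def using d(1) by metis
  show thesis
  proof (rule that)
    show "min 1 \<epsilon>1 > 0" using \<epsilon>1 by simp
    fix \<epsilon> :: real assume \<epsilon>: "0 < \<epsilon>" "\<epsilon> < min 1 \<epsilon>1"
    let ?c = "convolve (mollifier \<epsilon>) :: (real^'n \<Rightarrow> real) \<Rightarrow> real^'n \<Rightarrow> real"
    obtain B where B: "\<And>x::real^'n. \<bar>mollifier \<epsilon> x\<bar> \<le> B" using mollifier_bounded[OF \<epsilon>(1)] by blast
    have kc: "continuous_on UNIV (mollifier \<epsilon> :: real^'n \<Rightarrow> real)" by (rule smooth_on_continuous[OF mollifier_smooth_kernel(1)[OF \<epsilon>(1)]])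
    have cm[measurable]: "?c h \<in> borel_measurable lebesgue" if "integrable lebesgue h" for h
      by (rule continuous_lebesgue_measurable[OF continuous_on_convolve[OF kc B that]])
    note b1 = convolve_mollifier_Lp_bound[OF p \<epsilon>(1) fm i1]
    have b2: "\<bar>?c \<phi> x - \<phi> x\<bar> powr p \<le> indicator (cball 0 (m + 2)) x * d powr p" for x
    proof (cases "norm x \<le> m + 2")
      case True
      have cl: "\<bar>\<phi> y - \<phi> x\<bar> \<le> d" if "norm (y - x) < \<epsilon>" for y
      proof -
        have "norm y \<le> norm x + norm (y - x)" by (metis add.commute diff_add_cancel norm_triangle_ineq)
        then have "y \<in> cball 0 (m + 3)" "x \<in> cball 0 (m + 3)" using True that \<epsilon> by auto
        then show ?thesis using \<epsilon>1(2)[of x y] that \<epsilon> by (simp add: dist_norm)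
      qed
      have "\<phi> x - d \<le> ?c \<phi> x" using cl by (intro convolve_mollifier_ge[OF \<epsilon>(1) \<phi>i]) force
      moreover have "?c \<phi> x \<le> \<phi> x + d" using cl by (intro convolve_mollifier_le[OF \<epsilon>(1) \<phi>i]) force
      ultimately have "\<bar>?c \<phi> x - \<phi> x\<bar> \<le> d" by linarith
      then show ?thesis using True p by (auto intro!: powr_mono2)
    next
      case False
      have z: "\<phi> y = 0" if "norm (y - x) < \<epsilon>" for y
      proof -
        have "norm x \<le> norm y + norm (y - x)" by (metis add.commute diff_add_cancel norm_minus_commute norm_triangle_ineq)
        then show ?thesis using False that \<epsilon> by (intro \<phi>(2)) linarith
      qed
      have "0 \<le> ?c \<phi> x" using z by (intro convolve_mollifier_ge[OF \<epsilon>(1) \<phi>i]) force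
      moreover have "?c \<phi> x \<le> 0" using z by (intro convolve_mollifier_le[OF \<epsilon>(1) \<phi>i]) force
      ultimately have "?c \<phi> x = 0" by simp
      moreover have "\<phi> x = 0" using False by (intro \<phi>(2)) simp
      ultimately show ?thesis by simp
    qed
    have i2: "integrable lebesgue (\<lambda>x. \<bar>?c \<phi> x - \<phi> x\<bar> powr p)"
    proof (rule Bochner_Integration.integrable_bound)
      show "integrable lebesgue (\<lambda>x::real^'n. indicator (cball 0 (m + 2)) x * d powr p)" by (rule ball_i)
      have [measurable]: "?c \<phi> \<in> borel_measurable lebesgue" "\<phi> \<in> borel_measurable lebesgue" using cm \<phi>i by auto
      show "(\<lambda>x. \<bar>?c \<phi> x - \<phi> x\<bar> powr p) \<in> borel_measurable lebesgue" by measurable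
    qed (use b2 in \<open>auto intro: order_trans[OF _ abs_ge_self]\<close>)
    have l2: "(LINT x|lebesgue. \<bar>?c \<phi> x - \<phi> x\<bar> powr p) \<le> \<eta>1"
    proof -
      have "(LINT x|lebesgue. \<bar>?c \<phi> x - \<phi> x\<bar> powr p) \<le> (LINT x|lebesgue. indicator (cball (0::real^'n) (m + 2)) x * d powr p)"
        by (rule integral_mono[OF i2 ball_i b2])
      also have "\<dots> = d powr p * V" by (simp add: V_def)
      finally show ?thesis using d by simp
    qed
    let ?R = "\<lambda>x. C * (\<bar>?c (\<lambda>y. f y - \<phi> y) x\<bar> powr p + C * (\<bar>?c \<phi> x - \<phi> x\<bar> powr p + \<bar>f x - \<phi> x\<bar> powr p))"
    have le: "\<bar>?c f x - f x\<bar> powr p \<le> ?R x" for x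
    proof -
      have eq: "?c f x - f x = ?c (\<lambda>y. f y - \<phi> y) x + ((?c \<phi> x - \<phi> x) + - (f x - \<phi> x))"
        using convolve_diff[OF kc B fi \<phi>i] by simp
      have "\<bar>?c f x - f x\<bar> powr p \<le> C * (\<bar>?c (\<lambda>y. f y - \<phi> y) x\<bar> powr p + \<bar>(?c \<phi> x - \<phi> x) + - (f x - \<phi> x)\<bar> powr p)"
        unfolding C_def using p by (subst eq) (rule powr_add_le, simp)
      also have "\<dots> \<le> ?R x"
        using powr_add_le[of p "?c \<phi> x - \<phi> x" "- (f x - \<phi> x)"] p C
        unfolding abs_minus_cancel by (intro mult_left_mono add_left_mono) (auto simp: C_def)
      finally show ?thesis .
    qed
    have iR: "integrable lebesgue ?R" using b1(1) i1 i2 by simp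
    have i3: "integrable lebesgue (\<lambda>x. \<bar>?c f x - f x\<bar> powr p)"
    proof (rule Bochner_Integration.integrable_bound[OF iR])
      have [measurable]: "?c f \<in> borel_measurable lebesgue" using cm fi by auto
      show "(\<lambda>x. \<bar>?c f x - f x\<bar> powr p) \<in> borel_measurable lebesgue" by measurable
    qed (use le in \<open>auto intro: order_trans[OF _ abs_ge_self]\<close>)
    have "(LINT x|lebesgue. \<bar>?c f x - f x\<bar> powr p) \<le> (LINT x|lebesgue. ?R x)"
      by (rule integral_mono[OF i3 iR le])
    also have "\<dots> = C * ((LINT x|lebesgue. \<bar>?c (\<lambda>y. f y - \<phi> y) x\<bar> powr p) + C * ((LINT x|lebesgue. \<bar>?c \<phi> x - \<phi> x\<bar> powr p) + (LINT x|lebesgue. \<bar>f x - \<phi> x\<bar> powr p)))"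
      using b1(1) i1 i2 by simp
    also have "\<dots> \<le> C * (\<eta>1 + C * (\<eta>1 + \<eta>1))"
      using C b1(2) l1 l2 by (intro mult_left_mono add_mono) auto
    also have "\<dots> < \<eta>"
    proof -
      have "C * (\<eta>1 + C * (\<eta>1 + \<eta>1)) \<le> 2 * (C + C * C) * \<eta>1" using C e1 by (simp add: algebra_simps)
      also have "\<dots> = \<eta> / 2" using C add_pos_pos[OF C mult_pos_pos[OF C C]] by (simp add: \<eta>1_def field_simps)
      finally show ?thesis using eta by simp
    qed
    finally show "integrable lebesgue (\<lambda>x. \<bar>?c f x - f x\<bar> powr p) \<and> (LINT x|lebesgue. \<bar>?c f x - f x\<bar> powr p) < \<eta>"
      using i3 by simp
  qed
qed

section \<open>Comparison of strict subsolutions with \<open>p\<close>-superharmonic functions\<close>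

lemma powr_mult_self: "p > 1 \<Longrightarrow> x \<ge> 0 \<Longrightarrow> x powr (p - 2) * x = x powr (p - 1)" for x :: real
  using powr_mult_base[of x "p - 2"] by (simp add: mult.commute)

text \<open>
By the Cauchy--Schwarz inequality the inner product is at least
\<open>(|a|\<^sup>p\<^sup>-\<^sup>1 - |b|\<^sup>p\<^sup>-\<^sup>1) (|a| - |b|)\<close>, whose factors have the same sign.
\<close>

lemma p_flux_monotone:
  fixes a b :: "'a::real_inner"
  assumes p: "p > 1"
  shows "0 \<le> (norm a powr (p - 2) *\<^sub>R a - norm b powr (p - 2) *\<^sub>R b) \<bullet> (a - b)"
proof -
  let ?\<alpha> = "norm a" and ?\<beta> = "norm b"
  let ?A = "?\<alpha> powr (p - 2)" and ?B = "?\<beta> powr (p - 2)"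
  have "(?A + ?B) * (a \<bullet> b) \<le> (?A + ?B) * (?\<alpha> * ?\<beta>)" by (intro mult_left_mono norm_cauchy_schwarz) auto
  then have "(?A *\<^sub>R a - ?B *\<^sub>R b) \<bullet> (a - b) \<ge> ?A * ?\<alpha>\<^sup>2 + ?B * ?\<beta>\<^sup>2 - (?A + ?B) * (?\<alpha> * ?\<beta>)"
    by (simp add: inner_diff_left inner_diff_right inner_commute dot_square_norm algebra_simps)
  also have "?A * ?\<alpha>\<^sup>2 + ?B * ?\<beta>\<^sup>2 - (?A + ?B) * (?\<alpha> * ?\<beta>) = (?A * ?\<alpha> - ?B * ?\<beta>) * (?\<alpha> - ?\<beta>)"
    by (simp add: power2_eq_square algebra_simps)
  also have "\<dots> = (?\<alpha> powr (p - 1) - ?\<beta> powr (p - 1)) * (?\<alpha> - ?\<beta>)" using p by (simp add: powr_mult_self)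
  finally have "(?A *\<^sub>R a - ?B *\<^sub>R b) \<bullet> (a - b) \<ge> (?\<alpha> powr (p - 1) - ?\<beta> powr (p - 1)) * (?\<alpha> - ?\<beta>)" .
  moreover have "(?\<alpha> powr (p - 1) - ?\<beta> powr (p - 1)) * (?\<alpha> - ?\<beta>) \<ge> 0"
  proof (cases "?\<alpha> \<le> ?\<beta>")
    case True
    then have "?\<alpha> powr (p - 1) \<le> ?\<beta> powr (p - 1)" using p by (intro powr_mono2) auto
    then show ?thesis using True by (intro mult_nonpos_nonpos) auto
  next
    case False
    then have "?\<beta> powr (p - 1) \<le> ?\<alpha> powr (p - 1)" using p by (intro powr_mono2) auto
    then show ?thesis using False by (intro mult_nonneg_nonneg) auto
  qed
  ultimately show ?thesis by simp
qed

text \<open>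
Used like Hoelder's inequality: a small \<open>\<eta>\<close> is chosen first, and then \<open>y\<close>, the
error of a mollification, is made small in \<open>L\<^sup>p\<close>.
\<close>

lemma weighted_Young:
  fixes x y :: real
  assumes p: "p > 1" and "x \<ge> 0" "y \<ge> 0" and e: "\<eta> > 0"
  shows "x powr (p - 1) * y \<le> \<eta> * x powr p + \<eta> powr (1 - p) * y powr p"
proof (cases "y \<le> \<eta> * x")
  case True
  have "x powr (p - 1) * y \<le> x powr (p - 1) * (\<eta> * x)" using True by (intro mult_left_mono) auto
  also have "\<dots> = \<eta> * x powr p" using powr_mult_base[of x "p - 1"] assms by (simp add: mult_ac)
  finally show ?thesis by (simp add: add_increasing2)
next
  case False
  then have "x powr (p - 1) * y \<le> (y / \<eta>) powr (p - 1) * y"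
    using assms by (intro mult_right_mono powr_mono2) (auto simp: field_simps)
  also have "(y / \<eta>) powr (p - 1) = \<eta> powr (1 - p) * y powr (p - 1)"
    using assms powr_minus_divide[of \<eta> "p - 1"] by (simp add: powr_divide)
  also have "\<eta> powr (1 - p) * y powr (p - 1) * y = \<eta> powr (1 - p) * (y powr (p - 1) * y)" by simp
  also have "y powr (p - 1) * y = y powr p" using powr_mult_base[of y "p - 1"] assms by (simp add: mult.commute)
  finally show ?thesis using e by (simp add: add_increasing)
qed

lemma locally_Lp_restrict_compact:
  fixes f :: "real^'n::finite \<Rightarrow> real"
  assumes p: "p \<ge> 1" and f: "locally_Lp p G f" and K: "compact K" "K \<subseteq> G"
  shows "(\<lambda>x. indicator K x * f x) \<in> borel_measurable lebesgue"
    "integrable lebesgue (\<lambda>x. \<bar>indicator K x * f x\<bar> powr p)"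
    "integrable lebesgue (\<lambda>x. indicator K x * f x)"
proof -
  have KS: "K \<in> sets lebesgue" using K by (simp add: borel_compact)
  have "(\<lambda>x. indicator G x * f x) \<in> borel_measurable lebesgue"
    using f by (simp add: locally_Lp_def set_borel_measurable_def)
  then have "(\<lambda>x. indicator K x * (indicator G x * f x)) \<in> borel_measurable lebesgue"
    by (rule borel_measurable_times[OF borel_measurable_indicator[OF KS]])
  moreover have "indicator K x * (indicator G x * f x) = indicator K x * f x" for x
    using K(2) by (auto simp: indicator_def)
  ultimately show m: "(\<lambda>x. indicator K x * f x) \<in> borel_measurable lebesgue" by simp
  have "set_integrable lebesgue K (\<lambda>x. norm (f x) powr p)" using f K by (simp add: locally_Lp_def)
  moreover have "indicator K x * (norm (f x) powr p) = \<bar>indicator K x * f x\<bar> powr p" for x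
    by (auto simp: indicator_def)
  ultimately show ip: "integrable lebesgue (\<lambda>x. \<bar>indicator K x * f x\<bar> powr p)"
    by (simp add: set_integrable_def)
  have iK: "integrable lebesgue (\<lambda>x. indicator K x * (1::real))"
    using set_integrable_compact[OF K(1), of "\<lambda>x. 1::real"] by (simp add: set_integrable_def)
  show "integrable lebesgue (\<lambda>x. indicator K x * f x)"
  proof (rule Bochner_Integration.integrable_bound[OF Bochner_Integration.integrable_add[OF iK ip] m], rule AE_I2)
    fix x
    have "\<bar>f x\<bar> \<le> 1 + \<bar>f x\<bar> powr p" by (rule abs_le_one_plus_powr[OF p])
    then show "norm (indicator K x * f x) \<le> norm (indicator K x * 1 + \<bar>indicator K x * f x\<bar> powr p)"
      by (auto simp: indicator_def)
  qed
qed

lemma locally_Lp_component: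
  fixes g :: "real^'n::finite \<Rightarrow> real^'n"
  assumes p: "p \<ge> 0" and g: "locally_Lp p G g"
  shows "locally_Lp p G (\<lambda>x. g x $ i)"
  unfolding locally_Lp_def
proof (intro conjI allI impI)
  have gm: "(\<lambda>x. indicator G x *\<^sub>R g x) \<in> borel_measurable lebesgue"
    using g by (simp add: locally_Lp_def set_borel_measurable_def)
  have c: "(\<lambda>v::real^'n. v $ i) \<in> borel_measurable borel"
    by (intro borel_measurable_continuous_onI continuous_intros)
  have gi: "(\<lambda>x. indicator G x * (g x $ i)) \<in> borel_measurable lebesgue"
    using measurable_compose[OF gm c] by simp
  then show "set_borel_measurable lebesgue G (\<lambda>x. g x $ i)"
    by (simp add: set_borel_measurable_def)
  fix K assume K: "compact K \<and> K \<subseteq> G"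
  then have i: "integrable lebesgue (\<lambda>x. indicator K x *\<^sub>R norm (g x) powr p)"
    using g by (simp add: locally_Lp_def set_integrable_def)
  have KS: "K \<in> sets lebesgue" using K by (simp add: borel_compact)
  have "integrable lebesgue (\<lambda>x. indicator K x * (norm (g x $ i) powr p))"
  proof (rule Bochner_Integration.integrable_bound[OF i])
    have "(\<lambda>x. indicator K x * (norm (indicator G x * (g x $ i)) powr p)) \<in> borel_measurable lebesgue"
      using KS gi by measurable
    moreover have "indicator K x * (norm (indicator G x * (g x $ i)) powr p) = indicator K x * (norm (g x $ i) powr p)" for x
      using K by (auto simp: indicator_def)
    ultimately show "(\<lambda>x. indicator K x * (norm (g x $ i) powr p)) \<in> borel_measurable lebesgue" by (simp only:)
    show "AE x in lebesgue. norm (indicator K x * (norm (g x $ i) powr p)) \<le> norm (indicator K x *\<^sub>R norm (g x) powr p)"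
      using p by (auto simp: indicator_def component_le_norm_cart intro!: powr_mono2)
  qed
  then show "set_integrable lebesgue K (\<lambda>x. norm (g x $ i) powr p)" by (simp add: set_integrable_def)
qed

text \<open>
The kernel \<open>y \<mapsto> mollifier \<epsilon> (x - y)\<close> is a test function when the ball about \<open>x\<close> lies in \<open>G\<close>, so the
definition of the weak gradient moves the derivative from the kernel to \<open>u\<close>.
\<close>

lemma mollified_weak_gradient:
  fixes u :: "real^'n::finite \<Rightarrow> real"
  assumes p: "p \<ge> 1" and ug: "sobolev_loc_gradient p G u g" and K: "compact K" "K \<subseteq> G"
    and e: "\<epsilon> > 0" and x: "cball x \<epsilon> \<subseteq> K"
  shows "partial_deriv i (convolve (mollifier \<epsilon>) (\<lambda>y. indicator K y * u y)) x
    = convolve (mollifier \<epsilon>) (\<lambda>y. indicator K y * g y $ i) x"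
proof -
  let ?k = "mollifier \<epsilon> :: real^'n \<Rightarrow> real"
  note M = mollifier_smooth_kernel[OF e, where 'n='n]
  have k0: "\<And>z. z \<notin> cball 0 \<epsilon> \<Longrightarrow> ?k z = 0" using M(3) by simp
  have pk0: "partial_deriv i ?k z = 0" if "z \<notin> cball 0 \<epsilon>" for z
    by (rule partial_deriv_outside_support[OF closed_cball k0 that])
  have Lu: "locally_Lp p G u" using ug by (simp add: sobolev_loc_gradient_def)
  define \<psi> where "\<psi> y = ?k (x - y)" for y
  have \<psi>_smooth: "smooth_on UNIV \<psi>"
  proof -
    have "(x - y) \<bullet> (x - y) = (\<Sum>b\<in>Basis. (b \<bullet> (y - x))\<^sup>2)" for y
      using euclidean_inner[of "y - x" "y - x"]
      by (simp add: power2_eq_square inner_commute) (simp add: inner_diff_left inner_diff_right algebra_simps)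
    then have eq: "\<psi> = (\<lambda>y. (1 / (LINT y|lebesgue. flat (\<epsilon>\<^sup>2 - y \<bullet> (y::real^'n)))) * flat (\<epsilon>\<^sup>2 - (\<Sum>b\<in>Basis. (b \<bullet> (y - x))\<^sup>2)))"
      by (auto simp: \<psi>_def mollifier_def)
    show ?thesis unfolding eq
      by (intro smooth_on_mult smooth_on_const smooth_on_flat smooth_on_diff smooth_on_sum_squares) auto
  qed
  have \<psi>_sub: "{y. \<psi> y \<noteq> 0} \<subseteq> cball x \<epsilon>"
    using k0 unfolding \<psi>_def by (force simp: dist_norm)
  then have cl: "closure {y. \<psi> y \<noteq> 0} \<subseteq> cball x \<epsilon>" by (rule closure_minimal) simp
  have "compact (closure {y. \<psi> y \<noteq> 0})"
    using compact_Int_closed[OF compact_cball[of x \<epsilon>] closed_closure[of "{y. \<psi> y \<noteq> 0}"]] cl by (simp add: Int_absorb1)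
  then have test: "test_function G \<psi>"
    using \<psi>_smooth cl x K(2) unfolding test_function_def smooth_on_def C_class_iff by blast
  have p\<psi>: "partial_deriv i \<psi> y = - partial_deriv i ?k (x - y)" for y
  proof -
    have "(?k has_derivative (\<lambda>h. gradient ?k (x - y) \<bullet> h)) (at (x - y))"
      by (rule has_derivative_gradient[OF smooth_on_differentiable[OF M(1)]]) simp
    then have "(\<psi> has_derivative (\<lambda>h. gradient ?k (x - y) \<bullet> (- h))) (at y)"
      unfolding \<psi>_def[abs_def]
      by (rule has_derivative_compose[where f="\<lambda>y. x - y", rotated]) (auto intro!: derivative_eq_intros)
    from partial_deriv_eq[OF this, of i] show ?thesis by (simp add: inner_axis gradient_component)
  qed
  have "partial_deriv i (convolve ?k (\<lambda>y. indicator K y * u y)) x = convolve (partial_deriv i ?k) (\<lambda>y. indicator K y * u y) x"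
    by (rule partial_deriv_convolve[OF M(1) compact_cball k0 locally_Lp_restrict_compact(3)[OF p Lu K]])
  also have "\<dots> = - (LINT y:G|lebesgue. u y * partial_deriv i \<psi> y)"
  proof -
    have "partial_deriv i ?k (x - y) * (indicator K y * u y) = - (indicator G y *\<^sub>R (u y * partial_deriv i \<psi> y))" for y
    proof (cases "y \<in> cball x \<epsilon>")
      case True then show ?thesis using x K(2) by (auto simp: indicator_def p\<psi>)
    next
      case False
      then have "x - y \<notin> cball 0 \<epsilon>" by (simp add: dist_norm norm_minus_commute)
      then show ?thesis using pk0 by (simp add: p\<psi>)
    qed
    then show ?thesis by (simp add: convolve_def set_lebesgue_integral_def)
  qed
  also have "\<dots> = (LINT y:G|lebesgue. g y $ i * \<psi> y)"
    using ug test by (simp add: sobolev_loc_gradient_def)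
  also have "\<dots> = convolve ?k (\<lambda>y. indicator K y * g y $ i) x"
  proof -
    have "indicator G y *\<^sub>R (g y $ i * \<psi> y) = ?k (x - y) * (indicator K y * g y $ i)" for y
    proof (cases "y \<in> cball x \<epsilon>")
      case True then show ?thesis using x K(2) by (auto simp: indicator_def \<psi>_def)
    next
      case False
      then have "x - y \<notin> cball 0 \<epsilon>" by (simp add: dist_norm norm_minus_commute)
      then show ?thesis using k0 by (simp add: \<psi>_def)
    qed
    then show ?thesis unfolding convolve_def set_lebesgue_integral_def by (simp only:)
  qed
  finally show ?thesis .
qed

lemma sum_powr_le:
  fixes a :: "'n::finite \<Rightarrow> real"
  assumes "p \<ge> 0" "\<And>i. a i \<ge> 0"
  shows "(\<Sum>i\<in>UNIV. a i) powr p \<le> real CARD('n) powr p * (\<Sum>i\<in>UNIV. a i powr p)"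
proof -
  have "Max (range a) \<in> range a" by (rule Max_in) auto
  then obtain j where j': "Max (range a) = a j" by blast
  have j: "a i \<le> a j" for i unfolding j'[symmetric] by (rule Max_ge) auto
  have "(\<Sum>i\<in>UNIV. a i) \<le> real CARD('n) * a j" using sum_bounded_above[of UNIV a "a j"] j by simp
  then have "(\<Sum>i\<in>UNIV. a i) powr p \<le> (real CARD('n) * a j) powr p"
    using assms by (intro powr_mono2 sum_nonneg) auto
  also have "\<dots> = real CARD('n) powr p * a j powr p" using assms by (simp add: powr_mult)
  also have "\<dots> \<le> real CARD('n) powr p * (\<Sum>i\<in>UNIV. a i powr p)"
    by (intro mult_left_mono member_le_sum) auto
  finally show ?thesis .
qed

text \<open>
The test function \<open>\<theta> = flat (\<phi> - e - u\<^sub>\<epsilon>)\<close> vanishes near the boundary of a neighbourhood of \<open>K\<close>, since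
\<open>u \<ge> \<phi>\<close> off \<open>K\<close>.  Write \<open>X\<close> and \<open>F\<close> for the fluxes of \<open>\<phi>\<close> and \<open>u\<close>, \<open>g\<close> for the weak gradient of
\<open>u\<close> and \<open>g\<^sub>\<epsilon>\<close> for its mollification.  Then \<open>\<nabla>\<theta> = h (\<nabla>\<phi> - g\<^sub>\<epsilon>)\<close> with \<open>0 \<le> h \<le> 2\<close>, and
\<open>\<integral> div X \<theta> = - \<integral> X \<bullet> \<nabla>\<theta> \<le> \<integral> (F - X) \<bullet> \<nabla>\<theta> = \<integral> h (F - X) \<bullet> (\<nabla>\<phi> - g) + \<integral> h (F - X) \<bullet> (g - g\<^sub>\<epsilon>)\<close>.

The first integral on the right is nonpositive by monotonicity of the flux.  The second tends to zero
uniformly in \<open>h\<close>, as \<open>F - X\<close> is in the dual of \<open>L\<^sup>p\<close>.  On the left \<open>\<theta>\<close> converges in \<open>L\<^sup>1\<close> with \<open>u\<^sub>\<epsilon>\<close>,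
as \<open>flat\<close> is Lipschitz.  In the limit a nonnegative function has integral at most zero.
\<close>

lemma comparison_AE:
  fixes u \<phi> :: "real^'n::finite \<Rightarrow> real"
  assumes p: "p > 1" and ug: "sobolev_loc_gradient p G u g"
    and super: "\<And>\<theta>. test_function G \<theta> \<Longrightarrow> (\<And>x. 0 \<le> \<theta> x) \<Longrightarrow>
           (LINT x:G|lebesgue. norm (g x) powr (p - 2) * (g x \<bullet> gradient \<theta> x)) \<ge> 0"
    and U: "open U" "U \<subseteq> G" and \<phi>: "smooth_on U \<phi>" and X: "C1_field_on U (p_flux p \<phi>)"
    and div: "\<And>x. x \<in> U \<Longrightarrow> divergence (p_flux p \<phi>) x > 0"
    and K: "compact K" "K \<noteq> {}" "K \<subseteq> U" and off: "\<And>x. x \<in> U - K \<Longrightarrow> \<phi> x \<le> u x" and e: "e > 0"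
  shows "AE x in lebesgue. x \<in> U \<longrightarrow> \<phi> x - e \<le> u x"
proof -
  have p1: "p \<ge> 1" "p \<ge> 0" using p by auto
  define X where "X = p_flux p \<phi>"
  have X_eq: "X x = norm (gradient \<phi> x) powr (p - 2) *\<^sub>R gradient \<phi> x" for x
    by (simp add: X_def p_flux_def)
  note X = X[folded X_def] and div = div[folded X_def]
  have Lu: "locally_Lp p G u" and Lg: "locally_Lp p G g" using ug by (auto simp: sobolev_loc_gradient_def)
  obtain r where r: "r > 0" "(\<Union>x\<in>K. cball x r) \<subseteq> U"
    using compact_subset_open_imp_cball_epsilon_subset[OF K(1) U(1) K(3)] by blast
  define \<delta> where "\<delta> = r / 3"
  have \<delta>: "\<delta> > 0" using r by (simp add: \<delta>_def)
  \<comment> \<open>Test functions are supported in \<open>K'\<close>, given by a formula on \<open>N\<close>, and depend on \<open>u\<close> only through \<open>K1\<close>.\<close>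
  define K1 where "K1 = {x. infdist x K \<le> 3 * \<delta>}"
  define K' where "K' = {x. infdist x K \<le> \<delta>}"
  define N where "N = {x. infdist x K < 2 * \<delta>}"
  have K1: "compact K1" "K1 \<subseteq> U"
  proof -
    show "compact K1" unfolding K1_def using K \<delta> by (intro compact_infdist_le) auto
    show "K1 \<subseteq> U"
    proof
      fix x assume "x \<in> K1"
      moreover obtain y where "y \<in> K" "infdist x K = dist x y"
        using infdist_attains_inf[OF compact_imp_closed[OF K(1)] K(2)] by blast
      ultimately show "x \<in> U" using r(2) by (force simp: K1_def \<delta>_def dist_commute)
    qed
  qed
  have K': "compact K'" "K' \<subseteq> U" "K' \<subseteq> N" "K' \<subseteq> K1" "K \<subseteq> K'"
  proof -
    show "compact K'" unfolding K'_def using K \<delta> by (intro compact_infdist_le) auto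
    show s: "K' \<subseteq> K1" using \<delta> by (auto simp: K'_def K1_def)
    show "K' \<subseteq> U" using s K1(2) by (rule subset_trans)
    show "K' \<subseteq> N" "K \<subseteq> K'" using \<delta> by (auto simp: K'_def N_def)
  qed
  have N: "open N" "N \<subseteq> U" "N \<subseteq> K1"
  proof -
    show "open N" unfolding N_def by (intro open_Collect_less continuous_intros)
    show s: "N \<subseteq> K1" using \<delta> by (auto simp: N_def K1_def)
    show "N \<subseteq> U" using s K1(2) by (rule subset_trans)
  qed
  have K1G: "K1 \<subseteq> G" using K1 U by blast
  note R0 = locally_Lp_restrict_compact[OF p1(1) Lu K1(1) K1G]
  define f0 where "f0 x = indicator K1 x * u x" for x
  define f where "f i x = indicator K1 x * (g x $ i)" for i x
  note R1 = locally_Lp_restrict_compact[OF p1(1) locally_Lp_component[OF p1(2) Lg] K1(1) K1G]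
  obtain m0 where "\<forall>x\<in>K1. norm x \<le> m0" using compact_imp_bounded[OF K1(1)] bounded_iff by blast
  then have m0: "norm x > m0 \<Longrightarrow> x \<notin> K1" for x by force
  have supp: "norm x > m0 \<Longrightarrow> f0 x = 0" "norm x > m0 \<Longrightarrow> f i x = 0" for x i using m0[of x] by (auto simp: f0_def f_def)
  have f0: "f0 \<in> borel_measurable lebesgue" "integrable lebesgue (\<lambda>x. \<bar>f0 x\<bar> powr p)" "integrable lebesgue f0"
    using R0 unfolding f0_def by auto
  have fi: "f i \<in> borel_measurable lebesgue" "integrable lebesgue (\<lambda>x. \<bar>f i x\<bar> powr p)" "integrable lebesgue (f i)" for i
    using R1[of i] unfolding f_def by auto
  have gradc: "continuous_on U (gradient \<phi>)" using smooth_on_continuous_gradient[OF \<phi>] .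
  have \<phi>c: "continuous_on U \<phi>" using smooth_on_continuous[OF \<phi>] .
  have Xc: "continuous_on U X" and divc: "continuous_on U (divergence X)" using C1_field_onD[OF X] by auto
  obtain Cx where Cx: "\<And>x. x \<in> K' \<Longrightarrow> norm (X x) \<le> Cx" "Cx \<ge> 0"
  proof -
    have "compact (X ` K')" by (intro compact_continuous_image continuous_on_subset[OF Xc] K')
    then obtain B where "\<forall>x\<in>K'. norm (X x) \<le> B" using compact_imp_bounded bounded_iff by (metis imageI)
    then show ?thesis by (intro that[of "\<bar>B\<bar>"]) force+
  qed
  obtain D where D: "\<And>x. x \<in> K' \<Longrightarrow> \<bar>divergence X x\<bar> \<le> D" "D \<ge> 0"
  proof -
    have "compact (divergence X ` K')" by (intro compact_continuous_image continuous_on_subset[OF divc] K')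
    then obtain B where "\<forall>x\<in>K'. norm (divergence X x) \<le> B" using compact_imp_bounded bounded_iff by (metis imageI)
    then show ?thesis by (intro that[of "\<bar>B\<bar>"]) force+
  qed
  have K'S[measurable]: "K' \<in> sets lebesgue" using K'(1) by (simp add: borel_compact)
  have iK: "integrable lebesgue (\<lambda>x. indicator K' x * (c::real))" for c
    using set_integrable_compact[OF K'(1), of "\<lambda>x. c"] by (simp add: set_integrable_def)
  define V where "V = (LINT x|lebesgue. indicator K' x * (1::real))"
  have V: "V \<ge> 0" by (simp add: V_def)
  have V_eq: "(LINT x|lebesgue. indicator K' x * c) = V * c" for c by (simp add: V_def)
  define wt where "wt x = indicator K' x * (norm (g x) powr p)" for x
  have wt: "integrable lebesgue wt" "wt x \<ge> 0" for x
    using Lg K'(1,4) K1G unfolding locally_Lp_def set_integrable_def wt_def by auto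
  define W where "W = (LINT x|lebesgue. wt x)"
  have W: "W \<ge> 0" unfolding W_def using wt by simp
  define n where "n = real CARD('n)"
  \<comment> \<open>The integrand whose integral \<open>J\<close> has to vanish.\<close>
  define a4 where "a4 x = indicator K' x * (divergence X x * flat (\<phi> x - e - u x))" for x
  have gm[measurable]: "(\<lambda>x. indicator G x *\<^sub>R g x) \<in> borel_measurable lebesgue"
    using Lg by (simp add: locally_Lp_def set_borel_measurable_def)
  have ic_meas: "(\<lambda>x. indicator K' x *\<^sub>R h x) \<in> borel_measurable lebesgue" if "continuous_on U h" for h :: "real^'n \<Rightarrow> real"
  proof -
    have "(\<lambda>x. indicator K' x *\<^sub>R h x) \<in> borel_measurable borel"
      using continuous_on_subset[OF that K'(2)] K'(1) by (intro borel_measurable_continuous_on_indicator borel_compact)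
    then show ?thesis by (simp add: measurable_completion)
  qed
  have flatm[measurable]: "flat \<in> borel_measurable borel"
    unfolding flat_eq by (intro borel_measurable_continuous_onI continuous_on_flat_deriv)
  have a4_meas: "a4 \<in> borel_measurable lebesgue"
  proof -
    have [measurable]: "(\<lambda>x. indicator K' x *\<^sub>R divergence X x) \<in> borel_measurable lebesgue"
      "(\<lambda>x. indicator K' x *\<^sub>R \<phi> x) \<in> borel_measurable lebesgue" using ic_meas divc \<phi>c by auto
    note [measurable] = f0(1)
    have "(\<lambda>x. (indicator K' x *\<^sub>R divergence X x) * flat (indicator K' x *\<^sub>R \<phi> x - e - f0 x)) \<in> borel_measurable lebesgue"
      by measurable
    moreover have "(indicator K' x *\<^sub>R divergence X x) * flat (indicator K' x *\<^sub>R \<phi> x - e - f0 x) = a4 x" for x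
      using K'(4) by (auto simp: a4_def f0_def indicator_def)
    ultimately show ?thesis by (simp only:)
  qed
  have a4_nonneg: "a4 x \<ge> 0" for x
    using div[of x] K'(2) flat_nonneg[of "\<phi> x - e - u x"] by (auto simp: a4_def indicator_def)
  have a4: "integrable lebesgue a4"
  proof (rule Bochner_Integration.integrable_bound[OF iK[of D] a4_meas], rule AE_I2)
    fix x
    have "x \<in> K' \<Longrightarrow> \<bar>divergence X x\<bar> * \<bar>flat (\<phi> x - e - u x)\<bar> \<le> D * 1"
      using D flat_le_1 flat_nonneg by (intro mult_mono) (auto simp: abs_le_iff intro: order_trans[OF _ flat_nonneg])
    then show "norm (a4 x) \<le> norm (indicator K' x * D)"
      using D(2) by (auto simp: a4_def indicator_def abs_mult)
  qed
  define J where "J = (LINT x|lebesgue. a4 x)"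
  define Const where "Const = 2 * (W + Cx * V + (1 + Cx) * n powr p * n) + 2 * D * (V + 1)"
  have Const: "Const \<ge> 0" unfolding Const_def n_def using W V Cx D by (intro add_nonneg_nonneg mult_nonneg_nonneg) auto
  have key: "J \<le> Const * \<eta>" if \<eta>: "\<eta> > 0" for \<eta>
  proof -
    \<comment> \<open>The accuracy of the mollification for which the weighted Young inequality returns a multiple of \<open>\<eta>\<close>.\<close>
    define \<eta>' where "\<eta>' = \<eta> powr p"
    have \<eta>': "\<eta>' > 0" "\<eta> powr (1 - p) * \<eta>' = \<eta>" using \<eta> by (auto simp: \<eta>'_def powr_add[symmetric])
    define close where "close h \<epsilon> \<longleftrightarrow> integrable lebesgue (\<lambda>x. \<bar>convolve (mollifier \<epsilon>) h x - h x\<bar> powr p) \<and>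
     (LINT x|lebesgue. \<bar>convolve (mollifier \<epsilon>) h x - h x\<bar> powr p) < \<eta>'" for h :: "real^'n \<Rightarrow> real" and \<epsilon>
    have ex_close: "\<exists>E. E > 0 \<and> (\<forall>\<epsilon>. 0 < \<epsilon> \<longrightarrow> \<epsilon> < E \<longrightarrow> close h \<epsilon>)"
      if "h \<in> borel_measurable lebesgue" "integrable lebesgue (\<lambda>x. \<bar>h x\<bar> powr p)" "\<And>x. norm x > m0 \<Longrightarrow> h x = 0" for h
      by (rule convolve_mollifier_tendsto_Lp[OF p that(1,2) that(3) \<eta>'(1)]) (auto simp: close_def)
    obtain \<epsilon>0 where \<epsilon>0: "\<epsilon>0 > 0" "\<And>\<epsilon>. 0 < \<epsilon> \<Longrightarrow> \<epsilon> < \<epsilon>0 \<Longrightarrow> close f0 \<epsilon>"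
      using ex_close[OF f0(1,2) supp(1)] by blast
    have "\<forall>i. \<exists>E. E > 0 \<and> (\<forall>\<epsilon>. 0 < \<epsilon> \<longrightarrow> \<epsilon> < E \<longrightarrow> close (f i) \<epsilon>)"
      by (intro allI ex_close fi supp(2))
    from choice[OF this] obtain E where E: "\<And>i. E i > 0" "\<And>i \<epsilon>. 0 < \<epsilon> \<Longrightarrow> \<epsilon> < E i \<Longrightarrow> close (f i) \<epsilon>" by blast
    have "uniformly_continuous_on K1 \<phi>"
      by (intro compact_uniformly_continuous continuous_on_subset[OF \<phi>c] K1)
    then obtain \<epsilon>u where \<epsilon>u: "\<epsilon>u > 0" "\<And>x y. x \<in> K1 \<Longrightarrow> y \<in> K1 \<Longrightarrow> dist y x < \<epsilon>u \<Longrightarrow> dist (\<phi> y) (\<phi> x) < e"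
      unfolding uniformly_continuous_on_def using e by metis
    define m where "m = min (min \<epsilon>0 (Min (range E))) (min \<epsilon>u \<delta>)"
    define \<epsilon> where "\<epsilon> = m / 2"
    have "Min (range E) > 0" using E(1) by (subst Min_gr_iff) auto
    then have "m > 0" using \<epsilon>0 \<epsilon>u \<delta> by (auto simp: m_def)
    moreover have "m \<le> \<epsilon>0" "m \<le> Min (range E)" "m \<le> \<epsilon>u" "m \<le> \<delta>" unfolding m_def by linarith+
    ultimately have \<epsilon>: "\<epsilon> > 0" "\<epsilon> < \<epsilon>0" "\<epsilon> < Min (range E)" "\<epsilon> < \<epsilon>u" "\<epsilon> < \<delta>" unfolding \<epsilon>_def by linarith+
    have \<epsilon>E: "\<epsilon> < E i" for i using \<epsilon>(3) by (meson Min_le finite finite_imageI less_le_trans rangeI)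
    let ?c = "convolve (mollifier \<epsilon>) :: (real^'n \<Rightarrow> real) \<Rightarrow> real^'n \<Rightarrow> real"
    have c0: "close f0 \<epsilon>" using \<epsilon>0(2) \<epsilon> by blast
    have ci: "close (f i) \<epsilon>" for i using E(2) \<epsilon> \<epsilon>E by blast
    note ci = ci[unfolded close_def] and c0 = c0[unfolded close_def]
    have k0: "\<And>z::real^'n. z \<notin> cball 0 \<epsilon> \<Longrightarrow> mollifier \<epsilon> z = 0" by (rule mollifier_smooth_kernel(3)[OF \<epsilon>(1)]) simp
    have us: "smooth_on UNIV (?c f0)"
      by (rule smooth_on_convolve[OF mollifier_smooth_kernel(1)[OF \<epsilon>(1)] compact_cball k0 f0(3)])
    have cb: "cball x \<epsilon> \<subseteq> K1" if "x \<in> N" for x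
    proof
      fix y assume "y \<in> cball x \<epsilon>"
      then show "y \<in> K1" using infdist_triangle[of y K x] that \<epsilon>(5) by (simp add: N_def K1_def dist_commute)
    qed
    have pu: "partial_deriv i (?c f0) x = ?c (f i) x" if "x \<in> N" for x i
      using mollified_weak_gradient[OF p1(1) ug K1(1) K1G \<epsilon>(1) cb[OF that]] unfolding f0_def f_def .
    define arg where "arg x = \<phi> x - e - ?c f0 x" for x
    \<comment> \<open>Off \<open>K'\<close> the mollification averages values of \<open>u\<close> at points outside \<open>K\<close>, where \<open>u \<ge> \<phi>\<close>.\<close>
    have ann: "arg x \<le> 0" if "x \<in> N - K'" for x
    proof -
      have "\<phi> x - e \<le> f0 y" if "norm (y - x) < \<epsilon>" for y
      proof -
        have "infdist x K \<le> infdist y K + \<epsilon>" using infdist_triangle[of x K y] that by (simp add: dist_norm norm_minus_commute)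
        then have "infdist y K > 0" using \<open>x \<in> N - K'\<close> \<epsilon>(5) by (simp add: K'_def)
        then have "y \<notin> K" by auto
        moreover have yK: "y \<in> K1" using cb[of x] that \<open>x \<in> N - K'\<close> by (auto simp: dist_norm norm_minus_commute)
        ultimately have "\<phi> y \<le> u y" using off K1 by blast
        moreover have "dist (\<phi> y) (\<phi> x) < e"
          using \<epsilon>u(2)[of x y] yK \<open>x \<in> N - K'\<close> N(3) that \<epsilon>(4) by (auto simp: dist_norm)
        ultimately show ?thesis using yK by (simp add: f0_def dist_real_def)
      qed
      then have "\<phi> x - e \<le> ?c f0 x" by (rule convolve_mollifier_ge[OF \<epsilon>(1) f0(3)])
      then show ?thesis by (simp add: arg_def)
    qed
    define \<theta> where "\<theta> x = (if x \<in> N then flat (arg x) else 0)" for x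
    have \<theta>0: "\<theta> x = 0" if "x \<notin> K'" for x using ann[of x] that by (auto simp: \<theta>_def flat_zero)
    have arg_smooth: "smooth_on N arg" unfolding arg_def[abs_def]
      by (intro smooth_on_diff N(1) smooth_on_const smooth_on_subset[OF \<phi> N(2)] smooth_on_subset[OF us]) auto
    have \<theta>_smooth: "smooth_on UNIV \<theta>"
    proof -
      have "smooth_on N \<theta>"
        using smooth_on_flat[OF N(1) arg_smooth] smooth_on_cong[OF N(1), of \<theta> "\<lambda>x. flat (arg x)"] by (simp add: \<theta>_def)
      moreover have o: "open (- K')" using K'(1) by (simp add: compact_imp_closed open_Compl)
      have "smooth_on (- K') \<theta>"
        using smooth_on_cong[OF o, of \<theta> "\<lambda>x. 0"] \<theta>0 smooth_on_const by blast
      ultimately have "Ck_on k (N \<union> - K') \<theta>" for k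
        unfolding smooth_on_def using Ck_on_Un[OF N(1) o] by blast
      moreover have "N \<union> - K' = UNIV" using K'(3) by blast
      ultimately show ?thesis by (simp add: smooth_on_def)
    qed
    have \<theta>_nonneg: "0 \<le> \<theta> x" for x by (simp add: \<theta>_def flat_nonneg)
    have cl: "closure {x. \<theta> x \<noteq> 0} \<subseteq> K'"
      using \<theta>0 K'(1) by (intro closure_minimal) (auto simp: compact_imp_closed)
    have "compact (closure {x. \<theta> x \<noteq> 0})"
      using compact_Int_closed[OF K'(1) closed_closure[of "{x. \<theta> x \<noteq> 0}"]] cl by (simp add: Int_absorb1)
    then have test: "test_function U \<theta>" "test_function G \<theta>"
      using \<theta>_smooth cl K'(2) U(2) unfolding test_function_def smooth_on_def C_class_iff by blast+
    define h where "h x = flat_deriv 1 (arg x)" for x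
    have h: "0 \<le> h x" "h x \<le> 2" for x unfolding h_def by (rule flat_deriv1_nonneg flat_deriv1_le_2)+
    define ge where "ge x = (\<chi> i. ?c (f i) x)" for x
    have grad\<theta>: "gradient \<theta> x = h x *\<^sub>R (gradient \<phi> x - ge x)" if "x \<in> N" for x
    proof -
      have "\<phi> differentiable at x" "?c f0 differentiable at x"
        using smooth_on_differentiable[OF \<phi>] smooth_on_differentiable[OF us] that N(2) by auto
      note d = this[THEN has_derivative_gradient]
      have "gradient (?c f0) x = ge x" by (simp add: vec_eq_iff gradient_component pu[OF that] ge_def)
      then have "(arg has_derivative (\<lambda>v. (gradient \<phi> x - ge x) \<bullet> v)) (at x)"
        unfolding arg_def[abs_def] using d by (auto intro!: derivative_eq_intros simp: inner_diff_left)
      from DERIV_compose_FDERIV[OF flat_has_derivative this]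
      have "((\<lambda>x. flat (arg x)) has_derivative (\<lambda>v. (h x *\<^sub>R (gradient \<phi> x - ge x)) \<bullet> v)) (at x)"
        by (simp add: h_def mult.commute)
      then have "(\<theta> has_derivative (\<lambda>v. (h x *\<^sub>R (gradient \<phi> x - ge x)) \<bullet> v)) (at x)"
        by (rule has_derivative_transform_within_open[OF _ N(1) that]) (simp add: \<theta>_def)
      then show ?thesis by (rule gradient_unique)
    qed
    have grad0: "gradient \<theta> x = 0" if "x \<notin> K'" for x
      using partial_deriv_outside_support[OF compact_imp_closed[OF K'(1)] \<theta>0 that] by (simp add: vec_eq_iff gradient_component)
    define a1 where "a1 x = indicator K' x * (divergence X x * \<theta> x)" for x
    define a2 where "a2 x = indicator K' x * (X x \<bullet> gradient \<theta> x)" for x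
    define a3 where "a3 x = indicator K' x * (norm (g x) powr (p - 2) * (g x \<bullet> gradient \<theta> x))" for x
    have g\<theta>c: "continuous_on UNIV (gradient \<theta>)" by (rule smooth_on_continuous_gradient[OF \<theta>_smooth])
    have a1: "integrable lebesgue a1"
      using set_integrable_compact[OF K'(1), of "\<lambda>x. divergence X x * \<theta> x"]
        continuous_on_subset[OF divc K'(2)] continuous_on_subset[OF smooth_on_continuous[OF \<theta>_smooth]]
      by (simp add: set_integrable_def a1_def[abs_def] continuous_intros)
    have a2: "integrable lebesgue a2"
      using set_integrable_compact[OF K'(1), of "\<lambda>x. X x \<bullet> gradient \<theta> x"]
        continuous_on_subset[OF Xc K'(2)] continuous_on_subset[OF g\<theta>c]
      by (simp add: set_integrable_def a2_def[abs_def] continuous_intros)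
    obtain Bt where Bt: "\<And>x. norm (gradient \<theta> x) \<le> Bt" "Bt \<ge> 0"
      using bounded_of_compact_support[OF g\<theta>c K'(1) grad0] by blast
    have normF: "norm (g x) powr (p - 2) * norm (g x) = norm (g x) powr (p - 1)" for x
      using powr_mult_self[OF p] by simp
    have a3: "integrable lebesgue a3"
    proof (rule Bochner_Integration.integrable_bound)
      show "integrable lebesgue (\<lambda>x. Bt * (wt x + indicator K' x * 1))"
        by (intro integrable_mult_right Bochner_Integration.integrable_add wt(1) iK)
      have [measurable]: "gradient \<theta> \<in> borel_measurable lebesgue" using g\<theta>c by (rule continuous_lebesgue_measurable)
      have "(\<lambda>x. indicator K' x * (norm (indicator G x *\<^sub>R g x) powr (p - 2) * ((indicator G x *\<^sub>R g x) \<bullet> gradient \<theta> x))) \<in> borel_measurable lebesgue"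
        by measurable
      moreover have "indicator K' x * (norm (indicator G x *\<^sub>R g x) powr (p - 2) * ((indicator G x *\<^sub>R g x) \<bullet> gradient \<theta> x)) = a3 x" for x
        using K'(2) U(2) by (auto simp: a3_def indicator_def)
      ultimately show "a3 \<in> borel_measurable lebesgue" by (simp only:)
      show "AE x in lebesgue. norm (a3 x) \<le> norm (Bt * (wt x + indicator K' x * 1))"
      proof (rule AE_I2)
        fix x
        show "norm (a3 x) \<le> norm (Bt * (wt x + indicator K' x * 1))"
        proof (cases "x \<in> K'")
          case True
          have "\<bar>norm (g x) powr (p - 2) * (g x \<bullet> gradient \<theta> x)\<bar> \<le> norm (g x) powr (p - 2) * (norm (g x) * norm (gradient \<theta> x))"
            unfolding abs_mult using Cauchy_Schwarz_ineq2 by (intro mult_mono) auto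
          also have "\<dots> = norm (g x) powr (p - 1) * norm (gradient \<theta> x)" using normF[of x] by (simp add: mult.assoc[symmetric])
          also have "\<dots> \<le> (norm (g x) powr p + 1) * Bt"
            using weighted_Young[OF p, of "norm (g x)" 1 1] Bt by (intro mult_mono) auto
          finally show ?thesis using True Bt(2) by (simp add: a3_def wt_def mult.commute)
        qed (simp add: a3_def)
      qed
    qed
    have I3: "0 \<le> (LINT x|lebesgue. a3 x)"
    proof -
      have "indicator G x *\<^sub>R (norm (g x) powr (p - 2) * (g x \<bullet> gradient \<theta> x)) = a3 x" for x
        using K'(2) U(2) grad0[of x] by (auto simp: a3_def indicator_def)
      then show ?thesis using super[OF test(2) \<theta>_nonneg] by (simp add: set_lebesgue_integral_def)
    qed
    have I12: "(LINT x|lebesgue. a2 x) = - (LINT x|lebesgue. a1 x)"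
    proof -
      have "indicator U x *\<^sub>R (X x \<bullet> gradient \<theta> x) = a2 x" "indicator U x *\<^sub>R (divergence X x * \<theta> x) = a1 x" for x
        using K'(2) grad0[of x] \<theta>0[of x] by (auto simp: a1_def a2_def indicator_def)
      then show ?thesis using divergence_theorem_test_function[OF U(1) X test(1)] by (simp add: set_lebesgue_integral_def)
    qed
    define S where "S x = n powr p * (\<Sum>i\<in>UNIV. \<bar>?c (f i) x - f i x\<bar> powr p)" for x
    have S_int: "integrable lebesgue S" unfolding S_def
      by (intro integrable_mult_right Bochner_Integration.integrable_sum ci[THEN conjunct1])
    have IS: "(LINT x|lebesgue. S x) \<le> n powr p * n * \<eta>'"
    proof -
      have "(LINT x|lebesgue. S x) = n powr p * (\<Sum>i\<in>UNIV. LINT x|lebesgue. \<bar>?c (f i) x - f i x\<bar> powr p)"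
        unfolding S_def by (subst integral_mult_right_zero, subst Bochner_Integration.integral_sum) (use ci in auto)
      also have "\<dots> \<le> n powr p * (\<Sum>i\<in>(UNIV::'n set). \<eta>')"
        using ci by (intro mult_left_mono sum_mono) (auto intro: less_imp_le)
      finally show ?thesis by (simp add: n_def mult.assoc)
    qed
    define \<kappa> where "\<kappa> = \<eta> powr (1 - p)"
    have \<kappa>: "\<kappa> > 0" "\<kappa> * \<eta>' = \<eta>" using \<eta> \<eta>' by (auto simp: \<kappa>_def)
    define e0 where "e0 x = \<bar>?c f0 x - f0 x\<bar> powr p" for x
    have e0: "integrable lebesgue e0" "(LINT x|lebesgue. e0 x) \<le> \<eta>'" using c0 unfolding e0_def by auto
    have S0: "S x \<ge> 0" "e0 x \<ge> 0" for x by (auto simp: S_def e0_def intro!: mult_nonneg_nonneg sum_nonneg)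
    \<comment> \<open>Replacing \<open>u\<^sub>\<epsilon>\<close> by \<open>u\<close> inside \<open>flat\<close> costs a multiple of \<open>|u\<^sub>\<epsilon> - u|\<close>.\<close>
    have pt1: "a4 x \<le> a1 x + 2 * D * (\<eta> * (indicator K' x * 1) + \<kappa> * e0 x)" for x
    proof (cases "x \<in> K'")
      case True
      have "\<bar>flat (\<phi> x - e - u x) - flat (arg x)\<bar> \<le> 2 * \<bar>(\<phi> x - e - u x) - arg x\<bar>" by (rule flat_lipschitz)
      also have "(\<phi> x - e - u x) - arg x = ?c f0 x - f0 x" using True K'(4) by (auto simp: arg_def f0_def)
      also have "\<bar>?c f0 x - f0 x\<bar> \<le> \<eta> + \<kappa> * e0 x"
        using weighted_Young[OF p, of 1 "\<bar>?c f0 x - f0 x\<bar>" \<eta>] \<eta> by (simp add: e0_def \<kappa>_def)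
      finally have "flat (\<phi> x - e - u x) \<le> \<theta> x + 2 * (\<eta> + \<kappa> * e0 x)"
        using True K'(3) by (auto simp: \<theta>_def)
      moreover have "divergence X x > 0" using div True K' by blast
      ultimately have "divergence X x * flat (\<phi> x - e - u x) \<le> divergence X x * (\<theta> x + 2 * (\<eta> + \<kappa> * e0 x))"
        by (intro mult_left_mono) auto
      also have "\<dots> \<le> divergence X x * \<theta> x + D * (2 * (\<eta> + \<kappa> * e0 x))"
        unfolding distrib_left[of "divergence X x" "\<theta> x"] using D(1)[OF True] \<eta> \<kappa> S0(2)[of x]
        by (intro add_left_mono mult_right_mono) (auto intro!: add_nonneg_nonneg mult_nonneg_nonneg)
      finally show ?thesis using True by (simp add: a4_def a1_def algebra_simps)
    next
      case False
      have "0 \<le> 2 * D * (\<kappa> * e0 x)" using D \<kappa> S0 by (intro mult_nonneg_nonneg) auto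
      then show ?thesis using False by (simp add: a4_def a1_def)
    qed
    \<comment> \<open>Monotonicity of the flux, up to the error of the mollified gradient.\<close>
    have pt2: "- a2 x \<le> - a3 x + 2 * (\<eta> * wt x + Cx * \<eta> * (indicator K' x * 1) + (1 + Cx) * \<kappa> * S x)" for x
    proof (cases "x \<in> K'")
      case True
      define Fx where "Fx = norm (g x) powr (p - 2) *\<^sub>R g x"
      have xN: "x \<in> N" using True K' by auto
      have nF: "norm Fx = norm (g x) powr (p - 1)" using normF[of x] by (simp add: Fx_def)
      define A where "A = norm (g x - ge x)"
      have A_le: "A powr p \<le> S x"
      proof -
        have "A \<le> (\<Sum>i\<in>UNIV. \<bar>(g x - ge x) $ i\<bar>)" unfolding A_def by (rule norm_le_l1_cart)
        also have "\<dots> = (\<Sum>i\<in>UNIV. \<bar>?c (f i) x - f i x\<bar>)"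
          using True K'(4) by (intro sum.cong refl) (auto simp: ge_def f_def abs_minus_commute)
        finally have "A powr p \<le> (\<Sum>i\<in>UNIV. \<bar>?c (f i) x - f i x\<bar>) powr p"
          using p by (intro powr_mono2) (auto simp: A_def)
        also have "\<dots> \<le> S x" unfolding S_def n_def using p by (intro sum_powr_le) auto
        finally show ?thesis .
      qed
      have "(Fx - X x) \<bullet> gradient \<theta> x = h x * ((Fx - X x) \<bullet> (gradient \<phi> x - g x)) + h x * ((Fx - X x) \<bullet> (g x - ge x))"
        unfolding grad\<theta>[OF xN] by (simp add: inner_diff_right algebra_simps)
      moreover have "(Fx - X x) \<bullet> (gradient \<phi> x - g x) \<le> 0"
        using p_flux_monotone[OF p, of "g x" "gradient \<phi> x"] unfolding X_eq Fx_def
        by (simp add: inner_diff_left inner_diff_right)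
      then have "h x * ((Fx - X x) \<bullet> (gradient \<phi> x - g x)) \<le> 0" using h(1) by (rule mult_nonneg_nonpos[rotated])
      moreover have "h x * ((Fx - X x) \<bullet> (g x - ge x)) \<le> 2 * ((norm (g x) powr (p - 1) + Cx) * A)"
      proof -
        have "(Fx - X x) \<bullet> (g x - ge x) \<le> norm (Fx - X x) * A" unfolding A_def by (rule norm_cauchy_schwarz)
        also have "\<dots> \<le> (norm (g x) powr (p - 1) + Cx) * A"
          using norm_triangle_ineq4[of Fx "X x"] nF Cx(1)[OF True] by (intro mult_right_mono) (auto simp: A_def)
        finally have "h x * ((Fx - X x) \<bullet> (g x - ge x)) \<le> h x * ((norm (g x) powr (p - 1) + Cx) * A)"
          using h(1) by (rule mult_left_mono)
        also have "\<dots> \<le> 2 * ((norm (g x) powr (p - 1) + Cx) * A)"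
          using h(2) Cx(2) by (intro mult_right_mono mult_nonneg_nonneg) (auto simp: A_def)
        finally show ?thesis .
      qed
      moreover have \<kappa>A: "\<kappa> * A powr p \<le> \<kappa> * S x" using \<kappa>(1) by (intro mult_left_mono A_le) simp
      have A0: "A \<ge> 0" by (simp add: A_def)
      have "norm (g x) powr (p - 1) * A \<le> \<eta> * norm (g x) powr p + \<kappa> * A powr p"
        unfolding \<kappa>_def by (rule weighted_Young[OF p _ A0 \<eta>]) simp
      then have "norm (g x) powr (p - 1) * A \<le> \<eta> * norm (g x) powr p + \<kappa> * S x" using \<kappa>A by linarith
      moreover have "A \<le> \<eta> + \<kappa> * A powr p"
        using weighted_Young[OF p _ A0 \<eta>, of 1] by (simp add: \<kappa>_def)
      then have "A \<le> \<eta> + \<kappa> * S x" using \<kappa>A by linarith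
      then have "Cx * A \<le> Cx * (\<eta> + \<kappa> * S x)" using Cx(2) by (rule mult_left_mono)
      ultimately have "(Fx - X x) \<bullet> gradient \<theta> x \<le> 2 * (\<eta> * norm (g x) powr p + \<kappa> * S x + Cx * (\<eta> + \<kappa> * S x))"
        by (simp add: distrib_right)
      then show ?thesis using True
        by (simp add: a2_def a3_def wt_def Fx_def inner_diff_left algebra_simps)
    next
      case False
      have "0 \<le> 2 * ((1 + Cx) * \<kappa> * S x)" using Cx \<kappa> S0 by (intro mult_nonneg_nonneg) auto
      then show ?thesis using False by (simp add: a2_def a3_def wt_def)
    qed
    have "J \<le> (LINT x|lebesgue. a1 x + 2 * D * (\<eta> * (indicator K' x * 1) + \<kappa> * e0 x))"
      unfolding J_def by (rule integral_mono[OF a4 _ pt1])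
        (intro Bochner_Integration.integrable_add integrable_mult_right a1 iK e0)
    also have "\<dots> = (LINT x|lebesgue. a1 x) + 2 * D * (\<eta> * V + \<kappa> * (LINT x|lebesgue. e0 x))"
      using a1 iK[of 1] e0 V_eq[of 1] by simp
    also have "(LINT x|lebesgue. a1 x) = (LINT x|lebesgue. - a2 x)" using I12 by simp
    also have "(LINT x|lebesgue. - a2 x) \<le> (LINT x|lebesgue. - a3 x + 2 * (\<eta> * wt x + Cx * \<eta> * (indicator K' x * 1) + (1 + Cx) * \<kappa> * S x))"
      by (rule integral_mono[OF _ _ pt2])
        (intro Bochner_Integration.integrable_add Bochner_Integration.integrable_minus integrable_mult_right a2 a3 wt iK S_int)+
    also have "\<dots> = - (LINT x|lebesgue. a3 x) + 2 * (\<eta> * W + Cx * \<eta> * V + (1 + Cx) * \<kappa> * (LINT x|lebesgue. S x))"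
      using a3 wt iK[of 1] V_eq[of 1] S_int by (simp add: W_def)
    also have "\<dots> \<le> 2 * (\<eta> * W + Cx * \<eta> * V + (1 + Cx) * \<kappa> * (n powr p * n * \<eta>'))"
    proof -
      have "(1 + Cx) * \<kappa> * (LINT x|lebesgue. S x) \<le> (1 + Cx) * \<kappa> * (n powr p * n * \<eta>')"
        using IS Cx(2) \<kappa>(1) by (intro mult_left_mono) auto
      moreover have "- a + 2 * (b + c + y) \<le> 2 * (b + c + z)" if "0 \<le> a" "y \<le> z" for a b c y z :: real
        using that by simp
      ultimately show ?thesis using I3 by blast
    qed
    also have "2 * D * (\<eta> * V + \<kappa> * (LINT x|lebesgue. e0 x)) \<le> 2 * D * (\<eta> * V + \<kappa> * \<eta>')"
      using e0 D \<kappa> by (intro mult_left_mono add_left_mono) auto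
    finally have "J \<le> 2 * (\<eta> * W + Cx * \<eta> * V + (1 + Cx) * n powr p * n * (\<kappa> * \<eta>')) + 2 * D * (\<eta> * V + \<kappa> * \<eta>')"
      by (simp add: mult_ac)
    then show "J \<le> Const * \<eta>" unfolding \<kappa>(2) Const_def by (simp add: algebra_simps)
  qed
  have "J \<le> 0"
  proof (rule ccontr)
    assume "\<not> J \<le> 0"
    then have J: "J > 0" by simp
    then have "J \<le> Const * (J / (Const + 1))" using Const by (intro key) auto
    also have "\<dots> < J" using J Const by (simp add: field_simps)
    finally show False by simp
  qed
  moreover have "J \<ge> 0" unfolding J_def using a4_nonneg by simp
  ultimately have "AE x in lebesgue. a4 x = 0"
    using integral_nonneg_eq_0_iff_AE[OF a4] a4_nonneg unfolding J_def by auto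
  then show ?thesis
  proof eventually_elim
    case (elim x)
    show ?case
    proof
      assume "x \<in> U"
      show "\<phi> x - e \<le> u x"
      proof (cases "x \<in> K'")
        case True
        then have "flat (\<phi> x - e - u x) = 0" using elim div[OF \<open>x \<in> U\<close>] by (auto simp: a4_def)
        then have "\<not> \<phi> x - e - u x > 0" using flat_pos_iff[of "\<phi> x - e - u x"] by simp
        then show ?thesis by simp
      next
        case False
        then show ?thesis using off[of x] \<open>x \<in> U\<close> K'(5) e by force
      qed
    qed
  qed
qed

text \<open>
The inequality almost everywhere becomes one everywhere because a \<open>p\<close>-superharmonic function equals its
essential lower limit.
\<close>

theorem strict_subsolution_le_p_superharmonic:
  fixes u \<phi> :: "real^'n::finite \<Rightarrow> real"
  assumes p: "p > 1" and u: "p_superharmonic p G u"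
    and U: "open U" "U \<subseteq> G" and \<phi>: "smooth_on U \<phi>" and X: "C1_field_on U (p_flux p \<phi>)"
    and div: "\<And>x. x \<in> U \<Longrightarrow> divergence (p_flux p \<phi>) x > 0"
    and K: "compact K" "K \<subseteq> U" and off: "\<And>x. x \<in> U - K \<Longrightarrow> \<phi> x \<le> u x" and x: "x \<in> U"
  shows "\<phi> x \<le> u x"
proof (cases "K = {}")
  case True
  then show ?thesis using off x by simp
next
  case False
  obtain g where g: "sobolev_loc_gradient p G u g" and super: "\<And>\<theta>. test_function G \<theta> \<Longrightarrow> (\<And>x. 0 \<le> \<theta> x) \<Longrightarrow>
           (LINT x:G|lebesgue. norm (g x) powr (p - 2) * (g x \<bullet> gradient \<theta> x)) \<ge> 0"
    using u unfolding p_superharmonic_def p_supersolution_def by blast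
  show ?thesis
  proof (rule field_le_epsilon)
    fix e :: real assume "e > 0"
    then have e2: "e / 2 > 0" by simp
    have AE: "AE y in lebesgue. y \<in> U \<longrightarrow> \<phi> y - e / 2 \<le> u y"
      by (rule comparison_AE[OF p g super U \<phi> X div K(1) False K(2) off e2])
    have "isCont \<phi> x" using smooth_on_continuous[OF \<phi>] U(1) x by (simp add: continuous_on_eq_continuous_at)
    then obtain d where d: "d > 0" "\<And>y. dist y x < d \<Longrightarrow> dist (\<phi> y) (\<phi> x) < e / 2"
      unfolding continuous_at_eps_delta using e2 by metis
    obtain r where r: "r > 0" "ball x r \<subseteq> U" using U(1) x open_contains_ball by blast
    have "AE y in lebesgue. y \<in> ball x (min d r) \<inter> G \<longrightarrow> \<phi> x - e \<le> u y"
      using AE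
    proof eventually_elim
      case (elim y)
      show ?case
      proof
        assume "y \<in> ball x (min d r) \<inter> G"
        then have "y \<in> U" "dist y x < d" using r by (auto simp: dist_commute)
        then have "\<phi> x - \<phi> y < e / 2" "\<phi> y - e / 2 \<le> u y" using elim d(2)[of y] by (auto simp: dist_real_def abs_if split: if_splits)
        then show "\<phi> x - e \<le> u y" by linarith
      qed
    qed
    moreover have "x \<in> G" using x U by blast
    moreover have "min d r > 0" using d r by simp
    ultimately have "\<phi> x - e \<le> u x" using u unfolding p_superharmonic_def by blast
    then show "\<phi> x \<le> u x + e" by simp
  qed
qed

section \<open>Coordinates adapted to a plane and the \<open>p\<close>-Laplacian\<close>

definition orthonormal :: "'a::euclidean_space set \<Rightarrow> bool" where
  "orthonormal B \<longleftrightarrow> finite B \<and> pairwise orthogonal B \<and> (\<forall>b\<in>B. norm b = 1)"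

definition proj :: "'a::euclidean_space set \<Rightarrow> 'a \<Rightarrow> 'a" where
  "proj B v = (\<Sum>b\<in>B. (b \<bullet> v) *\<^sub>R b)"

lemma orthonormal_inner:
  assumes "orthonormal B" "a \<in> B" "b \<in> B" shows "a \<bullet> b = (if a = b then 1 else 0)"
  using assms by (auto simp: orthonormal_def pairwise_def orthogonal_def norm_eq_1)

lemma inner_proj:
  assumes "orthonormal B" "b \<in> B" shows "b \<bullet> proj B v = b \<bullet> v"
proof -
  have "b \<bullet> proj B v = (\<Sum>c\<in>B. (c \<bullet> v) * (if b = c then 1 else 0))"
    unfolding proj_def inner_sum_right using assms by (intro sum.cong) (auto simp: orthonormal_inner)
  also have "\<dots> = b \<bullet> v" using assms by (simp add: orthonormal_def sum.delta' if_distrib cong: if_cong)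
  finally show ?thesis .
qed

lemma proj_inner_left: "proj B v \<bullet> u = (\<Sum>b\<in>B. (b \<bullet> v) * (b \<bullet> u))"
  by (simp add: proj_def inner_sum_left)

lemma proj_inner:
  assumes "orthonormal B"
  shows "proj B v \<bullet> v = (\<Sum>b\<in>B. (b \<bullet> v)\<^sup>2)" "proj B v \<bullet> proj B v = (\<Sum>b\<in>B. (b \<bullet> v)\<^sup>2)"
  using inner_proj[OF assms] by (simp_all add: proj_inner_left power2_eq_square)

lemma proj_ortho:
  assumes "orthonormal B" shows "proj B v \<bullet> (v - proj B v) = 0" "(v - proj B v) \<bullet> (v - proj B v) = v \<bullet> v - (\<Sum>b\<in>B. (b \<bullet> v)\<^sup>2)"
  using proj_inner[OF assms, of v] by (simp_all add: inner_diff_right inner_diff_left inner_commute[of v "proj B v"])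

lemma bessel: "orthonormal B \<Longrightarrow> (\<Sum>b\<in>B. (b \<bullet> v)\<^sup>2) \<le> v \<bullet> v"
  using proj_ortho(2)[of B v] inner_ge_zero[of "v - proj B v"] by simp

lemma linear_proj: "linear (proj B)"
  by (rule linearI) (simp_all add: proj_def inner_right_distrib scaleR_add_left sum.distrib scaleR_sum_right)

text \<open>
The trace of an orthogonal projection is its rank; it counts the normal directions in the divergence of
a radial field.
\<close>

lemma trace_proj:
  fixes B :: "(real^'n::finite) set"
  assumes "orthonormal B" shows "(\<Sum>i\<in>UNIV. proj B (axis i 1) $ i) = card B"
proof -
  have "(\<Sum>i\<in>UNIV. proj B (axis i 1) $ i) = (\<Sum>i\<in>UNIV. \<Sum>b\<in>B. (b $ i) * (b $ i))"
    by (simp add: proj_def inner_axis)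
  also have "\<dots> = (\<Sum>b\<in>B. \<Sum>i\<in>UNIV. (b $ i) * (b $ i))" by (rule sum.swap)
  also have "\<dots> = (\<Sum>b\<in>B. b \<bullet> b)" by (simp add: inner_vec_def)
  also have "\<dots> = (\<Sum>b\<in>B. 1)" using orthonormal_inner[OF assms] by (intro sum.cong) auto
  finally show ?thesis by simp
qed

text \<open>
An orthonormal basis of the orthogonal complement of the direction space.  It replaces the splitting
of the coordinates into \<open>x'\<close> and \<open>x''\<close>: the sum of squares is \<open>|x'|\<^sup>2\<close>.
\<close>

lemma hyperplane_normal_frame:
  fixes \<Lambda> :: "(real^'n::finite) set"
  assumes "hyperplane_of_dim m \<Lambda>" "w \<in> \<Lambda>"
  obtains B where "orthonormal B" "card B + m = CARD('n)"
    "\<And>x. infdist x \<Lambda> = sqrt (\<Sum>b\<in>B. (b \<bullet> (x - w))\<^sup>2)"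
proof -
  have aff: "affine \<Lambda>" and dim: "aff_dim \<Lambda> = int m" using assms by (auto simp: hyperplane_of_dim_def)
  define S where "S = (\<lambda>x. x - w) ` \<Lambda>"
  have S: "subspace S" unfolding S_def by (rule affine_diffs_subspace_subtract[OF aff assms(2)])
  have dS: "dim S = m"
    using aff_dim_eq_dim_subtract[of w \<Lambda>] assms(2) dim hull_inc unfolding S_def by (metis of_nat_eq_iff)
  define C where "C = {y \<in> UNIV. \<forall>x\<in>S. orthogonal x y}"
  have C: "subspace C" unfolding C_def by (auto simp: subspace_def orthogonal_def inner_right_distrib)
  have dC: "dim C + m = CARD('n)"
    using dim_subspace_orthogonal_to_vectors[OF S subspace_UNIV] dS by (simp add: C_def)
  obtain B where B: "B \<subseteq> C" "pairwise orthogonal B" "\<And>x. x \<in> B \<Longrightarrow> norm x = 1" "independent B" "card B = dim C" "span B = C"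
    using orthonormal_basis_subspace[OF C] by blast
  have on: "orthonormal B" using B independent_imp_finite by (auto simp: orthonormal_def)
  have BS: "b \<bullet> v = 0" if "b \<in> B" "v \<in> S" for b v
    using B(1) that by (auto simp: C_def orthogonal_def inner_commute)
  have inS: "v - proj B v \<in> S" for v
  proof -
    obtain y z where yz: "y \<in> span S" "\<And>w. w \<in> span S \<Longrightarrow> orthogonal z w" "v = y + z"
      using orthogonal_subspace_decomp_exists[of S v] by blast
    have yS: "y \<in> S" using yz(1) S span_eq_iff by blast
    have "orthogonal x z" if "x \<in> S" for x using yz(2)[OF span_base[OF that]] by (simp add: orthogonal_commute)
    then have zC: "z \<in> span B" unfolding B(6) C_def by blast
    have "orthogonal (z - proj B z) b" if "b \<in> B" for b
      using inner_proj[OF on that, of z] by (simp add: orthogonal_def inner_diff_left inner_commute[of z b] inner_commute[of "proj B z" b])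
    then have orth: "orthogonal (z - proj B z) a" if "a \<in> span B" for a
      by (rule orthogonal_to_span[OF that])
    have "proj B z \<in> span B" unfolding proj_def by (intro span_sum span_scale span_base)
    then have "z - proj B z \<in> span B" using zC by (rule span_diff[rotated])
    from orth[OF this] have "z = proj B z" by (simp add: orthogonal_self)
    moreover have "proj B y = 0" unfolding proj_def using BS[OF _ yS] by simp
    moreover have "proj B v = proj B y + proj B z" using linear_add[OF linear_proj] yz(3) by blast
    ultimately show ?thesis using yS yz(3) by simp
  qed
  have "infdist x \<Lambda> = sqrt (\<Sum>b\<in>B. (b \<bullet> (x - w))\<^sup>2)" for x
  proof (rule antisym)
    have "(x - w) - proj B (x - w) \<in> S" by (rule inS)
    then obtain y where y: "y \<in> \<Lambda>" "y - w = (x - w) - proj B (x - w)" by (auto simp: S_def)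
    have "infdist x \<Lambda> \<le> dist x y" using y(1) by (rule infdist_le)
    also have "x - y = proj B (x - w)" using y(2) by (simp add: algebra_simps)
    then have "dist x y = sqrt (\<Sum>b\<in>B. (b \<bullet> (x - w))\<^sup>2)"
      by (simp add: dist_norm norm_eq_sqrt_inner proj_inner[OF on])
    finally show "infdist x \<Lambda> \<le> sqrt (\<Sum>b\<in>B. (b \<bullet> (x - w))\<^sup>2)" .
    have "\<Lambda> \<noteq> {}" using assms(2) by blast
    then obtain y where y: "y \<in> \<Lambda>" "infdist x \<Lambda> = dist x y"
      using infdist_attains_inf[OF affine_closed[OF aff]] by blast
    have "b \<bullet> (x - y) = b \<bullet> (x - w)" if "b \<in> B" for b
      using BS[OF that, of "y - w"] y(1) by (auto simp: S_def inner_diff_right)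
    then have "(\<Sum>b\<in>B. (b \<bullet> (x - w))\<^sup>2) = (\<Sum>b\<in>B. (b \<bullet> (x - y))\<^sup>2)" by simp
    also have "\<dots> \<le> (x - y) \<bullet> (x - y)" by (rule bessel[OF on])
    finally show "sqrt (\<Sum>b\<in>B. (b \<bullet> (x - w))\<^sup>2) \<le> infdist x \<Lambda>"
      unfolding y(2) dist_norm norm_eq_sqrt_inner by simp
  qed
  then show ?thesis using that[OF on] B(5) dC by simp
qed

lemma divergence_eq:
  assumes "(X has_derivative D) (at x)"
  shows "divergence X x = (\<Sum>i\<in>UNIV. D (axis i 1) $ i)"
  unfolding divergence_def
proof (intro sum.cong refl)
  fix i
  have "((\<lambda>y. X y $ i) has_derivative (\<lambda>h. D h $ i)) (at x)"
    using assms by (rule bounded_linear.has_derivative[OF bounded_linear_vec_nth])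
  then show "partial_deriv i (\<lambda>y. X y $ i) x = D (axis i 1) $ i" by (rule partial_deriv_eq)
qed

lemma inner_eq_sum_axis: "(\<Sum>i\<in>UNIV. (g \<bullet> axis i 1) * (N $ i)) = g \<bullet> (N :: real^'n::finite)"
proof -
  have "(\<Sum>i\<in>UNIV. (g \<bullet> axis i 1) * (N $ i)) = (\<Sum>i\<in>UNIV. g $ i * N $ i)" by (simp add: inner_axis)
  also have "\<dots> = g \<bullet> N" by (simp add: inner_vec_def)
  finally show ?thesis .
qed

text \<open>
The \<open>p\<close>-Laplacian of \<open>u = F(y) + c \<tau>\<close> for \<open>y = |x'|\<^sup>2\<close> and \<open>\<tau> = |x''|\<^sup>2\<close>.  The gradients of \<open>y\<close> and \<open>\<tau>\<close>
are the orthogonal vectors \<open>2x'\<close> and \<open>2x''\<close>, so \<open>\<nabla>u = 2N\<close> with \<open>N = F'(y) x' + c x''\<close> and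
\<open>|N|\<^sup>2 = Q = F'(y)\<^sup>2 y + c\<^sup>2 \<tau>\<close>.  The divergence of \<open>Q\<^sup>s N\<close> with \<open>s = (p - 2)/2\<close> is the positive
factor \<open>Q\<^sup>s\<^sup>-\<^sup>1\<close> times \<open>s \<nabla>Q \<cdot> N + Q div N\<close>, which is the bracket below.  In terms of
\<open>f(\<rho>) = F(\<rho>\<^sup>2)\<close> the combination \<open>2y F'' + F'\<close> is \<open>f''/2\<close> and \<open>F'\<close> is \<open>f'/(2\<rho>)\<close>.
\<close>

lemma p_flux_of_squared_distances:
  fixes B :: "(real^'n::finite) set" and F F1 F2 :: "real \<Rightarrow> real" and w :: "real^'n" and c p :: real
  defines "y \<equiv> \<lambda>x w. \<Sum>b\<in>B. (b \<bullet> (x - w))\<^sup>2"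
  defines "tau \<equiv> \<lambda>x w. (x - w) \<bullet> (x - w) - y x w"
  assumes B: "orthonormal B" and U: "open U" and ypos: "\<And>x. x \<in> U \<Longrightarrow> y x w > 0"
    and F: "\<And>t. t > 0 \<Longrightarrow> (F has_real_derivative F1 t) (at t)" "\<And>t. t > 0 \<Longrightarrow> (F1 has_real_derivative F2 t) (at t)"
    and F1pos: "\<And>x. x \<in> U \<Longrightarrow> F1 (y x w) > 0"
    and smooth: "smooth_on U (\<lambda>x. F (y x w))" "smooth_on U (\<lambda>x. F1 (y x w))"
  defines "u \<equiv> \<lambda>x. F (y x w) + c * tau x w"
  defines "X \<equiv> p_flux p u"
  shows "smooth_on U u" "C1_field_on U X"
    "\<And>x. x \<in> U \<Longrightarrow> \<exists>k>0. divergence X x = k *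
       ((F1 (y x w))\<^sup>2 * y x w * ((p - 1) * (2 * y x w * F2 (y x w) + F1 (y x w)) + (real (card B) - 1) * F1 (y x w) + c * real (CARD('n) - card B))
        + c\<^sup>2 * tau x w * ((2 * y x w * F2 (y x w) + F1 (y x w)) + (real (card B) - 1) * F1 (y x w) + c * (real (CARD('n) - card B) + p - 2)))"
proof -
  define Y where "Y x = y x w" for x
  define T where "T x = tau x w" for x
  define P where "P x = proj B (x - w)" for x
  define N where "N x = F1 (Y x) *\<^sub>R P x + c *\<^sub>R ((x - w) - P x)" for x
  define Q where "Q x = (F1 (Y x))\<^sup>2 * Y x + c\<^sup>2 * T x" for x
  have Y_eq: "Y x = P x \<bullet> P x" "P x \<bullet> (x - w) = Y x" for x
    unfolding Y_def y_def P_def by (simp_all add: proj_inner[OF B])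
  have T_eq: "T x = ((x - w) - P x) \<bullet> ((x - w) - P x)" for x
    unfolding T_def tau_def y_def P_def by (simp add: proj_ortho(2)[OF B])
  have PT: "P x \<bullet> ((x - w) - P x) = 0" for x unfolding P_def by (rule proj_ortho(1)[OF B])
  have T0: "T x \<ge> 0" for x unfolding T_eq by simp
  have dP: "(P has_derivative (\<lambda>h. proj B h)) (at x)" for x
  proof -
    have "bounded_linear (proj B)" using linear_proj linear_conv_bounded_linear by blast
    then show ?thesis unfolding P_def[abs_def]
      by (rule bounded_linear.has_derivative[of "proj B" "\<lambda>x. x - w"]) (auto intro!: derivative_eq_intros)
  qed
  have projsym: "proj B h \<bullet> P x = P x \<bullet> h" for h x
  proof -
    have "proj B h \<bullet> proj B (x - w) = (\<Sum>b\<in>B. (b \<bullet> h) * (b \<bullet> (x - w)))"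
      unfolding proj_inner_left using inner_proj[OF B] by simp
    then show ?thesis by (simp add: P_def proj_inner_left mult.commute)
  qed
  have projsym': "P x \<bullet> proj B h = P x \<bullet> h" for h x using projsym by (simp add: inner_commute)
  have dY: "(Y has_derivative (\<lambda>h. 2 * (P x \<bullet> h))) (at x)" for x
    unfolding Y_eq(1)[abs_def]
    by (rule has_derivative_eq_rhs[OF has_derivative_inner[OF dP dP]]) (auto simp: fun_eq_iff projsym projsym')
  have dT: "(T has_derivative (\<lambda>h. 2 * (((x - w) - P x) \<bullet> h))) (at x)" for x
  proof -
    have "((\<lambda>x. (x - w) \<bullet> (x - w) - Y x) has_derivative (\<lambda>h. 2 * (((x - w) - P x) \<bullet> h))) (at x)"
      by (auto intro!: derivative_eq_intros dY simp: inner_commute inner_diff_left algebra_simps)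
    then show ?thesis unfolding T_def[abs_def] tau_def Y_def[abs_def] .
  qed
  have Ypos: "Y x > 0" "F1 (Y x) > 0" if "x \<in> U" for x using ypos F1pos that by (auto simp: Y_def)
  have Qpos: "Q x > 0" if "x \<in> U" for x
    unfolding Q_def using Ypos[OF that] T0[of x] by (intro add_pos_nonneg mult_pos_pos mult_nonneg_nonneg) auto
  have NN: "N x \<bullet> N x = Q x" for x
    unfolding N_def Q_def Y_eq(1) T_eq using PT[of x] inner_commute[of "P x" "x - w - P x"]
    by (simp add: inner_add_left inner_add_right power2_eq_square)
  have F1': "((\<lambda>x. F1 (Y x)) has_derivative (\<lambda>h. (2 * (P x \<bullet> h)) * F2 (Y x))) (at x)" if "x \<in> U" for x
    using DERIV_compose_FDERIV[OF F(2)[OF Ypos(1)[OF that]] dY] .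
  have du: "(u has_derivative (\<lambda>h. (2 *\<^sub>R N x) \<bullet> h)) (at x)" if "x \<in> U" for x
  proof -
    have "((\<lambda>x. F (Y x)) has_derivative (\<lambda>h. (2 * (P x \<bullet> h)) * F1 (Y x))) (at x)"
      using DERIV_compose_FDERIV[OF F(1)[OF Ypos(1)[OF that]] dY] .
    from has_derivative_add[OF this has_derivative_mult_right[OF dT, of c]]
    have "((\<lambda>x. F (Y x) + c * T x) has_derivative (\<lambda>h. (2 *\<^sub>R N x) \<bullet> h)) (at x)"
      by (rule has_derivative_eq_rhs) (auto simp: fun_eq_iff N_def inner_add_left algebra_simps)
    then show ?thesis unfolding u_def Y_def[abs_def] T_def[abs_def] .
  qed
  have gu: "gradient u x = 2 *\<^sub>R N x" if "x \<in> U" for x by (rule gradient_unique[OF du[OF that]])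
  have finB: "finite B" using B by (simp add: orthonormal_def)
  have sY: "smooth_on U Y" unfolding Y_def[abs_def] y_def by (rule smooth_on_sum_squares[OF U finB])
  have sT: "smooth_on U T"
  proof -
    have "smooth_on U (\<lambda>x. (\<Sum>b\<in>Basis. (b \<bullet> (x - w))\<^sup>2) - Y x)"
      by (intro smooth_on_diff[OF U] smooth_on_sum_squares U sY) simp
    moreover have "(\<Sum>b\<in>Basis. (b \<bullet> (x - w))\<^sup>2) = (x - w) \<bullet> (x - w)" for x
      using euclidean_inner[of "x - w" "x - w"] by (simp add: power2_eq_square inner_commute)
    ultimately show ?thesis by (simp add: T_def[abs_def] tau_def Y_def)
  qed
  show "smooth_on U u" unfolding u_def
    using smooth sT by (intro smooth_on_add[OF U] smooth_on_mult[OF U] smooth_on_const) (auto simp: T_def[abs_def])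
  define s where "s = (p - 2) / 2"
  define X' where "X' x = (2 powr (p - 1) * Q x powr s) *\<^sub>R N x" for x
  have X_eq: "X x = X' x" if "x \<in> U" for x
  proof -
    have "norm (gradient u x) = 2 * sqrt (Q x)"
      unfolding gu[OF that] by (simp add: norm_eq_sqrt_inner NN real_sqrt_mult)
    then have "norm (gradient u x) powr (p - 2) = 2 powr (p - 2) * Q x powr s"
      using Qpos[OF that] by (simp add: powr_mult s_def powr_half_sqrt[symmetric] powr_powr)
    moreover have "(2::real) powr (p - 1) = 2 powr (p - 2) * 2"
      using powr_add[of 2 "p - 2" 1] by simp
    ultimately show ?thesis unfolding X_def p_flux_def X'_def gu[OF that] by (simp add: mult_ac)
  qed
  have sQ: "smooth_on U Q"
    unfolding Q_def[abs_def] power2_eq_square using smooth(2) sY sT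
    by (intro smooth_on_add[OF U] smooth_on_mult[OF U] smooth_on_const) (auto simp: Y_def[abs_def])
  have sX': "smooth_on U (\<lambda>x. X' x $ i)" for i
  proof -
    have sl: "smooth_on U (\<lambda>x. a \<bullet> (x - w))" for a using Ck_on_affine[OF U] by (simp add: smooth_on_def)
    have Pi: "P x $ i = (\<Sum>b\<in>B. (b $ i) * (b \<bullet> (x - w)))" for x by (simp add: P_def proj_def mult.commute)
    have sPi: "smooth_on U (\<lambda>x. P x $ i)" unfolding Pi smooth_on_def
      using sl unfolding smooth_on_def by (intro allI Ck_on_sum[OF U finB] Ck_on_mult[OF U] Ck_on_const) auto
    have xi: "smooth_on U (\<lambda>x. (x - w) $ i)" using sl[of "axis i 1"] by (simp add: inner_axis')
    have "smooth_on U (\<lambda>x. (2 powr (p - 1) * Q x powr s) * (F1 (Y x) * P x $ i + c * ((x - w) $ i - P x $ i)))"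
      using smooth(2) by (intro smooth_on_mult[OF U] smooth_on_add[OF U] smooth_on_diff[OF U] smooth_on_const smooth_on_powr[OF U] sQ sPi xi Qpos)
        (auto simp: Y_def[abs_def])
    then show ?thesis by (simp add: X'_def N_def)
  qed
  show "C1_field_on U X"
    unfolding C1_field_on_def
  proof
    fix i show "Ck_on 1 U (\<lambda>x. X x $ i)"
      using sX'[of i] Ck_on_cong[OF U, of "\<lambda>x. X x $ i" "\<lambda>x. X' x $ i" 1] X_eq unfolding smooth_on_def by simp
  qed
  fix x assume x: "x \<in> U"
  define a where "a = F1 (Y x)"
  define b where "b = F2 (Y x)"
  define \<nu> where "\<nu> = (x - w) - P x"
  have \<nu>: "P x \<bullet> \<nu> = 0" "\<nu> \<bullet> P x = 0" "\<nu> \<bullet> \<nu> = T x" "P x \<bullet> P x = Y x"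
    using PT[of x] T_eq[of x] Y_eq(1)[of x] inner_commute[of \<nu> "P x"] by (simp_all add: \<nu>_def)
  define gQ where "gQ = (2 * (2 * a * b * Y x + a\<^sup>2)) *\<^sub>R P x + (2 * c\<^sup>2) *\<^sub>R \<nu>"
  have dQ: "(Q has_derivative (\<lambda>h. gQ \<bullet> h)) (at x)"
    unfolding Q_def[abs_def] power2_eq_square
    by (rule has_derivative_eq_rhs, (rule derivative_intros F1'[OF x] dY dT)+)
      (auto simp: fun_eq_iff gQ_def a_def b_def \<nu>_def inner_add_left algebra_simps power2_eq_square)
  have dN: "(N has_derivative (\<lambda>h. (2 * b * (P x \<bullet> h)) *\<^sub>R P x + a *\<^sub>R proj B h + c *\<^sub>R (h - proj B h))) (at x)"
    unfolding N_def[abs_def]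
    by (rule has_derivative_eq_rhs, (rule derivative_intros F1'[OF x] dP)+)
      (auto simp: fun_eq_iff a_def b_def algebra_simps)
  have "((\<lambda>q. q powr s) has_real_derivative s * Q x powr (s - 1)) (at (Q x))"
    using Qpos[OF x] by (auto intro!: derivative_eq_intros)
  from DERIV_compose_FDERIV[OF this dQ]
  have dQs: "((\<lambda>x. Q x powr s) has_derivative (\<lambda>h. (gQ \<bullet> h) * (s * Q x powr (s - 1)))) (at x)" .
  define q where "q = Q x powr (s - 1)"
  have Qs: "Q x powr s = q * Q x"
    unfolding q_def using Qpos[OF x] by (simp add: powr_diff)
  define k0 where "k0 = 2 powr (p - 1)"
  define DX where "DX h = k0 *\<^sub>R (((gQ \<bullet> h) * (s * q)) *\<^sub>R N x + (q * Q x) *\<^sub>R ((2 * b * (P x \<bullet> h)) *\<^sub>R P x + a *\<^sub>R proj B h + c *\<^sub>R (h - proj B h)))" for h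
  have "((\<lambda>x. k0 *\<^sub>R (Q x powr s *\<^sub>R N x)) has_derivative DX) (at x)"
    by (rule has_derivative_eq_rhs[OF has_derivative_scaleR_right[OF has_derivative_scaleR[OF dQs dN]]])
      (auto simp: fun_eq_iff DX_def Qs q_def[symmetric] add.commute)
  then have "(X' has_derivative DX) (at x)" unfolding X'_def[abs_def] k0_def by simp
  then have dX: "(X has_derivative DX) (at x)"
    by (rule has_derivative_transform_within_open[OF _ U x]) (simp add: X_eq)
  have lec: "card B \<le> CARD('n)"
  proof -
    have "(0::real^'n) \<notin> B" using B by (auto simp: orthonormal_def)
    then have "independent B" using B pairwise_orthogonal_independent by (auto simp: orthonormal_def)
    then show ?thesis using independent_bound by fastforce
  qed
  have "divergence X x = (\<Sum>i\<in>UNIV. k0 * (s * q * ((gQ \<bullet> axis i 1) * N x $ i) + q * Q x * (2 * b * ((P x \<bullet> axis i 1) * P x $ i)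
      + a * (proj B (axis i 1) $ i) + c * (1 - proj B (axis i 1) $ i))))"
    unfolding divergence_eq[OF dX] DX_def by (intro sum.cong refl) (simp add: algebra_simps)
  also have "\<dots> = k0 * (s * q * (gQ \<bullet> N x) + q * Q x * (2 * b * (P x \<bullet> P x) + a * card B + c * (real CARD('n) - card B)))"
    by (simp add: sum.distrib sum_subtractf sum_distrib_left[symmetric] inner_eq_sum_axis trace_proj[OF B])
  also have "gQ \<bullet> N x = 2 * ((2 * a * b * Y x + a\<^sup>2) * a * Y x + c\<^sup>2 * c * T x)"
    unfolding gQ_def N_def a_def[symmetric] \<nu>_def[symmetric]
    by (simp add: inner_add_left inner_add_right \<nu>)
  also have "s * q * (2 * ((2 * a * b * Y x + a\<^sup>2) * a * Y x + c\<^sup>2 * c * T x)) = q * ((p - 2) * ((2 * a * b * Y x + a\<^sup>2) * a * Y x + c\<^sup>2 * c * T x))"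
    by (simp add: s_def)
  finally have "divergence X x = (k0 * q) * ((p - 2) * ((2 * a * b * Y x + a\<^sup>2) * a * Y x + c\<^sup>2 * c * T x)
      + Q x * (2 * b * Y x + a * card B + c * (real CARD('n) - card B)))"
    unfolding \<nu>(4) by (simp only: distrib_left mult.assoc)
  also have "\<dots> = (k0 * q) * (a\<^sup>2 * Y x * ((p - 1) * (2 * Y x * b + a) + (real (card B) - 1) * a + c * real (CARD('n) - card B))
        + c\<^sup>2 * T x * ((2 * Y x * b + a) + (real (card B) - 1) * a + c * (real (CARD('n) - card B) + p - 2)))"
    using lec unfolding Q_def a_def[symmetric] by (simp add: of_nat_diff algebra_simps power2_eq_square)
  finally show "\<exists>k>0. divergence X x = k *
       ((F1 (y x w))\<^sup>2 * y x w * ((p - 1) * (2 * y x w * F2 (y x w) + F1 (y x w)) + (real (card B) - 1) * F1 (y x w) + c * real (CARD('n) - card B))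
        + c\<^sup>2 * tau x w * ((2 * y x w * F2 (y x w) + F1 (y x w)) + (real (card B) - 1) * F1 (y x w) + c * (real (CARD('n) - card B) + p - 2)))"
    using Qpos[OF x] by (intro exI[of _ "k0 * q"]) (auto simp: a_def b_def Y_def T_def k0_def q_def)
qed

section \<open>Barriers for finite \<open>p\<close>\<close>

text \<open>
The sign of the \<open>p\<close>-Laplacian of the barrier, at a point with \<open>|x'|\<^sup>2 = \<sigma>\<close> and \<open>|x''|\<^sup>2 = \<theta>\<close> in the unit ball;
\<open>P\<close> and \<open>T\<close> stand for \<open>F'\<close> and \<open>2\<sigma>F'' + F'\<close> with \<open>F(\<sigma>) = a \<sigma>\<^sup>\<beta>\<^sup>/\<^sup>2 - \<sigma>\<^sup>1\<^sup>-\<^sup>\<beta>\<^sup>/\<^sup>2 - k \<sigma>\<close>.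
In \<open>(p - 1) T + (d - 1) P\<close> the contribution of \<open>a\<close> cancels, by the choice of \<open>\<beta>\<close>, and what is left is
\<open>-(2 - \<beta>) ((d - 1) \<delta> + (p - 1) k)\<close>.  Multiplied by \<open>P\<^sup>2 \<sigma>\<close>, which is of order \<open>(a\<beta>\<alpha>)\<^sup>2 \<sigma>\<close>, it beats the second
summand: as \<open>\<alpha>\<delta>\<sigma> = 1\<close>, the \<open>\<delta>\<close>-part gives \<open>(a\<beta>)\<^sup>2 (d - 1) \<alpha>\<close> against \<open>a\<beta> (d - 1) \<alpha>\<close>, and the \<open>k\<close>-part
dominates \<open>m\<close> and \<open>p - 1\<close> by the lower bounds for \<open>k\<close>.
\<close>

lemma powr_combination_inequality:
  fixes \<sigma> \<beta> p a k \<theta> d m :: real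
  assumes \<sigma>: "0 < \<sigma>" "\<sigma> < 1" and \<beta>: "0 < \<beta>" "\<beta> \<le> 1" and p: "p > 1" and d: "d - 1 = (p - 1) * (1 - \<beta>)" "d \<ge> 1"
    and m: "m \<ge> 0" and k: "k \<ge> 1" "(p - 1) * k \<ge> 2 * m" and a: "a * \<beta> \<ge> 8 + 4 * k" and \<theta>: "0 \<le> \<theta>" "\<theta> \<le> 1"
  defines "\<alpha> \<equiv> \<sigma> powr (\<beta> / 2 - 1)" and "\<delta> \<equiv> \<sigma> powr (- (\<beta> / 2))"
  defines "P \<equiv> a * \<beta> / 2 * \<alpha> - (1 - \<beta> / 2) * \<delta> - k"
    and "T \<equiv> a * \<beta> / 2 * (\<beta> - 1) * \<alpha> - (1 - \<beta> / 2) * (1 - \<beta>) * \<delta> - k"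
  shows "P > 0" "P\<^sup>2 * \<sigma> * ((p - 1) * T + (d - 1) * P + m) + \<theta> * (T + (d - 1) * P + (m + p - 2)) \<le> 0"
proof -
  define A where "A = a * \<beta>"
  have A: "A \<ge> 8 + 4 * k" using a by (simp add: A_def)
  have \<delta>1: "\<delta> \<ge> 1"
  proof -
    have "\<sigma> powr 0 \<le> \<sigma> powr (- (\<beta> / 2))" using \<sigma> \<beta> by (intro powr_mono') auto
    then show ?thesis using \<sigma> by (simp add: \<delta>_def)
  qed
  have \<alpha>\<delta>: "\<delta> \<le> \<alpha>" unfolding \<alpha>_def \<delta>_def using \<sigma> \<beta> by (intro powr_mono') auto
  have prod: "\<alpha> * \<delta> * \<sigma> = 1"
  proof -
    have "\<alpha> * \<delta> * \<sigma> powr 1 = \<sigma> powr 0" unfolding \<alpha>_def \<delta>_def powr_add[symmetric] by simp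
    then show ?thesis using \<sigma> by simp
  qed
  have sq: "\<alpha> * \<alpha> * \<sigma> \<ge> 1"
    using prod \<alpha>\<delta> \<delta>1 \<sigma> by (smt (verit) mult_left_mono mult_right_mono)
  have b1: "(1 - \<beta> / 2) * \<delta> \<le> \<alpha>" using mult_mono[of "1 - \<beta> / 2" 1 \<delta> \<alpha>] \<beta> \<alpha>\<delta> \<delta>1 by simp
  have b2: "k \<le> k * \<alpha>" using mult_left_mono[of 1 \<alpha> k] k \<alpha>\<delta> \<delta>1 by simp
  have b3: "(8 + 4 * k) * \<alpha> \<le> A * \<alpha>" using A \<alpha>\<delta> \<delta>1 by (intro mult_right_mono) auto
  have P_lo: "A / 4 * \<alpha> \<le> P"
    using b1 b2 b3 \<alpha>\<delta> \<delta>1 unfolding P_def A_def[symmetric] by (simp add: algebra_simps)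
  have "0 \<le> (1 - \<beta> / 2) * \<delta>" using \<beta> \<delta>1 by (intro mult_nonneg_nonneg) auto
  then have P_hi: "P \<le> A / 2 * \<alpha>" using k unfolding P_def A_def[symmetric] by linarith
  have Apos: "A > 0" using A k by simp
  have "A / 4 * \<alpha> > 0" using Apos \<alpha>\<delta> \<delta>1 by (intro mult_pos_pos) auto
  then show P0: "P > 0" using P_lo by linarith
  have T0: "T \<le> 0"
  proof -
    have "A / 2 * (\<beta> - 1) * \<alpha> \<le> 0" using Apos \<beta> \<alpha>\<delta> \<delta>1 by (intro mult_nonpos_nonneg mult_nonneg_nonpos) auto
    moreover have "0 \<le> (1 - \<beta> / 2) * (1 - \<beta>) * \<delta>" using \<beta> \<delta>1 by (intro mult_nonneg_nonneg) auto
    ultimately show ?thesis using k unfolding T_def A_def[symmetric] by linarith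
  qed
  define L where "L = (p - 1) * T + (d - 1) * P"
  have "L = (p - 1) * (T + (1 - \<beta>) * P)" unfolding L_def d(1) by (simp add: algebra_simps)
  also have "T + (1 - \<beta>) * P = - ((2 - \<beta>) * ((1 - \<beta>) * \<delta> + k))" unfolding T_def P_def by (simp add: field_simps)
  also have "(p - 1) * (- ((2 - \<beta>) * ((1 - \<beta>) * \<delta> + k))) = - ((2 - \<beta>) * ((d - 1) * \<delta> + (p - 1) * k))"
    unfolding d(1) by (simp add: algebra_simps)
  finally have L_eq: "L = - ((2 - \<beta>) * ((d - 1) * \<delta> + (p - 1) * k))" .
  have nn: "0 \<le> (d - 1) * \<delta>" "0 \<le> (p - 1) * k" using d(2) \<delta>1 p k by auto
  have "1 * ((d - 1) * \<delta> + (p - 1) * k) \<le> (2 - \<beta>) * ((d - 1) * \<delta> + (p - 1) * k)"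
    using nn \<beta> by (intro mult_right_mono) auto
  then have Lm: "L + m \<le> - ((d - 1) * \<delta> + (p - 1) * k / 2)" using k(2) L_eq by simp
  have "P\<^sup>2 * \<sigma> \<ge> (A / 4 * \<alpha>)\<^sup>2 * \<sigma>"
    using P_lo Apos \<alpha>\<delta> \<delta>1 \<sigma> by (intro mult_right_mono power_mono) auto
  moreover have "0 \<le> (d - 1) * \<delta> + (p - 1) * k / 2" using nn by simp
  ultimately have "(A / 4 * \<alpha>)\<^sup>2 * \<sigma> * ((d - 1) * \<delta> + (p - 1) * k / 2) \<le> P\<^sup>2 * \<sigma> * ((d - 1) * \<delta> + (p - 1) * k / 2)"
    by (rule mult_right_mono)
  also have "\<dots> \<le> P\<^sup>2 * \<sigma> * (- (L + m))" using Lm \<sigma> by (intro mult_left_mono) auto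
  also have "\<dots> = - (P\<^sup>2 * \<sigma> * (L + m))" by (rule mult_minus_right)
  finally have first: "P\<^sup>2 * \<sigma> * (L + m) \<le> - ((A / 4 * \<alpha>)\<^sup>2 * \<sigma> * ((d - 1) * \<delta> + (p - 1) * k / 2))"
    by (simp only: le_minus_iff)
  have "(q * \<alpha>)\<^sup>2 * \<sigma> * (D * \<delta> + Z) = q\<^sup>2 * (D * \<alpha> * (\<alpha> * \<delta> * \<sigma>) + (\<alpha> * \<alpha> * \<sigma>) * Z)" for q D Z
    by (simp add: power2_eq_square algebra_simps)
  then have "(A / 4 * \<alpha>)\<^sup>2 * \<sigma> * ((d - 1) * \<delta> + (p - 1) * k / 2) = (A / 4)\<^sup>2 * ((d - 1) * \<alpha> * (\<alpha> * \<delta> * \<sigma>) + (\<alpha> * \<alpha> * \<sigma>) * ((p - 1) * k / 2))" .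
  also have "\<dots> \<ge> (A / 4)\<^sup>2 * ((d - 1) * \<alpha> + 1 * ((p - 1) * k / 2))"
    unfolding prod using sq nn by (intro mult_left_mono add_mono mult_right_mono) auto
  finally have second: "(A / 4)\<^sup>2 * ((d - 1) * \<alpha> + (p - 1) * k / 2) \<le> (A / 4 * \<alpha>)\<^sup>2 * \<sigma> * ((d - 1) * \<delta> + (p - 1) * k / 2)"
    by simp
  have A4: "A / 4 \<ge> 2" using A k by simp
  have "A / 2 * ((d - 1) * \<alpha>) + 2 * ((p - 1) * k) \<le> (A / 4)\<^sup>2 * ((d - 1) * \<alpha>) + (A / 4)\<^sup>2 * ((p - 1) * k / 2)"
  proof (rule add_mono)
    have "2 * (A / 4) \<le> (A / 4)\<^sup>2" using A4 unfolding power2_eq_square by (intro mult_right_mono) auto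
    then show "A / 2 * ((d - 1) * \<alpha>) \<le> (A / 4)\<^sup>2 * ((d - 1) * \<alpha>)"
      using d(2) \<alpha>\<delta> \<delta>1 by (intro mult_right_mono) auto
    have "2\<^sup>2 \<le> (A / 4)\<^sup>2" using A4 by (intro power_mono) auto
    then have "4 * ((p - 1) * k / 2) \<le> (A / 4)\<^sup>2 * ((p - 1) * k / 2)" using nn by (intro mult_right_mono) auto
    moreover have "4 * ((p - 1) * k / 2) = 2 * ((p - 1) * k)" by simp
    ultimately show "2 * ((p - 1) * k) \<le> (A / 4)\<^sup>2 * ((p - 1) * k / 2)" by (simp only:)
  qed
  then have third: "A / 2 * ((d - 1) * \<alpha>) + 2 * ((p - 1) * k) \<le> (A / 4)\<^sup>2 * ((d - 1) * \<alpha> + (p - 1) * k / 2)"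
    by (simp add: distrib_left)
  have dP: "(d - 1) * P \<le> A / 2 * ((d - 1) * \<alpha>)" using mult_left_mono[OF P_hi, of "d - 1"] d(2) by (simp add: mult_ac)
  have pk: "p - 1 \<le> (p - 1) * k" using mult_left_mono[of 1 k "p - 1"] k p by simp
  have dP0: "0 \<le> (d - 1) * P" using d(2) P0 by simp
  have "\<theta> * (T + (d - 1) * P + (m + p - 2)) \<le> \<theta> * ((d - 1) * P + m + (p - 1))"
    using T0 \<theta> by (intro mult_left_mono) auto
  also have "\<dots> \<le> 1 * ((d - 1) * P + m + (p - 1))"
    using \<theta> dP0 m p by (intro mult_right_mono) auto
  also have "\<dots> \<le> A / 2 * ((d - 1) * \<alpha>) + 2 * ((p - 1) * k)" 
  proof -
    have "1 * (x + m + q) \<le> y + 2 * z" if "x \<le> y" "2 * m \<le> z" "q \<le> z" for x y z q :: real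
    proof -
      have "m + q \<le> 2 * z" using that(2,3) m by simp
      then show ?thesis using that(1) by simp
    qed
    from this[OF dP k(2) pk] show ?thesis .
  qed
  finally have fourth: "\<theta> * (T + (d - 1) * P + (m + p - 2)) \<le> A / 2 * ((d - 1) * \<alpha>) + 2 * ((p - 1) * k)" .
  show "P\<^sup>2 * \<sigma> * ((p - 1) * T + (d - 1) * P + m) + \<theta> * (T + (d - 1) * P + (m + p - 2)) \<le> 0"
  proof -
    have "x + z \<le> 0" if "x \<le> - t" "r \<le> t" "q \<le> r" "z \<le> q" for x z t r q :: real using that by linarith
    from this[OF first second third fourth] show ?thesis unfolding L_def .
  qed
qed

text \<open>
The barrier \<open>F(|x'|\<^sup>2 / R\<^sup>2) + |x''|\<^sup>2 / R\<^sup>2\<close>.  As \<open>\<sigma>\<^sup>1\<^sup>-\<^sup>\<beta>\<^sup>/\<^sup>2\<close> and \<open>\<sigma>\<close> are at most \<open>\<sigma>\<^sup>\<beta>\<^sup>/\<^sup>2\<close> on \<open>[0,1]\<close>,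
the bound \<open>a \<ge> 2 + k\<close> gives \<open>F(\<sigma>) \<ge> \<sigma>\<close>, which is nonnegativity in the ball and, since
\<open>|x'|\<^sup>2 + |x''|\<^sup>2 = R\<^sup>2\<close> on the sphere, the boundary condition.
\<close>

lemma p_harmonic_measure_barrier:
  fixes B :: "(real^'n::finite) set" and w :: "real^'n" and p R b\<^sub>0 q\<^sub>0 :: real
  assumes B: "orthonormal B" "1 \<le> card B" and p: "p > real (card B)" and R: "R > 0"
    and G: "open G" "G \<subseteq> ball w R" "\<And>x. x \<in> G \<Longrightarrow> (\<Sum>b\<in>B. (b \<bullet> (x - w))\<^sup>2) > 0"
    and \<beta>_def: "\<beta> = (p - card B) / (p - 1)" and b0: "0 < b\<^sub>0" "b\<^sub>0 \<le> \<beta>" and q0: "0 < q\<^sub>0" "q\<^sub>0 \<le> p - 1"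
  defines "a \<equiv> (8 + 4 * (1 + 2 * CARD('n) / q\<^sub>0)) / b\<^sub>0"
  obtains u where "p_superharmonic p G u" "\<And>x. x \<in> G \<Longrightarrow> 0 \<le> u x"
    "\<And>y. y \<in> frontier (ball w R) \<Longrightarrow> (\<Sum>b\<in>B. (b \<bullet> (y - w))\<^sup>2) > 0 \<Longrightarrow> Liminf (at y within G) (\<lambda>z. ereal (u z)) \<ge> 1"
    "\<And>x. x \<in> G \<Longrightarrow> (x - w) \<bullet> (x - w) = (\<Sum>b\<in>B. (b \<bullet> (x - w))\<^sup>2) \<Longrightarrow> u x \<le> a * (norm (x - w) / R) powr \<beta>"
proof -
  define k where "k = 1 + 2 * CARD('n) / q\<^sub>0"
  define d where "d = real (card B)"
  define m where "m = real (CARD('n) - card B)"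
  have p1: "p > 1" using p B(2) by linarith
  have \<beta>: "0 < \<beta>" "\<beta> \<le> 1" using p p1 B(2) by (auto simp: \<beta>_def)
  have d: "d - 1 = (p - 1) * (1 - \<beta>)" "d \<ge> 1" using p1 B(2) by (auto simp: \<beta>_def d_def field_simps)
  have k: "k \<ge> 1" using q0 by (simp add: k_def)
  have km: "(p - 1) * k \<ge> 2 * m"
  proof -
    have "2 * m \<le> 2 * CARD('n)" by (simp add: m_def)
    also have "\<dots> \<le> q\<^sub>0 * k" using q0 by (simp add: k_def field_simps)
    also have "\<dots> \<le> (p - 1) * k" using q0 k by (intro mult_right_mono) auto
    finally show ?thesis .
  qed
  have a_eq: "a = (8 + 4 * k) / b\<^sub>0" by (simp add: a_def k_def)
  have a0: "a > 0" unfolding a_eq using b0 k by simp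
  have ab: "a * \<beta> \<ge> 8 + 4 * k"
  proof -
    have "8 + 4 * k = a * b\<^sub>0" unfolding a_eq using b0 by simp
    also have "\<dots> \<le> a * \<beta>" using b0 a0 by (intro mult_left_mono) auto
    finally show ?thesis .
  qed
  have ak: "a \<ge> 2 + k"
  proof -
    have "a * \<beta> \<le> a * 1" using \<beta> a0 by (intro mult_left_mono) auto
    then show ?thesis using ab k by simp
  qed
  define c where "c = 1 / R\<^sup>2"
  have c: "c > 0" using R by (simp add: c_def)
  define Y where "Y x = (\<Sum>b\<in>B. (b \<bullet> (x - w))\<^sup>2)" for x
  define F where "F t = a * (c * t) powr (\<beta> / 2) - (c * t) powr (1 - \<beta> / 2) - k * (c * t)" for t
  define F1 where "F1 t = c * (a * \<beta> / 2 * (c * t) powr (\<beta> / 2 - 1) - (1 - \<beta> / 2) * (c * t) powr (- (\<beta> / 2)) - k)" for t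
  define F2 where "F2 t = c\<^sup>2 * (a * \<beta> / 2 * (\<beta> / 2 - 1) * (c * t) powr (\<beta> / 2 - 2) + (1 - \<beta> / 2) * (\<beta> / 2) * (c * t) powr (- (\<beta> / 2) - 1))" for t
  have F_der: "(F has_real_derivative F1 t) (at t)" if "t > 0" for t
    unfolding F_def F1_def using that c
    by (auto intro!: derivative_eq_intros simp: algebra_simps)
  have F1_der: "(F1 has_real_derivative F2 t) (at t)" if "t > 0" for t
    unfolding F1_def F2_def using that c
    by (auto intro!: derivative_eq_intros simp: algebra_simps power2_eq_square) (simp add: field_simps)
  define u where "u x = F (Y x) + c * ((x - w) \<bullet> (x - w) - Y x)" for x
  define U where "U = {x. Y x > 0}"
  have Yc: "continuous_on S Y" for S unfolding Y_def by (intro continuous_intros)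
  have U: "open U" unfolding U_def by (intro open_Collect_less continuous_on_const Yc)
  have GU: "G \<subseteq> U" using G(3) by (auto simp: U_def Y_def)
  have sY: "smooth_on U Y" unfolding Y_def[abs_def] using B(1) by (intro smooth_on_sum_squares U) (simp add: orthonormal_def)
  have sp: "smooth_on U (\<lambda>x. (c * Y x) powr e)" for e
    using c by (intro smooth_on_powr smooth_on_mult U smooth_on_const sY) (auto simp: U_def)
  have sF: "smooth_on U (\<lambda>x. F (Y x))"
    unfolding F_def by (intro smooth_on_diff smooth_on_mult smooth_on_const U sp sY)
  have sF1: "smooth_on U (\<lambda>x. F1 (Y x))"
    unfolding F1_def by (intro smooth_on_diff smooth_on_mult smooth_on_const U sp sY)
  have R2: "c * R\<^sup>2 = 1" using R by (simp add: c_def)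
  have Yle: "Y x \<le> (x - w) \<bullet> (x - w)" for x unfolding Y_def by (rule bessel[OF B(1)])
  have norm_lt: "(x - w) \<bullet> (x - w) < R\<^sup>2" if "x \<in> G" for x
  proof -
    have "norm (x - w) < R" using G(2) that by (auto simp: dist_norm norm_minus_commute)
    then show ?thesis unfolding dot_square_norm by (intro power_strict_mono) auto
  qed
  have \<sigma>: "0 < c * Y x" "c * Y x < 1" if "x \<in> G" for x
  proof -
    show "0 < c * Y x" using c G(3)[OF that] by (simp add: Y_def)
    have "Y x < R\<^sup>2" using Yle[of x] norm_lt[OF that] by linarith
    then have "c * Y x < c * R\<^sup>2" using c by (rule mult_strict_left_mono)
    then show "c * Y x < 1" using R2 by simp
  qed
  have \<theta>: "0 \<le> c * ((x - w) \<bullet> (x - w) - Y x)" "c * ((x - w) \<bullet> (x - w) - Y x) \<le> 1" if "x \<in> G" for x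
  proof -
    show "0 \<le> c * ((x - w) \<bullet> (x - w) - Y x)" using c Yle by simp
    have "(x - w) \<bullet> (x - w) - Y x \<le> R\<^sup>2" using norm_lt[OF that] G(3)[OF that] by (simp add: Y_def)
    then have "c * ((x - w) \<bullet> (x - w) - Y x) \<le> c * R\<^sup>2" using c by (intro mult_left_mono) auto
    then show "c * ((x - w) \<bullet> (x - w) - Y x) \<le> 1" using R2 by simp
  qed
  note ineq = powr_combination_inequality[OF \<sigma> \<beta> p1 d _ k km ab \<theta>]
  have F1pos: "F1 (Y x) > 0" if "x \<in> G" for x
    unfolding F1_def using ineq(1)[OF that that _ that that] c by (simp add: m_def)
  have u_eq: "u = (\<lambda>x. F (Y x) + c * ((x - w) \<bullet> (x - w) - Y x))" by (simp add: u_def[abs_def])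
  note sFG = smooth_on_subset[OF sF GU] smooth_on_subset[OF sF1 GU]
  note flux = p_flux_of_squared_distances[OF B(1) G(1) G(3) F_der F1_der F1pos[unfolded Y_def] sFG[unfolded Y_def]]
  have u_smooth: "smooth_on G u" unfolding u_eq Y_def by (rule flux(1))
  have X_C1: "C1_field_on G (p_flux p u)"
    unfolding u_eq Y_def by (rule flux(2))
  have divX: "\<exists>K>0. divergence (p_flux p u) x = K *
       ((F1 (Y x))\<^sup>2 * Y x * ((p - 1) * (2 * Y x * F2 (Y x) + F1 (Y x)) + (d - 1) * F1 (Y x) + c * m)
        + c\<^sup>2 * ((x - w) \<bullet> (x - w) - Y x) * ((2 * Y x * F2 (Y x) + F1 (Y x)) + (d - 1) * F1 (Y x) + c * (m + p - 2)))"
    if "x \<in> G" for x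
    unfolding u_eq Y_def d_def m_def by (rule flux(3)) (simp_all add: that)
  have div: "divergence (p_flux p u) x \<le> 0" if x: "x \<in> G" for x
  proof -
    let ?y = "Y x" and ?t = "(x - w) \<bullet> (x - w) - Y x"
    define \<sigma>' where "\<sigma>' = c * ?y"
    define P where "P = a * \<beta> / 2 * \<sigma>' powr (\<beta> / 2 - 1) - (1 - \<beta> / 2) * \<sigma>' powr (- (\<beta> / 2)) - k"
    define T where "T = a * \<beta> / 2 * (\<beta> - 1) * \<sigma>' powr (\<beta> / 2 - 1) - (1 - \<beta> / 2) * (1 - \<beta>) * \<sigma>' powr (- (\<beta> / 2)) - k"
    have \<sigma>'0: "\<sigma>' > 0" using \<sigma>[OF x] by (simp add: \<sigma>'_def)
    have F1P: "F1 ?y = c * P" by (simp add: F1_def P_def \<sigma>'_def)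
    have e1: "\<sigma>' * \<sigma>' powr (\<beta> / 2 - 2) = \<sigma>' powr (\<beta> / 2 - 1)"
      "\<sigma>' * \<sigma>' powr (- (\<beta> / 2) - 1) = \<sigma>' powr (- (\<beta> / 2))"
      using \<sigma>'0 by (simp_all add: powr_mult_base)
    have F2y: "2 * ?y * F2 ?y = 2 * c * (a * \<beta> / 2 * (\<beta> / 2 - 1) * (\<sigma>' * \<sigma>' powr (\<beta> / 2 - 2)) + (1 - \<beta> / 2) * (\<beta> / 2) * (\<sigma>' * \<sigma>' powr (- (\<beta> / 2) - 1)))"
      unfolding F2_def \<sigma>'_def by (simp add: power2_eq_square algebra_simps)
    have F2T: "2 * ?y * F2 ?y + F1 ?y = c * T"
      unfolding F2y e1 F1P P_def T_def by (simp add: field_simps)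
    have I: "P\<^sup>2 * \<sigma>' * ((p - 1) * T + (d - 1) * P + m) + (c * ?t) * (T + (d - 1) * P + (m + p - 2)) \<le> 0"
    proof -
      have "0 \<le> m" by (simp add: m_def)
      from ineq(2)[OF x x this x x] show ?thesis unfolding P_def T_def \<sigma>'_def .
    qed
    obtain K where K: "K > 0" "divergence (p_flux p u) x = K *
       ((F1 ?y)\<^sup>2 * ?y * ((p - 1) * (2 * ?y * F2 ?y + F1 ?y) + (d - 1) * F1 ?y + c * m)
        + c\<^sup>2 * ?t * ((2 * ?y * F2 ?y + F1 ?y) + (d - 1) * F1 ?y + c * (m + p - 2)))"
      using divX[OF x] by blast
    have "(F1 ?y)\<^sup>2 * ?y * ((p - 1) * (2 * ?y * F2 ?y + F1 ?y) + (d - 1) * F1 ?y + c * m)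
        + c\<^sup>2 * ?t * ((2 * ?y * F2 ?y + F1 ?y) + (d - 1) * F1 ?y + c * (m + p - 2))
      = c\<^sup>2 * (P\<^sup>2 * \<sigma>' * ((p - 1) * T + (d - 1) * P + m) + (c * ?t) * (T + (d - 1) * P + (m + p - 2)))"
      unfolding F2T unfolding F1P \<sigma>'_def by (simp add: power2_eq_square algebra_simps)
    also have "\<dots> \<le> 0" using I by (intro mult_nonneg_nonpos) auto
    finally show ?thesis unfolding K(2) using K(1) by (intro mult_nonneg_nonpos) auto
  qed
  show thesis
  proof (rule that)
    show "p_superharmonic p G u"
      by (rule p_superharmonic_classical[OF G(1) _ smooth_on_differentiable[OF u_smooth] smooth_on_continuous_gradient[OF u_smooth] X_C1 div])
        (use p1 in auto)
    have key: "F (Y x) \<ge> (c * Y x) powr (\<beta> / 2) + (a - 2 - k) * (c * Y x) powr (\<beta> / 2)" "F (Y x) \<ge> c * Y x"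
      if "0 \<le> c * Y x" "c * Y x \<le> 1" for x
    proof -
      have l1: "(c * Y x) powr (1 - \<beta> / 2) \<le> (c * Y x) powr (\<beta> / 2)" using \<beta> that by (intro powr_mono') auto
      have "(c * Y x) powr 1 \<le> (c * Y x) powr (\<beta> / 2)" using \<beta> that by (intro powr_mono') auto
      then have l2: "c * Y x \<le> (c * Y x) powr (\<beta> / 2)" using that by simp
      have l3: "k * (c * Y x) \<le> k * (c * Y x) powr (\<beta> / 2)" using l2 k by (intro mult_left_mono) auto
      show 1: "F (Y x) \<ge> (c * Y x) powr (\<beta> / 2) + (a - 2 - k) * (c * Y x) powr (\<beta> / 2)"
        using l1 l3 unfolding F_def by (simp add: algebra_simps)
      have "0 \<le> (a - 2 - k) * (c * Y x) powr (\<beta> / 2)" using ak by simp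
      then show "F (Y x) \<ge> c * Y x" using 1 l2 by linarith
    qed
    show "0 \<le> u x" if "x \<in> G" for x
      using key(2)[of x] \<sigma>[OF that] \<theta>(1)[OF that] unfolding u_def by linarith
    show "Liminf (at y within G) (\<lambda>z. ereal (u z)) \<ge> 1"
      if y: "y \<in> frontier (ball w R)" "(\<Sum>b\<in>B. (b \<bullet> (y - w))\<^sup>2) > 0" for y
    proof -
      have ny: "(y - w) \<bullet> (y - w) = R\<^sup>2"
        using y(1) R by (auto simp: dot_square_norm frontier_ball dist_norm norm_minus_commute)
      have Yy: "0 \<le> c * Y y" "c * Y y \<le> 1"
      proof -
        show "0 \<le> c * Y y" using y(2) c by (simp add: Y_def)
        have "c * Y y \<le> c * R\<^sup>2" using Yle[of y] ny c by (intro mult_left_mono) auto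
        then show "c * Y y \<le> 1" using R2 by simp
      qed
      have "u y \<ge> c * R\<^sup>2" using key(2)[OF Yy] unfolding u_def ny by (simp add: right_diff_distrib)
      then have uy: "u y \<ge> 1" using R2 by simp
      have "y \<in> U" using y(2) by (simp add: U_def Y_def)
      moreover have "continuous_on U u" unfolding u_def
        by (intro continuous_intros smooth_on_continuous[OF sF] Yc)
      ultimately have "isCont u y" using U by (simp add: continuous_on_eq_continuous_at)
      then have lim: "(u \<longlongrightarrow> u y) (at y within G)" using continuous_at_imp_continuous_at_within continuous_within by blast
      show ?thesis unfolding le_Liminf_iff
      proof (intro allI impI)
        fix z :: ereal assume "z < 1"
        then have "z < ereal (u y)" using uy by (metis ereal_less_eq(3) less_le_trans one_ereal_def)
        moreover have "((\<lambda>x. ereal (u x)) \<longlongrightarrow> ereal (u y)) (at y within G)" using lim by simp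
        ultimately show "\<forall>\<^sub>F x in at y within G. z < ereal (u x)" by (rule order_tendstoD(1)[rotated])
      qed
    qed
    show "u x \<le> a * (norm (x - w) / R) powr \<beta>" if x: "x \<in> G" and eq: "(x - w) \<bullet> (x - w) = (\<Sum>b\<in>B. (b \<bullet> (x - w))\<^sup>2)" for x
    proof -
      have Yx: "Y x = (norm (x - w))\<^sup>2" using eq by (simp add: Y_def dot_square_norm)
      have "u x = F (Y x)" using eq by (simp add: u_def Y_def)
      also have "\<dots> \<le> a * (c * Y x) powr (\<beta> / 2)"
      proof -
        have "0 \<le> (c * Y x) powr (1 - \<beta> / 2)" "0 \<le> k * (c * Y x)" using \<sigma>[OF x] k by simp_all
        then show ?thesis unfolding F_def by linarith
      qed
      also have "c * Y x = (norm (x - w) / R) powr 2"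
        using R unfolding Yx c_def by (simp add: power_divide)
      also have "\<dots> powr (\<beta> / 2) = (norm (x - w) / R) powr \<beta>" by (simp add: powr_powr)
      finally show ?thesis .
    qed
  qed
qed

text \<open>
The \<open>p\<close>-Laplacian of \<open>|x'|\<^sup>b\<close> has the sign of \<open>(p - 1) b - (p - d)\<close>.  Lowering the subsolution by
\<open>e\<close> keeps the set where it exceeds \<open>u\<close> away from the tube, where it is at most \<open>-e\<close>, and from the sphere,
where it is at most \<open>1 - e\<close>.
\<close>

lemma p_superharmonic_lower_bound_strict:
  fixes B :: "(real^'n::finite) set" and w :: "real^'n" and p R s b :: real
  defines "\<rho> \<equiv> \<lambda>x. sqrt (\<Sum>a\<in>B. (a \<bullet> (x - w))\<^sup>2)"
  assumes B: "orthonormal B" "1 \<le> card B" and p: "p > real (card B)" and R: "R > 0" and s: "s > 0"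
    and b: "b > (p - card B) / (p - 1)"
    and G: "\<And>x. x \<in> ball w R \<Longrightarrow> \<rho> x > s \<Longrightarrow> x \<in> G"
    and u: "p_superharmonic p G u" "\<And>x. x \<in> G \<Longrightarrow> 0 \<le> u x"
    and bd: "\<And>y. y \<in> frontier (ball w R) \<Longrightarrow> \<rho> y > s \<Longrightarrow> Liminf (at y within G) (\<lambda>z. ereal (u z)) \<ge> 1"
    and x: "x \<in> ball w R" "\<rho> x > s"
  shows "(\<rho> x powr b - s powr b) / R powr b \<le> u x"
proof (rule field_le_epsilon)
  fix e :: real assume e: "e > 0"
  have p1: "p > 1" using p B(2) by linarith
  have b0: "b > 0" 
  proof -
    have "(p - card B) / (p - 1) > 0" using p p1 by simp
    then show ?thesis using b by linarith
  qed
  define Y where "Y x = (\<Sum>a\<in>B. (a \<bullet> (x - w))\<^sup>2)" for x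
  have \<rho>Y: "\<rho> = (\<lambda>x. sqrt (Y x))" by (simp add: \<rho>_def Y_def)
  have Y0: "Y x \<ge> 0" for x by (simp add: Y_def sum_nonneg)
  define c where "c = 1 / R powr b"
  have c: "c > 0" using R by (simp add: c_def)
  define k where "k = c * s powr b + e"
  define F where "F t = c * t powr (b / 2) - k" for t
  define F1 where "F1 t = c * (b / 2) * t powr (b / 2 - 1)" for t
  define F2 where "F2 t = c * (b / 2) * (b / 2 - 1) * t powr (b / 2 - 2)" for t
  have F_der: "(F has_real_derivative F1 t) (at t)" if "t > 0" for t
    unfolding F_def F1_def using that by (auto intro!: derivative_eq_intros)
  have F1_der: "(F1 has_real_derivative F2 t) (at t)" if "t > 0" for t
    unfolding F1_def F2_def using that by (auto intro!: derivative_eq_intros)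
  define \<phi> where "\<phi> x = F (Y x)" for x
  have \<phi>_eq: "\<phi> z = c * \<rho> z powr b - k" for z
    unfolding \<phi>_def F_def \<rho>Y using Y0[of z] by (simp add: powr_half_sqrt[symmetric] powr_powr)
  define U where "U = {z \<in> ball w R. \<rho> z > s}"
  have Yc: "continuous_on S Y" for S unfolding Y_def by (intro continuous_intros)
  have \<rho>c: "continuous_on S \<rho>" for S unfolding \<rho>Y by (intro continuous_intros Yc)
  have \<phi>c: "continuous_on UNIV \<phi>"
    unfolding \<phi>_def F_def using b0 Y0 by (intro continuous_intros continuous_on_powr' Yc) auto
  have "open ({z. \<rho> z > s} \<inter> ball w R)"
    by (intro open_Int open_Collect_less continuous_on_const \<rho>c open_ball)
  then have U: "open U" "U \<subseteq> G" using G by (auto simp: U_def Int_def conj_commute)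
  have \<rho>pos: "Y z > 0" if "z \<in> U" for z
    using that s Y0[of z] by (auto simp: U_def \<rho>Y intro: ccontr)
  have Ypos: "z \<in> U \<Longrightarrow> (\<Sum>a\<in>B. (a \<bullet> (z - w))\<^sup>2) > 0" for z using \<rho>pos by (simp add: Y_def)
  have F1pos: "F1 (Y z) > 0" if "z \<in> U" for z
    using c b0 \<rho>pos[OF that] by (auto simp: F1_def intro!: mult_pos_pos)
  have sY: "smooth_on U Y" unfolding Y_def[abs_def] using B(1) by (intro smooth_on_sum_squares U) (simp add: orthonormal_def)
  have sp: "smooth_on U (\<lambda>x. Y x powr a)" for a by (intro smooth_on_powr U sY \<rho>pos)
  have sF: "smooth_on U (\<lambda>x. F (Y x))" "smooth_on U (\<lambda>x. F1 (Y x))"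
    unfolding F_def F1_def by (intro smooth_on_diff smooth_on_mult smooth_on_const U sp)+
  have \<phi>_eq0: "\<phi> = (\<lambda>x. F (Y x) + 0 * ((x - w) \<bullet> (x - w) - Y x))" by (simp add: \<phi>_def[abs_def])
  note flux = p_flux_of_squared_distances[OF B(1) U(1) Ypos F_der F1_der F1pos[unfolded Y_def] sF[unfolded Y_def]]
  have \<phi>_smooth: "smooth_on U \<phi>" using sF(1) by (simp add: \<phi>_def[abs_def])
  have X_C1: "C1_field_on U (p_flux p \<phi>)"
    unfolding \<phi>_eq0 Y_def by (rule flux(2))
  have divX: "\<exists>K>0. divergence (p_flux p \<phi>) z = K *
       ((F1 (Y z))\<^sup>2 * Y z * ((p - 1) * (2 * Y z * F2 (Y z) + F1 (Y z)) + (real (card B) - 1) * F1 (Y z) + 0 * real (CARD('n) - card B))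
        + 0\<^sup>2 * ((z - w) \<bullet> (z - w) - Y z) * ((2 * Y z * F2 (Y z) + F1 (Y z)) + (real (card B) - 1) * F1 (Y z) + 0 * (real (CARD('n) - card B) + p - 2)))"
    if "z \<in> U" for z
    unfolding \<phi>_eq0 Y_def by (rule flux(3)) (simp_all add: that)
  have div: "divergence (p_flux p \<phi>) z > 0" if z: "z \<in> U" for z
  proof -
    obtain K where K: "K > 0" "divergence (p_flux p \<phi>) z =
        K * ((F1 (Y z))\<^sup>2 * Y z * ((p - 1) * (2 * Y z * F2 (Y z) + F1 (Y z)) + (real (card B) - 1) * F1 (Y z)))"
      using divX[OF z] by auto
    have Yp: "Y z * Y z powr (b / 2 - 2) = Y z powr (b / 2 - 1)" using \<rho>pos[OF z] by (simp add: powr_mult_base)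
    have "2 * Y z * F2 (Y z) = (b - 2) * (c * (b / 2) * (Y z * Y z powr (b / 2 - 2)))" unfolding F2_def by (simp add: field_simps)
    then have "2 * Y z * F2 (Y z) = (b - 2) * F1 (Y z)" unfolding Yp F1_def .
    then have Tz: "2 * Y z * F2 (Y z) + F1 (Y z) = (b - 1) * F1 (Y z)" by (simp add: algebra_simps)
    have "(p - 1) * (2 * Y z * F2 (Y z) + F1 (Y z)) + (real (card B) - 1) * F1 (Y z) = ((p - 1) * b - (p - card B)) * F1 (Y z)"
      unfolding Tz by (simp add: algebra_simps)
    moreover have "(p - 1) * b - (p - card B) > 0" using b p1 by (simp add: divide_less_eq mult.commute)
    ultimately show ?thesis unfolding K(2) using K(1) F1pos[OF z] \<rho>pos[OF z] by simp
  qed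
  define S where "S = {z \<in> U. u z < \<phi> z}"
  have Sb: "bounded S" by (rule bounded_subset[of "ball w R"]) (auto simp: S_def U_def)
  have clS: "closure S \<subseteq> U"
  proof
    fix z assume "z \<in> closure S"
    then obtain X where X: "\<And>n. X n \<in> S" "X \<longlonglongrightarrow> z" unfolding closure_sequential by blast
    have \<phi>lim: "(\<lambda>n. \<phi> (X n)) \<longlonglongrightarrow> \<phi> z" using \<phi>c X(2) by (rule continuous_on_tendsto_compose) auto
    have "(\<lambda>n. \<rho> (X n)) \<longlonglongrightarrow> \<rho> z" using \<rho>c[of UNIV] X(2) by (rule continuous_on_tendsto_compose) auto
    then have \<rho>z: "s \<le> \<rho> z" by (rule LIMSEQ_le_const) (use X(1) in \<open>auto simp: S_def U_def intro: less_imp_le\<close>)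
    have "(\<lambda>n. dist w (X n)) \<longlonglongrightarrow> dist w z" using X(2) by (intro tendsto_intros)
    then have dz: "dist w z \<le> R" by (rule LIMSEQ_le_const2) (use X(1) in \<open>auto simp: S_def U_def intro: less_imp_le\<close>)
    have "\<phi> z \<ge> 0"
    proof (rule LIMSEQ_le_const[OF \<phi>lim])
      have "0 \<le> \<phi> (X n)" for n using X(1)[of n] u(2)[of "X n"] U(2) unfolding S_def by force
      then show "\<exists>N. \<forall>n\<ge>N. 0 \<le> \<phi> (X n)" by blast
    qed
    then have "s powr b < \<rho> z powr b" using e c by (simp add: \<phi>_eq k_def) (smt (verit) mult_le_cancel_left_pos)
    then have \<rho>z': "s < \<rho> z" using \<rho>z by (cases "s = \<rho> z") auto
    show "z \<in> U"
    proof (rule ccontr)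
      assume zU: "z \<notin> U"
      then have "dist w z = R" using dz \<rho>z' by (auto simp: U_def)
      then have fr: "z \<in> frontier (ball w R)" using R by (simp add: frontier_ball)
      have "Y z \<le> R\<^sup>2"
        using bessel[OF B(1), of "z - w"] \<open>dist w z = R\<close> by (simp add: Y_def dot_square_norm dist_norm norm_minus_commute)
      then have "\<rho> z \<le> R" unfolding \<rho>Y using R by (simp add: real_le_lsqrt)
      then have "\<rho> z powr b \<le> R powr b" using b0 s \<rho>z by (intro powr_mono2) auto
      then have "c * \<rho> z powr b \<le> 1" using R by (simp add: c_def divide_le_eq)
      moreover have "0 \<le> c * s powr b" using c by simp
      ultimately have \<phi>z: "\<phi> z \<le> 1 - e" by (simp add: \<phi>_eq k_def)
      have "ereal (1 - e / 2) < 1" using e by (simp add: one_ereal_def)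
      then have "eventually (\<lambda>y. ereal (1 - e / 2) < ereal (u y)) (at z within G)"
        using bd[OF fr \<rho>z'] unfolding le_Liminf_iff by blast
      then have ev: "eventually (\<lambda>y. 1 - e / 2 < u y) (at z within G)" by simp
      have "filterlim X (at z within G) sequentially"
        unfolding filterlim_at using X zU U(2) by (auto simp: S_def intro!: always_eventually)
      then have "eventually (\<lambda>n. 1 - e / 2 < u (X n)) sequentially"
        using ev by (rule eventually_compose_filterlim[rotated])
      moreover have "eventually (\<lambda>n. \<phi> (X n) < 1 - e / 2) sequentially"
        using \<phi>z e by (intro order_tendstoD(2)[OF \<phi>lim]) auto
      ultimately have "eventually (\<lambda>n. False) sequentially"
      proof eventually_elim
        case (elim n)
        then show ?case using X(1)[of n] by (simp add: S_def)
      qed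
      then show False by simp
    qed
  qed
  have K: "compact (closure S)" using Sb by simp
  have "\<phi> x \<le> u x"
  proof (rule strict_subsolution_le_p_superharmonic[OF p1 u(1) U \<phi>_smooth X_C1 div K clS])
    show "x \<in> U" using x by (simp add: U_def)
    show "\<phi> z \<le> u z" if "z \<in> U - closure S" for z
      using that closure_subset[of S] by (auto simp: S_def not_less)
  qed
  then show "(\<rho> x powr b - s powr b) / R powr b \<le> u x + e"
    by (simp add: \<phi>_eq k_def c_def diff_divide_distrib)
qed

lemma p_superharmonic_lower_bound:
  fixes B :: "(real^'n::finite) set" and w :: "real^'n" and p R s :: real
  defines "\<rho> \<equiv> \<lambda>x. sqrt (\<Sum>a\<in>B. (a \<bullet> (x - w))\<^sup>2)" and "\<beta> \<equiv> (p - card B) / (p - 1)"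
  assumes B: "orthonormal B" "1 \<le> card B" and p: "p > real (card B)" and R: "R > 0" and s: "s > 0"
    and G: "\<And>x. x \<in> ball w R \<Longrightarrow> \<rho> x > s \<Longrightarrow> x \<in> G"
    and u: "p_superharmonic p G u" "\<And>x. x \<in> G \<Longrightarrow> 0 \<le> u x"
    and bd: "\<And>y. y \<in> frontier (ball w R) \<Longrightarrow> \<rho> y > s \<Longrightarrow> Liminf (at y within G) (\<lambda>z. ereal (u z)) \<ge> 1"
    and x: "x \<in> ball w R" "\<rho> x > s"
  shows "(\<rho> x powr \<beta> - s powr \<beta>) / R powr \<beta> \<le> u x"
proof (rule tendsto_upperbound)
  show "((\<lambda>b. (\<rho> x powr b - s powr b) / R powr b) \<longlongrightarrow> (\<rho> x powr \<beta> - s powr \<beta>) / R powr \<beta>) (at_right \<beta>)"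
    using R s x(2) by (intro tendsto_intros) auto
  have "eventually (\<lambda>b. \<beta> < b) (at_right \<beta>)" by (simp add: eventually_at_right_less)
  then show "eventually (\<lambda>b. (\<rho> x powr b - s powr b) / R powr b \<le> u x) (at_right \<beta>)"
  proof eventually_elim
    case (elim b)
    show ?case
      unfolding \<rho>_def
      by (rule p_superharmonic_lower_bound_strict[OF B p R s elim[unfolded \<beta>_def] G[unfolded \<rho>_def] u bd[unfolded \<rho>_def] x[unfolded \<rho>_def]])
  qed
qed simp

section \<open>Cones and absolutely minimizing functions\<close>

text \<open>
Together with the next lemma, this finds boundary points of \<open>V\<close> on both sides of \<open>x\<close> on the ray from \<open>z\<close>.
\<close>

lemma segment_meets_frontier:
  fixes V :: "'a::real_normed_vector set"
  assumes "open V" "x \<in> V" "z \<notin> V"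
  obtains a where "0 \<le> a" "a < 1" "z + a *\<^sub>R (x - z) \<in> frontier V"
proof -
  have "closed_segment z x \<inter> frontier V \<noteq> {}"
    using assms by (intro connected_Int_frontier) (auto simp: disjoint_iff)
  then obtain a where a: "0 \<le> a" "a \<le> 1" "(1 - a) *\<^sub>R z + a *\<^sub>R x \<in> frontier V"
    by (auto simp: in_segment)
  have eq: "(1 - a) *\<^sub>R z + a *\<^sub>R x = z + a *\<^sub>R (x - z)" by (simp add: algebra_simps)
  have "a \<noteq> 1" using a(3) assms(1,2) by (auto simp: frontier_def interior_open)
  then show ?thesis using that[of a] a unfolding eq by simp
qed

lemma ray_meets_frontier:
  fixes V :: "'a::real_normed_vector set"
  assumes "open V" "bounded V" "x \<in> V" "x \<noteq> z"
  obtains b where "b > 1" "z + b *\<^sub>R (x - z) \<in> frontier V"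
proof -
  let ?f = "\<lambda>b::real. z + b *\<^sub>R (x - z)"
  have c: "connected (?f ` {1..})" by (intro connected_continuous_image continuous_intros) auto
  obtain M where M: "\<And>y. y \<in> V \<Longrightarrow> dist z y \<le> M" using assms(2) bounded_any_center[of V z] by blast
  define b0 where "b0 = 1 + \<bar>M\<bar> / norm (x - z)"
  have n: "norm (x - z) > 0" using assms(4) by simp
  have "dist z (?f b0) = b0 * norm (x - z)" using n by (simp add: dist_norm b0_def)
  also have "\<dots> = norm (x - z) + \<bar>M\<bar>" using n by (simp add: b0_def distrib_right)
  finally have far: "dist z (?f b0) = norm (x - z) + \<bar>M\<bar>" .
  have "?f b0 \<notin> V"
  proof
    assume "?f b0 \<in> V"
    then have "norm (x - z) + \<bar>M\<bar> \<le> M" using M far by fastforce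
    then show False using n by linarith
  qed
  moreover have "b0 \<ge> 1" using n by (simp add: b0_def)
  moreover have "?f 1 \<in> V" using assms(3) by simp
  ultimately have "?f ` {1..} \<inter> frontier V \<noteq> {}"
    by (intro connected_Int_frontier[OF c]) auto
  then obtain b where b: "b \<ge> 1" "?f b \<in> frontier V" by auto
  have "b \<noteq> 1" using b(2) assms(1,3) by (auto simp: frontier_def interior_open)
  then show ?thesis using that[of b] b by simp
qed

text \<open>
The distance to \<open>w\<close> has slope one along rays, so two points on a ray detect the exact constant.
\<close>

lemma lipschitz_on_cone_iff:
  fixes V :: "(real^'n::finite) set"
  assumes R: "R > 0" and x: "x \<noteq> w" and ab: "0 \<le> a" "a < b" "w + a *\<^sub>R (x - w) \<in> V" "w + b *\<^sub>R (x - w) \<in> V"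
  shows "L-lipschitz_on V (\<lambda>x. dist x w / R) \<longleftrightarrow> 1 / R \<le> L"
proof
  assume L: "L-lipschitz_on V (\<lambda>x. dist x w / R)"
  have n: "norm (x - w) > 0" using x by simp
  let ?p = "w + a *\<^sub>R (x - w)" and ?q = "w + b *\<^sub>R (x - w)"
  have d: "dist ?q w = b * norm (x - w)" "dist ?p w = a * norm (x - w)"
    using ab by (simp_all add: dist_norm)
  have "?q - ?p = (b - a) *\<^sub>R (x - w)" by (simp add: algebra_simps)
  then have d2: "dist ?q ?p = (b - a) * norm (x - w)" using ab by (simp add: dist_norm)
  have pos: "(b - a) * norm (x - w) > 0" using ab n by simp
  have "b * norm (x - w) / R - a * norm (x - w) / R = 1 / R * ((b - a) * norm (x - w))"
    by (simp add: algebra_simps diff_divide_distrib)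
  moreover have "0 \<le> 1 / R * ((b - a) * norm (x - w))" using pos R by simp
  ultimately have "dist (dist ?q w / R) (dist ?p w / R) = 1 / R * ((b - a) * norm (x - w))"
    unfolding d dist_real_def by (simp only: abs_of_nonneg)
  then have "1 / R * ((b - a) * norm (x - w)) \<le> L * ((b - a) * norm (x - w))"
    using lipschitz_onD[OF L ab(4,3)] unfolding d2 by simp
  then show "1 / R \<le> L" using pos by (rule mult_right_le_imp_le)
next
  assume L: "1 / R \<le> L"
  have L0: "0 \<le> L" using L R by (meson divide_nonneg_pos less_eq_real_def order_trans zero_le_one)
  show "L-lipschitz_on V (\<lambda>x. dist x w / R)"
  proof (rule lipschitz_onI[OF _ L0])
    fix y z
    have "dist (dist y w / R) (dist z w / R) = \<bar>dist y w - dist z w\<bar> * (1 / R)"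
      using R by (simp add: dist_real_def diff_divide_distrib[symmetric])
    also have "\<dots> \<le> dist y z * L"
      using L R abs_dist_diff_le[of y w z] by (intro mult_mono) (auto simp: dist_commute)
    finally show "dist (dist y w / R) (dist z w / R) \<le> L * dist y z" by (simp add: mult.commute)
  qed
qed

text \<open>
Both \<open>V\<close> and its frontier contain two points of a ray from the vertex.
\<close>

lemma absolutely_minimizing_cone:
  fixes G :: "(real^'n::finite) set"
  assumes R: "R > 0" and w: "w \<notin> G"
  shows "absolutely_minimizing G (\<lambda>x. dist x w / R)"
  unfolding absolutely_minimizing_def
proof (intro conjI allI impI)
  show "continuous_on G (\<lambda>x. dist x w / R)" using R by (intro continuous_intros) auto
  fix V assume "open V \<and> bounded V \<and> closure V \<subseteq> G"
  then have V: "open V" "bounded V" "closure V \<subseteq> G" by auto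
  show "lipschitz_constant V (\<lambda>x. dist x w / R) = lipschitz_constant (frontier V) (\<lambda>x. dist x w / R)"
  proof (cases "V = {}")
    case False
    then obtain x where x: "x \<in> V" by blast
    have wV: "w \<notin> V" using w V(3) closure_subset by blast
    then have xw: "x \<noteq> w" using x by blast
    obtain a where a: "0 \<le> a" "a < 1" "w + a *\<^sub>R (x - w) \<in> frontier V"
      using segment_meets_frontier[OF V(1) x wV] .
    obtain b where b: "b > 1" "w + b *\<^sub>R (x - w) \<in> frontier V"
      using ray_meets_frontier[OF V(1,2) x xw] .
    obtain r where r: "r > 0" "ball x r \<subseteq> V" using V(1) x open_contains_ball by blast
    define t where "t = 1 + r / (2 * norm (x - w))"
    have n: "norm (x - w) > 0" using xw by simp
    have t: "t > 1" using r n by (simp add: t_def)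
    have "w + t *\<^sub>R (x - w) = x + (r / (2 * norm (x - w))) *\<^sub>R (x - w)" by (simp add: t_def algebra_simps)
    then have "dist x (w + t *\<^sub>R (x - w)) = r / 2" using n r by (simp add: dist_norm)
    then have tV: "w + t *\<^sub>R (x - w) \<in> V" using r by auto
    have "L-lipschitz_on V (\<lambda>x. dist x w / R) \<longleftrightarrow> 1 / R \<le> L" for L
      by (rule lipschitz_on_cone_iff[OF R xw _ t _ tV]) (use x in auto)
    moreover have "L-lipschitz_on (frontier V) (\<lambda>x. dist x w / R) \<longleftrightarrow> 1 / R \<le> L" for L
      by (rule lipschitz_on_cone_iff[OF R xw a(1) _ a(3) b(2)]) (use a b in simp)
    ultimately show ?thesis by (simp add: lipschitz_constant_def)
  qed simp
qed

text \<open>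
Comparison with cones from below.  Suppose that \<open>u\<close> is less than \<open>\<phi>\<close>, the cone lowered by \<open>e\<close>, on a nonempty
set \<open>W\<close>.  The closure of \<open>W\<close> lies in \<open>G\<close> and \<open>u = \<phi>\<close> on the frontier of \<open>W\<close>, so the Lipschitz constant
of \<open>u\<close> on \<open>W\<close> is at most the slope of the cone.  But the segment from \<open>x \<in> W\<close> towards the vertex, which is
not in \<open>W\<close>, meets the frontier; from there to \<open>x\<close> the cone drops at full slope, and \<open>u\<close> cannot drop faster.
\<close>

lemma absolutely_minimizing_ge_cone:
  fixes G :: "(real^'n::finite) set"
  assumes u: "absolutely_minimizing G u" "\<And>x. x \<in> G \<Longrightarrow> 0 \<le> u x" and G: "open G" "bounded G"
    and z: "z \<notin> G" and rho: "\<rho> > 0"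
    and bd: "\<And>y. y \<notin> G \<Longrightarrow> y \<in> closure G \<Longrightarrow> dist y z < \<rho> \<Longrightarrow> Liminf (at y within G) (\<lambda>z. ereal (u z)) \<ge> 1"
    and x: "x \<in> G"
  shows "1 - dist x z / \<rho> \<le> u x"
proof (rule field_le_epsilon)
  fix e :: real assume e: "e > 0"
  define \<phi> where "\<phi> y = 1 - dist y z / \<rho> - e" for y
  have \<phi>c: "continuous_on S \<phi>" for S unfolding \<phi>_def using rho by (intro continuous_intros) auto
  have uc: "continuous_on G u" using u(1) by (simp add: absolutely_minimizing_def)
  define W where "W = {y \<in> G. u y < \<phi> y}"
  have "open (G \<inter> (\<lambda>y. \<phi> y - u y) -` {0<..})"
    by (intro continuous_open_preimage continuous_on_diff \<phi>c uc G) auto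
  moreover have "W = G \<inter> (\<lambda>y. \<phi> y - u y) -` {0<..}" by (auto simp: W_def)
  ultimately have W: "open W" by simp
  have WG: "W \<subseteq> G" by (auto simp: W_def)
  have Wb: "bounded W" using G(2) WG bounded_subset by blast
  have clW: "closure W \<subseteq> G"
  proof
    fix y assume "y \<in> closure W"
    then obtain X where X: "\<And>n. X n \<in> W" "X \<longlonglongrightarrow> y" unfolding closure_sequential by blast
    have \<phi>lim: "(\<lambda>n. \<phi> (X n)) \<longlonglongrightarrow> \<phi> y" using \<phi>c[of UNIV] X(2) by (rule continuous_on_tendsto_compose) auto
    have "0 \<le> \<phi> y"
    proof (rule LIMSEQ_le_const[OF \<phi>lim])
      have "0 \<le> \<phi> (X n)" for n using X(1)[of n] u(2)[of "X n"] unfolding W_def by force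
      then show "\<exists>N. \<forall>n\<ge>N. 0 \<le> \<phi> (X n)" by blast
    qed
    then have "dist y z / \<rho> < 1" using e by (simp add: \<phi>_def)
    then have dy: "dist y z < \<rho>" using rho by (simp add: divide_less_eq)
    show "y \<in> G"
    proof (rule ccontr)
      assume yG: "y \<notin> G"
      have "y \<in> closure G" using \<open>y \<in> closure W\<close> closure_mono[OF WG] by blast
      moreover have "ereal (1 - e / 2) < 1" using e by (simp add: one_ereal_def)
      ultimately have "eventually (\<lambda>v. ereal (1 - e / 2) < ereal (u v)) (at y within G)"
        using bd[OF yG _ dy] unfolding le_Liminf_iff by blast
      then have ev: "eventually (\<lambda>v. 1 - e / 2 < u v) (at y within G)" by simp
      have "filterlim X (at y within G) sequentially"
        unfolding filterlim_at using X yG by (auto simp: W_def intro!: always_eventually)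
      then have "eventually (\<lambda>n. 1 - e / 2 < u (X n)) sequentially"
        using ev by (rule eventually_compose_filterlim[rotated])
      then obtain n where "1 - e / 2 < u (X n)" using eventually_happens' sequentially_bot by blast
      moreover have "u (X n) < \<phi> (X n)" using X(1)[of n] by (simp add: W_def)
      moreover have "0 \<le> dist (X n) z / \<rho>" using rho by simp
      ultimately show False using e by (simp add: \<phi>_def)
    qed
  qed
  have fr_eq: "u y = \<phi> y" if "y \<in> frontier W" for y
  proof (rule antisym)
    have yc: "y \<in> closure W" "y \<notin> W" using that W by (auto simp: frontier_def interior_open)
    then show "\<phi> y \<le> u y" using clW by (auto simp: W_def)
    obtain X where X: "\<And>n. X n \<in> W" "X \<longlonglongrightarrow> y" using yc(1) unfolding closure_sequential by blast
    have \<phi>lim: "(\<lambda>n. \<phi> (X n)) \<longlonglongrightarrow> \<phi> y" using \<phi>c[of UNIV] X(2) by (rule continuous_on_tendsto_compose) auto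
    have ulim: "(\<lambda>n. u (X n)) \<longlonglongrightarrow> u y"
      using uc X(2) by (rule continuous_on_tendsto_compose) (use yc clW X(1) WG in \<open>auto intro!: always_eventually\<close>)
    show "u y \<le> \<phi> y"
      by (rule LIMSEQ_le[OF ulim \<phi>lim]) (use X(1) in \<open>auto simp: W_def intro: less_imp_le\<close>)
  qed
  have \<phi>_lip: "(1 / \<rho>)-lipschitz_on S \<phi>" for S
  proof (rule lipschitz_onI)
    fix a b
    have "dist (\<phi> a) (\<phi> b) = \<bar>dist a z - dist b z\<bar> * (1 / \<rho>)"
      using rho by (simp add: \<phi>_def dist_real_def diff_divide_distrib[symmetric] abs_minus_commute)
    also have "\<dots> \<le> dist a b * (1 / \<rho>)" using rho abs_dist_diff_le[of a z b] by (intro mult_right_mono) (auto simp: dist_commute)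
    finally show "dist (\<phi> a) (\<phi> b) \<le> 1 / \<rho> * dist a b" by (simp add: mult.commute)
  qed (use rho in simp)
  have "(1 / \<rho>)-lipschitz_on (frontier W) u"
    using \<phi>_lip[of "frontier W"] fr_eq by (simp add: lipschitz_on_def)
  then have "lipschitz_constant (frontier W) u \<le> ennreal (1 / \<rho>)"
    unfolding lipschitz_constant_def by (intro INF_lower) auto
  then have lipW: "lipschitz_constant W u \<le> ennreal (1 / \<rho>)"
    using u(1) W Wb clW unfolding absolutely_minimizing_def by auto
  have W_lip: "dist (u a) (u b) \<le> 1 / \<rho> * dist a b" if "a \<in> W" "b \<in> W" for a b
  proof (rule ccontr)
    assume "\<not> ?thesis"
    then have less: "1 / \<rho> * dist a b < dist (u a) (u b)" by simp
    have ab: "dist a b > 0" using less by (cases "a = b") auto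
    define L' where "L' = dist (u a) (u b) / dist a b"
    have "1 / \<rho> < L'" using less ab by (simp add: L'_def less_divide_eq)
    then have "ennreal (1 / \<rho>) < ennreal L'" using rho by (intro ennreal_lessI) (auto intro: less_trans[of 0 "1 / \<rho>"])
    then have "lipschitz_constant W u < ennreal L'" using lipW by (rule le_less_trans[rotated])
    then obtain L where L: "L-lipschitz_on W u" "ennreal L < ennreal L'"
      unfolding lipschitz_constant_def INF_less_iff by auto
    have "L \<ge> 0" using L(1) by (simp add: lipschitz_on_def)
    then have "L < L'" using L(2) by (simp add: ennreal_less_iff)
    moreover have "dist (u a) (u b) \<le> L * dist a b" using L(1) that by (simp add: lipschitz_onD)
    then have "L' \<le> L" using ab by (simp add: L'_def divide_le_eq)
    ultimately show False by simp
  qed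
  have "x \<notin> W"
  proof
    assume xW: "x \<in> W"
    have zW: "z \<notin> W" using z WG by blast
    obtain a where a: "0 \<le> a" "a < 1" "z + a *\<^sub>R (x - z) \<in> frontier W"
      using segment_meets_frontier[OF W xW zW] .
    let ?y = "z + a *\<^sub>R (x - z)"
    have yc: "?y \<in> closure W" using a(3) by (simp add: frontier_def)
    then obtain X where X: "\<And>n. X n \<in> W" "X \<longlonglongrightarrow> ?y" unfolding closure_sequential by blast
    have "(\<lambda>n. u (X n)) \<longlonglongrightarrow> u ?y"
      using uc X(2) by (rule continuous_on_tendsto_compose) (use yc clW X(1) WG in \<open>auto intro!: always_eventually\<close>)
    then have le: "dist (u x) (u ?y) \<le> 1 / \<rho> * dist x ?y"
      by (intro LIMSEQ_le[OF tendsto_dist[OF tendsto_const] tendsto_mult[OF tendsto_const tendsto_dist[OF tendsto_const X(2)]]])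
        (use W_lip[OF xW X(1)] in auto)
    have "x - ?y = (1 - a) *\<^sub>R (x - z)" by (simp add: algebra_simps)
    then have d: "dist x ?y = (1 - a) * dist x z" using a by (simp add: dist_norm)
    have "1 / \<rho> * ((1 - a) * dist x z) = dist x z / \<rho> - a * dist x z / \<rho>"
      by (simp add: algebra_simps diff_divide_distrib)
    then have "u ?y - u x \<le> dist x z / \<rho> - a * dist x z / \<rho>"
      using le unfolding d dist_real_def by simp
    moreover have "u ?y = 1 - a * dist x z / \<rho> - e" using fr_eq[OF a(3)] a by (simp add: \<phi>_def dist_norm)
    ultimately have "u x \<ge> 1 - dist x z / \<rho> - e" by simp
    then show False using xW by (simp add: W_def \<phi>_def)
  qed
  then show "1 - dist x z / \<rho> \<le> u x + e" using x by (simp add: W_def \<phi>_def not_less)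
qed

section \<open>Bounds for the harmonic measure\<close>

lemma p_harmonic_measure_le:
  assumes "if p = \<infinity> then absolutely_minimizing G u else p_superharmonic (real_of_ereal p) G u"
    and "\<And>z. z \<in> G \<Longrightarrow> 0 \<le> u z" and "\<And>y. y \<in> E \<Longrightarrow> Liminf (at y within G) (\<lambda>z. ereal (u z)) \<ge> 1" and "x \<in> G"
  shows "p_harmonic_measure p G E x \<le> u x"
  unfolding p_harmonic_measure_def
  by (rule cINF_lower) (use assms in \<open>auto intro!: bdd_belowI[of _ 0]\<close>)

lemma p_harmonic_measure_ge:
  assumes "if p = \<infinity> then absolutely_minimizing G v else p_superharmonic (real_of_ereal p) G v"
    and "\<And>z. z \<in> G \<Longrightarrow> 0 \<le> v z" and "\<And>y. y \<in> E \<Longrightarrow> Liminf (at y within G) (\<lambda>z. ereal (v z)) \<ge> 1"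
    and "\<And>u. (if p = \<infinity> then absolutely_minimizing G u else p_superharmonic (real_of_ereal p) G u) \<Longrightarrow>
      (\<And>z. z \<in> G \<Longrightarrow> 0 \<le> u z) \<Longrightarrow> (\<And>y. y \<in> E \<Longrightarrow> Liminf (at y within G) (\<lambda>z. ereal (u z)) \<ge> 1) \<Longrightarrow> a \<le> u x"
  shows "a \<le> p_harmonic_measure p G E x"
  unfolding p_harmonic_measure_def
proof (rule cINF_greatest)
  show "{u. (if p = \<infinity> then absolutely_minimizing G u else p_superharmonic (real_of_ereal p) G u) \<and>
      (\<forall>z\<in>G. 0 \<le> u z) \<and> (\<forall>y\<in>E. Liminf (at y within G) (\<lambda>z. ereal (u z)) \<ge> 1)} \<noteq> {}"
    using assms(1,2,3) by blast
qed (use assms(4) in blast)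

context
  fixes \<Lambda> \<Omega> :: "(real^'n::finite) set" and w A :: "real^'n" and m :: nat and s r :: real and B :: "(real^'n) set"
  assumes \<Lambda>: "affine \<Lambda>" "w \<in> \<Lambda>"
    and B: "orthonormal B" "1 \<le> card B" "\<And>x. infdist x \<Lambda> = sqrt (\<Sum>b\<in>B. (b \<bullet> (x - w))\<^sup>2)"
    and \<Omega>: "open \<Omega>" "\<Lambda> \<subseteq> - \<Omega>" "- \<Omega> \<subseteq> tube \<Lambda> s"
    and s: "0 < s" and r: "2 * s < r"
    and A: "infdist A \<Lambda> = 2 * s" "A \<in> frontier (ball w (2 * s))"
begin

lemma dist_A: "norm (A - w) = 2 * s"
  using A(2) s by (simp add: frontier_ball dist_norm norm_minus_commute)

lemma outside_tube: "infdist x \<Lambda> > s \<Longrightarrow> x \<in> \<Omega>"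
  using \<Omega>(3) by (force simp: tube_def)

lemma off_hyperplane: "x \<in> \<Omega> \<Longrightarrow> (\<Sum>b\<in>B. (b \<bullet> (x - w))\<^sup>2) > 0"
proof -
  assume x: "x \<in> \<Omega>"
  then have "x \<notin> \<Lambda>" using \<Omega>(2) by blast
  moreover have "\<Lambda> \<noteq> {}" using \<Lambda>(2) by blast
  ultimately have "infdist x \<Lambda> \<noteq> 0" using in_closed_iff_infdist_zero[OF affine_closed[OF \<Lambda>(1)]] by blast
  moreover have "(\<Sum>b\<in>B. (b \<bullet> (x - w))\<^sup>2) \<ge> 0" by (intro sum_nonneg) simp
  ultimately show ?thesis unfolding B(3) by (metis less_eq_real_def real_sqrt_zero)
qed

lemma A_in_domain: "A \<in> ball w (5 * r) \<inter> \<Omega>"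
  using dist_A s r outside_tube[of A] A(1) by (simp add: dist_norm norm_minus_commute)

text \<open>
Above: the cone with vertex \<open>w\<close> and value one on the sphere.  Below: the cone with vertex at the point
\<open>z\<close> of the sphere on the ray from \<open>w\<close> through \<open>A\<close>.  Its distance from \<open>\<Lambda>\<close> is \<open>5r\<close>, so points closer to \<open>z\<close>
than \<open>5r - s\<close> are outside the tube.
\<close>

lemma infinity_harmonic_measure_bounds:
  defines "v \<equiv> p_harmonic_measure \<infinity> (ball w (5 * r) \<inter> \<Omega>) (frontier (ball w (5 * r)) - (- \<Omega>)) A"
  shows "s \<le> 5 * (v * r)" "v * r \<le> s"
proof -
  let ?G = "ball w (5 * r) \<inter> \<Omega>" and ?E = "frontier (ball w (5 * r)) - (- \<Omega>)"
  have r0: "r > 0" using s r by simp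
  define c where "c x = dist x w / (5 * r)" for x
  have "w \<notin> ?G" using \<Lambda>(2) \<Omega>(2) by blast
  then have c_min: "absolutely_minimizing ?G c"
    unfolding c_def[abs_def] using r0 by (intro absolutely_minimizing_cone) auto
  have c0: "\<And>z. z \<in> ?G \<Longrightarrow> 0 \<le> c z" using r0 by (simp add: c_def)
  have c1: "Liminf (at y within ?G) (\<lambda>z. ereal (c z)) \<ge> 1" if "y \<in> ?E" for y
  proof -
    have cy: "c y = 1" using that r0 by (auto simp: c_def frontier_ball dist_commute)
    have "isCont c y" unfolding c_def[abs_def] using r0 by (intro continuous_intros) auto
    then have "(c \<longlongrightarrow> c y) (at y within ?G)" using continuous_at_imp_continuous_at_within continuous_within by blast
    then have "((\<lambda>x. ereal (c x)) \<longlongrightarrow> 1) (at y within ?G)" unfolding cy by (simp add: one_ereal_def)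
    then show ?thesis unfolding le_Liminf_iff using order_tendstoD(1) by blast
  qed
  have "v \<le> c A"
    unfolding v_def by (rule p_harmonic_measure_le) (use c_min c0 c1 A_in_domain in auto)
  also have "c A = 2 * s / (5 * r)" by (simp add: c_def dist_norm dist_A)
  finally have "v * r \<le> 2 * s / (5 * r) * r" using r0 by (intro mult_right_mono) auto
  then show "v * r \<le> s" using r0 s by simp
  have "s / (5 * r - s) \<le> v"
    unfolding v_def
  proof (rule p_harmonic_measure_ge[of \<infinity> _ c])
    fix u assume u: "if (\<infinity>::ereal) = \<infinity> then absolutely_minimizing ?G u else p_superharmonic (real_of_ereal \<infinity>) ?G u"
      and u0: "\<And>z. z \<in> ?G \<Longrightarrow> 0 \<le> u z" and u1: "\<And>y. y \<in> ?E \<Longrightarrow> Liminf (at y within ?G) (\<lambda>z. ereal (u z)) \<ge> 1"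
    define k where "k = 5 * r / (2 * s)"
    define z where "z = w + k *\<^sub>R (A - w)"
    have k: "k > 0" "k * (2 * s) = 5 * r" using s r0 by (auto simp: k_def)
    have zw: "dist z w = 5 * r" using k by (simp add: z_def dist_norm dist_A)
    have zL: "infdist z \<Lambda> = 5 * r"
    proof -
      have "(\<Sum>b\<in>B. (b \<bullet> (z - w))\<^sup>2) = k\<^sup>2 * (\<Sum>b\<in>B. (b \<bullet> (A - w))\<^sup>2)"
        by (simp add: z_def power_mult_distrib sum_distrib_left)
      then have "infdist z \<Lambda> = k * infdist A \<Lambda>" unfolding B(3) using k by (simp add: real_sqrt_mult)
      then show ?thesis using A(1) k by simp
    qed
    have "1 - dist A z / (5 * r - s) \<le> u A"
    proof (rule absolutely_minimizing_ge_cone[of ?G u z "5 * r - s" A])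
      show "absolutely_minimizing ?G u" using u by simp
      show "open ?G" "bounded ?G" using \<Omega>(1) by (auto intro: bounded_subset[OF bounded_ball])
      show "z \<notin> ?G" using zw by (simp add: dist_commute)
      show "0 < 5 * r - s" using s r by simp
      show "A \<in> ?G" by (rule A_in_domain)
      show "Liminf (at y within ?G) (\<lambda>z. ereal (u z)) \<ge> 1" if y: "y \<notin> ?G" "y \<in> closure ?G" "dist y z < 5 * r - s" for y
      proof (rule u1)
        have "infdist z \<Lambda> \<le> infdist y \<Lambda> + dist z y" by (rule infdist_triangle)
        then have y\<Omega>: "y \<in> \<Omega>" using y(3) zL by (intro outside_tube) (simp add: dist_commute)
        have "closure ?G \<subseteq> cball w (5 * r)" by (intro closure_minimal) auto
        then have "dist w y = 5 * r" using y(1,2) y\<Omega> by force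
        then show "y \<in> ?E" using y\<Omega> r0 by (simp add: frontier_ball)
      qed
    qed (use u0 in auto)
    moreover have "dist A z = 5 * r - 2 * s"
    proof -
      have "A - z = (1 - k) *\<^sub>R (A - w)" by (simp add: z_def algebra_simps)
      moreover have "k \<ge> 1" using s r by (simp add: k_def)
      ultimately have "dist A z = (k - 1) * (2 * s)" by (simp add: dist_norm dist_A)
      then show ?thesis using k(2) by (simp add: algebra_simps)
    qed
    moreover have "1 - (5 * r - 2 * s) / (5 * r - s) = s / (5 * r - s)" using s r by (simp add: field_simps)
    ultimately show "s / (5 * r - s) \<le> u A" by simp
  qed (use c_min c0 c1 in auto)
  moreover have "s / (5 * r) \<le> s / (5 * r - s)" using s r by (intro divide_left_mono) auto
  ultimately have "s / (5 * r) * r \<le> v * r" using r0 by (intro mult_right_mono) auto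
  then show "s \<le> 5 * (v * r)" using r0 by simp
qed

text \<open>
The lower bounds \<open>b\<^sub>0\<close> and \<open>q\<^sub>0\<close> for \<open>\<beta>\<close> and \<open>p - 1\<close> are parameters of their own, so that one factor can
serve all large \<open>p\<close>.
\<close>

lemma p_harmonic_measure_bounds:
  fixes p b\<^sub>0 q\<^sub>0 :: real
  defines "\<beta> \<equiv> (p - card B) / (p - 1)"
  defines "v \<equiv> p_harmonic_measure (ereal p) (ball w (5 * r) \<inter> \<Omega>) (frontier (ball w (5 * r)) - (- \<Omega>)) A"
  assumes p: "p > real (card B)" and b0: "0 < b\<^sub>0" "b\<^sub>0 \<le> \<beta>" and q0: "0 < q\<^sub>0" "q\<^sub>0 \<le> p - 1"
  shows "(2 powr \<beta> - 1) / 5 powr \<beta> * s powr \<beta> \<le> v * r powr \<beta>"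
    "v * r powr \<beta> \<le> (8 + 4 * (1 + 2 * CARD('n) / q\<^sub>0)) / b\<^sub>0 * s powr \<beta>"
proof -
  let ?G = "ball w (5 * r) \<inter> \<Omega>" and ?E = "frontier (ball w (5 * r)) - (- \<Omega>)"
  define a where "a = (8 + 4 * (1 + 2 * CARD('n) / q\<^sub>0)) / b\<^sub>0"
  have a0: "a \<ge> 0" using b0 q0 by (simp add: a_def)
  have r0: "r > 0" using s r by simp
  have \<beta>0: "\<beta> > 0" using b0 by simp
  have R0: "5 * r > 0" using r0 by simp
  have oG: "open ?G" using \<Omega>(1) by auto
  have G1: "?G \<subseteq> ball w (5 * r)" by simp
  have G3: "(\<Sum>b\<in>B. (b \<bullet> (x - w))\<^sup>2) > 0" if "x \<in> ?G" for x using off_hyperplane that by blast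
  have \<beta>': "\<beta> = (p - card B) / (p - 1)" by (simp add: \<beta>_def)
  note bar = p_harmonic_measure_barrier[OF B(1,2) p R0 oG G1 G3 \<beta>' b0 q0, folded a_def]
  obtain c where c: "p_superharmonic p ?G c" "\<And>x. x \<in> ?G \<Longrightarrow> 0 \<le> c x"
    "\<And>y. y \<in> frontier (ball w (5 * r)) \<Longrightarrow> (\<Sum>b\<in>B. (b \<bullet> (y - w))\<^sup>2) > 0 \<Longrightarrow> Liminf (at y within ?G) (\<lambda>z. ereal (c z)) \<ge> 1"
    "\<And>x. x \<in> ?G \<Longrightarrow> (x - w) \<bullet> (x - w) = (\<Sum>b\<in>B. (b \<bullet> (x - w))\<^sup>2) \<Longrightarrow> c x \<le> a * (norm (x - w) / (5 * r)) powr \<beta>"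
    by (rule bar, assumption) (rule that)
  have cE: "\<And>y. y \<in> ?E \<Longrightarrow> Liminf (at y within ?G) (\<lambda>z. ereal (c z)) \<ge> 1"
    using c(3) off_hyperplane by blast
  have rs: "x * (s / r) powr \<beta> * r powr \<beta> = x * s powr \<beta>" for x
    using r0 s by (simp add: powr_divide)
  have "v \<le> c A"
    unfolding v_def by (rule p_harmonic_measure_le) (use c(1,2) cE A_in_domain in auto)
  also have "c A \<le> a * (norm (A - w) / (5 * r)) powr \<beta>"
  proof (rule c(4)[OF A_in_domain])
    have "sqrt (\<Sum>b\<in>B. (b \<bullet> (A - w))\<^sup>2) = norm (A - w)" using A(1) dist_A B(3) by simp
    then show "(A - w) \<bullet> (A - w) = (\<Sum>b\<in>B. (b \<bullet> (A - w))\<^sup>2)" by (simp add: norm_eq_sqrt_inner)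
  qed
  also have "\<dots> \<le> a * (s / r) powr \<beta>"
    unfolding dist_A using s r0 \<beta>0 a0 by (intro mult_left_mono powr_mono2) (auto simp: field_simps)
  finally have "v * r powr \<beta> \<le> a * (s / r) powr \<beta> * r powr \<beta>" by (intro mult_right_mono) auto
  then show "v * r powr \<beta> \<le> (8 + 4 * (1 + 2 * CARD('n) / q\<^sub>0)) / b\<^sub>0 * s powr \<beta>"
    unfolding rs a_def .
  have "((2 * s) powr \<beta> - s powr \<beta>) / (5 * r) powr \<beta> \<le> v"
    unfolding v_def
  proof (rule p_harmonic_measure_ge[of "ereal p" _ c])
    fix u assume u: "if ereal p = \<infinity> then absolutely_minimizing ?G u else p_superharmonic (real_of_ereal (ereal p)) ?G u"
      and u0: "\<And>z. z \<in> ?G \<Longrightarrow> 0 \<le> u z" and u1: "\<And>y. y \<in> ?E \<Longrightarrow> Liminf (at y within ?G) (\<lambda>z. ereal (u z)) \<ge> 1"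
    have up: "p_superharmonic p ?G u" using u by simp
    have AR: "A \<in> ball w (5 * r)" using A_in_domain by blast
    have As: "s < sqrt (\<Sum>b\<in>B. (b \<bullet> (A - w))\<^sup>2)" using A(1) s by (simp add: B(3))
    have "(sqrt (\<Sum>b\<in>B. (b \<bullet> (A - w))\<^sup>2) powr \<beta> - s powr \<beta>) / (5 * r) powr \<beta> \<le> u A"
      unfolding \<beta>_def
    proof (rule p_superharmonic_lower_bound[OF B(1,2) p R0 s _ up u0 _ AR As])
      show "x \<in> ?G" if "x \<in> ball w (5 * r)" "s < sqrt (\<Sum>a\<in>B. (a \<bullet> (x - w))\<^sup>2)" for x
        using that outside_tube[of x] by (simp add: B(3))
      show "Liminf (at y within ?G) (\<lambda>z. ereal (u z)) \<ge> 1"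
        if "y \<in> frontier (ball w (5 * r))" "s < sqrt (\<Sum>a\<in>B. (a \<bullet> (y - w))\<^sup>2)" for y
        using that outside_tube[of y] by (intro u1) (simp add: B(3))
    qed
    then show "((2 * s) powr \<beta> - s powr \<beta>) / (5 * r) powr \<beta> \<le> u A"
      using A(1) by (simp add: B(3))
  qed (use c(1,2) cE in auto)
  moreover have "((2 * s) powr \<beta> - s powr \<beta>) / (5 * r) powr \<beta> = (2 powr \<beta> - 1) / 5 powr \<beta> * (s / r) powr \<beta>"
    using s r0 by (simp add: powr_mult powr_divide left_diff_distrib)
  ultimately have "(2 powr \<beta> - 1) / 5 powr \<beta> * (s / r) powr \<beta> * r powr \<beta> \<le> v * r powr \<beta>"
    by (intro mult_right_mono) auto
  then show "(2 powr \<beta> - 1) / 5 powr \<beta> * s powr \<beta> \<le> v * r powr \<beta>" unfolding rs .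
qed

end

theorem theorem1:
  fixes \<delta>\<^sub>c :: "real \<Rightarrow> ereal \<Rightarrow> real"
  assumes "critical_delta TYPE('n::finite) \<delta>\<^sub>c"
  shows "\<exists>c :: ereal \<Rightarrow> real.
    (\<forall>p. 1 \<le> c p) \<and>
    (\<exists>P :: real. \<forall>p \<ge> ereal P. c p = c \<infinity>) \<and>
    (\<forall>(m :: nat) (\<Lambda> :: (real^'n) set) (w :: real^'n) (p :: ereal) (\<beta> :: real) (\<gamma> :: real)
       (\<Omega> :: (real^'n) set) (s :: real) (r :: real) (A :: real^'n).
       m \<le> CARD('n) - 1 \<and>
       hyperplane_of_dim m \<Lambda> \<and> w \<in> \<Lambda> \<and>
       ereal (real CARD('n) - real m) < p \<and>
       \<beta> = beta_exponent CARD('n) m p \<and> 0 < \<gamma> \<and> \<gamma> < \<beta> \<and>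
       open \<Omega> \<and> connected \<Omega> \<and> \<not> bounded \<Omega> \<and>
       0 < s \<and> \<Lambda> \<subseteq> - \<Omega> \<and> - \<Omega> \<subseteq> tube \<Lambda> s \<and>
       2 * s / \<delta>\<^sub>c \<gamma> p < r \<and>
       infdist A \<Lambda> = 2 * s \<and> A \<in> frontier (ball w (2 * s)) \<longrightarrow>
       (let v = p_harmonic_measure p (ball w (5 * r) \<inter> \<Omega>) (frontier (ball w (5 * r)) - (- \<Omega>))
        in inverse (c p) * s powr \<beta> \<le> v A * r powr \<beta> \<and>
           v A * r powr \<beta> \<le> c p * s powr \<beta>))"
proof -
  define n where "n = real CARD('n)"
  have n1: "n \<ge> 1" unfolding n_def using zero_less_card_finite[where 'a='n] by linarith
  \<comment> \<open>For \<open>p \<ge> 2n + 1\<close> every admissible exponent satisfies \<open>\<beta> \<ge> 1/2\<close>.\<close>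
  define P where "P = 2 * n + 1"
  define a where "a q \<beta> = (8 + 4 * (1 + 2 * n / (q - 1))) / \<beta>" for q \<beta> :: real
  define b where "b \<beta> = 5 powr \<beta> / (2 powr \<beta> - 1)" for \<beta> :: real
  \<comment> \<open>The constants for a single dimension \<open>m\<close>; adding them over \<open>m\<close> serves all dimensions at once.\<close>
  define K where "K q m = \<bar>a q (beta_exponent CARD('n) m (ereal q))\<bar> + \<bar>b (beta_exponent CARD('n) m (ereal q))\<bar>" for q m
  \<comment> \<open>The factor of the barrier for the lower bounds \<open>\<beta> \<ge> 1/2\<close> and \<open>p - 1 \<ge> 1\<close>.\<close>
  define C where "C = 24 + 16 * n"
  define c where "c p = (if ereal P \<le> p then C else C + (\<Sum>m<CARD('n). K (real_of_ereal p) m))" for p :: ereal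
  have K0: "K q m \<ge> 0" for q m by (simp add: K_def)
  have cC: "C \<le> c p" for p using K0 by (simp add: c_def sum_nonneg)
  have C40: "C \<ge> 40" using n1 by (simp add: C_def)
  have c1: "1 \<le> c p" for p using cC[of p] C40 by linarith
  have c_large: "\<exists>P :: real. \<forall>p \<ge> ereal P. c p = c \<infinity>"
    by (intro exI[of _ P]) (simp add: c_def)
  have main: "inverse (c p) * s powr \<beta> \<le> v * r powr \<beta> \<and> v * r powr \<beta> \<le> c p * s powr \<beta>"
    if H: "m \<le> CARD('n) - 1" "hyperplane_of_dim m \<Lambda>" "w \<in> \<Lambda>"
       "ereal (real CARD('n) - real m) < p" "\<beta> = beta_exponent CARD('n) m p"
       "open \<Omega>" "0 < s" "\<Lambda> \<subseteq> - \<Omega>" "- \<Omega> \<subseteq> tube \<Lambda> s" "2 * s / \<delta>\<^sub>c \<gamma> p < r"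
       "infdist A \<Lambda> = 2 * s" "A \<in> frontier (ball w (2 * s))"
       "v = p_harmonic_measure p (ball w (5 * r) \<inter> \<Omega>) (frontier (ball w (5 * r)) - (- \<Omega>)) A"
    for m and \<Lambda> :: "(real^'n) set" and w p \<beta> \<gamma> \<Omega> s r A v
  proof -
    have \<Lambda>: "affine \<Lambda>" using H(2) by (simp add: hyperplane_of_dim_def)
    obtain B where B: "orthonormal B" "card B + m = CARD('n)"
      "\<And>x. infdist x \<Lambda> = sqrt (\<Sum>b\<in>B. (b \<bullet> (x - w))\<^sup>2)"
      using hyperplane_normal_frame[OF H(2,3)] by blast
    have mn: "m < CARD('n)" using H(1) zero_less_card_finite[where 'a='n] by linarith
    have cB: "1 \<le> card B" using B(2) mn by linarith
    have dB: "real (card B) = n - real m" using B(2) unfolding n_def by linarith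
    have \<delta>: "0 < \<delta>\<^sub>c \<gamma> p" "\<delta>\<^sub>c \<gamma> p < 1" using assms by (auto simp: critical_delta_def)
    have "2 * s * 1 \<le> 2 * s / \<delta>\<^sub>c \<gamma> p" using \<delta> H(7) by (simp add: le_divide_eq)
    then have sr: "2 * s < r" using H(10) by linarith
    note ctx = \<Lambda> H(3) B(1) cB B(3) H(6,8,9,7) sr H(11,12)
    show ?thesis
    proof (cases "p = \<infinity>")
      case True
      have \<beta>: "\<beta> = 1" using H(5) True by (simp add: beta_exponent_def)
      have r0: "r > 0" using sr H(7) by linarith
      note inf = infinity_harmonic_measure_bounds[OF ctx, folded H(13)[unfolded True]]
      have "inverse (c p) * s \<le> inverse 5 * s"
        using cC[of p] C40 H(7) by (intro mult_right_mono le_imp_inverse_le) auto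
      also have "\<dots> \<le> v * r" using inf(1) by simp
      finally have lower: "inverse (c p) * s \<le> v * r" .
      have "1 * s \<le> c p * s" using c1[of p] H(7) by (intro mult_right_mono) auto
      then have "v * r \<le> c p * s" using inf(2) by linarith
      with lower show ?thesis using \<beta> r0 H(7) by simp
    next
      case False
      then obtain q where q: "p = ereal q" using H(4) by (cases p) auto
      have qd: "q > real (card B)" using H(4) dB by (simp add: q n_def)
      have q1: "q > 1" using qd cB by linarith
      have \<beta>: "\<beta> = (q - card B) / (q - 1)" unfolding H(5) q dB by (simp add: beta_exponent_def n_def)
      have \<beta>0: "\<beta> > 0" using qd q1 by (simp add: \<beta>)
      have \<beta>1: "\<beta> \<le> 1" using cB q1 by (simp add: \<beta>)
      have v: "v = p_harmonic_measure (ereal q) (ball w (5 * r) \<inter> \<Omega>) (frontier (ball w (5 * r)) - (- \<Omega>)) A"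
        using H(13) q by simp
      have pow: "1 < 2 powr \<beta>" using \<beta>0 by simp
      have "b \<beta> \<le> c p \<and> v * r powr \<beta> \<le> c p * s powr \<beta>"
      proof (cases "P \<le> q")
        case True
        have cp: "c p = C" using True by (simp add: c_def q)
        have dn: "real (card B) \<le> n" using dB by simp
        have half: "1 / 2 \<le> \<beta>" using True q1 dn n1 by (simp add: \<beta> P_def field_simps)
        \<comment> \<open>Here \<open>b \<beta> \<le> 5 / (\<surd>2 - 1)\<close>, which is less than \<open>40\<close>.\<close>
        have "2 powr (1 / 2) \<le> 2 powr \<beta>" using half by (intro powr_mono) auto
        moreover have "(14 / 10 :: real) \<le> sqrt 2" by (rule real_le_rsqrt) (simp add: power2_eq_square)
        then have "(14 / 10 :: real) \<le> 2 powr (1 / 2)" by (simp add: powr_half_sqrt)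
        ultimately have "14 / 10 \<le> 2 powr \<beta>" by linarith
        moreover have "5 powr \<beta> \<le> (5::real) powr 1" using \<beta>1 by (intro powr_mono) auto
        ultimately have "b \<beta> \<le> 5 / (4 / 10)" unfolding b_def by (intro frac_le) auto
        then have "b \<beta> \<le> C" using C40 by simp
        moreover have "v * r powr \<beta> \<le> (8 + 4 * (1 + 2 * CARD('n) / 1)) / (1 / 2) * s powr \<beta>"
          unfolding v \<beta> by (rule p_harmonic_measure_bounds(2)[OF ctx qd]) (use half True n1 in \<open>auto simp: \<beta>[symmetric] P_def\<close>)
        moreover have "(8 + 4 * (1 + 2 * CARD('n) / 1)) / (1 / 2) = C" by (simp add: C_def n_def)
        ultimately show ?thesis by (simp add: cp)
      next
        case False
        have "K q m \<le> (\<Sum>m<CARD('n). K q m)" using mn K0 by (intro member_le_sum) auto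
        then have "K q m \<le> c p" using False C40 by (simp add: c_def q)
        then have ab: "a q \<beta> \<le> c p" "b \<beta> \<le> c p" unfolding K_def H(5) q by linarith+
        have "v * r powr \<beta> \<le> (8 + 4 * (1 + 2 * CARD('n) / (q - 1))) / \<beta> * s powr \<beta>"
          unfolding v \<beta> by (rule p_harmonic_measure_bounds(2)[OF ctx qd]) (use \<beta>0 q1 in \<open>auto simp: \<beta>[symmetric]\<close>)
        also have "\<dots> = a q \<beta> * s powr \<beta>" by (simp add: a_def n_def)
        also have "\<dots> \<le> c p * s powr \<beta>" using ab(1) by (intro mult_right_mono) auto
        finally show ?thesis using ab(2) by simp
      qed
      moreover have "(2 powr \<beta> - 1) / 5 powr \<beta> * s powr \<beta> \<le> v * r powr \<beta>"
        unfolding v \<beta> by (rule p_harmonic_measure_bounds(1)[OF ctx qd _ order_refl _ order_refl]) (use \<beta>0 q1 in \<open>auto simp: \<beta>[symmetric]\<close>)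
      moreover have "inverse (b \<beta>) = (2 powr \<beta> - 1) / 5 powr \<beta>" by (simp add: b_def)
      moreover have "b \<beta> > 0" using pow by (simp add: b_def)
      then have "b \<beta> \<le> c p \<Longrightarrow> inverse (c p) * s powr \<beta> \<le> inverse (b \<beta>) * s powr \<beta>"
        by (intro mult_right_mono le_imp_inverse_le) auto
      ultimately show ?thesis by (metis order_trans)
    qed
  qed
  show ?thesis
    by (rule exI[of _ c]) (use c1 c_large main in \<open>auto simp: Let_def\<close>)
qed

end
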